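(* Let $(G,\sigma)$ be a signed graph with $G$ planar. For every $k\in\{3,4,5,6\}$, if $G$ contains no circuit of length $k$, then $(G,\sigma)$ is $4$-choosable.
   Context: All graphs are finite and simple. A circuit of length $k$ is a cycle on $k$ vertices, occurring as a (not necessarily induced) subgraph. A signed graph is a pair $(G,\sigma)$ where $G$ is a graph and $\sigma: E(G)\to\{1,-1\}$ is a mapping, called a signature of $G$. A proper coloring of $(G,\sigma)$ is a map $c: V(G)\to\mathbb{Z}$ such that $c(u)\neq \sigma(uv)\,c(v)$ for every edge $uv\in E(G)$. A list-assignment is a function $L$ on $V(G)$ with $\emptyset\neq L(v)\subseteq\mathbb{Z}$ for each $v\in V(G)$; it is an $m$-list-assignment if $|L(v)|=m$ for every $v\in V(G)$. An $L$-coloring is a proper coloring $c$ of $(G,\sigma)$ with $c(v)\in L(v)$ for every $v\in V(G)$. $(G,\sigma)$ is $m$-choosable if it has an $L$-coloring for every $m$-list-assignment $L$. *)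

theory Defs
  imports "HOL-Analysis.Analysis"
begin

definition simple_graph :: "'a set \<Rightarrow> 'a set set \<Rightarrow> bool" where
  "simple_graph V E \<longleftrightarrow> finite V \<and> (\<forall>e\<in>E. e \<subseteq> V \<and> card e = 2)"

definition has_circuit :: "'a set \<Rightarrow> 'a set set \<Rightarrow> nat \<Rightarrow> bool" where
  "has_circuit V E k \<longleftrightarrow> 3 \<le> k \<and>
     (\<exists>vs. length vs = k \<and> distinct vs \<and> set vs \<subseteq> V \<and>
       (\<forall>i<k. {vs ! i, vs ! (Suc i mod k)} \<in> E))"

text \<open>The plane is represented by \<^typ>\<open>complex\<close>, the type for which the library
  states the Jordan curve theorem. In a drawing, the interior of each edge contains neither a
  vertex nor a point of another edge.\<close>

definition plane_drawing ::
    "'a set \<Rightarrow> 'a set set \<Rightarrow> ('a \<Rightarrow> complex) \<Rightarrow> ('a set \<Rightarrow> real \<Rightarrow> complex) \<Rightarrow> bool" where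
  "plane_drawing V E p \<gamma> \<longleftrightarrow>
     inj_on p V \<and>
     (\<forall>e\<in>E. arc (\<gamma> e) \<and> {pathstart (\<gamma> e), pathfinish (\<gamma> e)} = p ` e \<and>
            (path_image (\<gamma> e) - p ` e) \<inter> p ` V = {}) \<and>
     (\<forall>e\<in>E. \<forall>f\<in>E. e \<noteq> f \<longrightarrow> (path_image (\<gamma> e) - p ` e) \<inter> path_image (\<gamma> f) = {})"

definition planar_graph :: "'a set \<Rightarrow> 'a set set \<Rightarrow> bool" where
  "planar_graph V E \<longleftrightarrow> (\<exists>p \<gamma>. plane_drawing V E p \<gamma>)"

definition signature :: "'a set set \<Rightarrow> ('a set \<Rightarrow> int) \<Rightarrow> bool" where
  "signature E \<sigma> \<longleftrightarrow> (\<forall>e\<in>E. \<sigma> e \<in> {1, -1})"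

definition proper_coloring :: "'a set set \<Rightarrow> ('a set \<Rightarrow> int) \<Rightarrow> ('a \<Rightarrow> int) \<Rightarrow> bool" where
  "proper_coloring E \<sigma> c \<longleftrightarrow> (\<forall>u v. {u, v} \<in> E \<longrightarrow> c u \<noteq> \<sigma> {u, v} * c v)"

definition list_assignment :: "'a set \<Rightarrow> ('a \<Rightarrow> int set) \<Rightarrow> bool" where
  "list_assignment V L \<longleftrightarrow> (\<forall>v\<in>V. L v \<noteq> {})"

definition m_list_assignment :: "nat \<Rightarrow> 'a set \<Rightarrow> ('a \<Rightarrow> int set) \<Rightarrow> bool" where
  "m_list_assignment m V L \<longleftrightarrow>
     list_assignment V L \<and> (\<forall>v\<in>V. finite (L v) \<and> card (L v) = m)"

definition L_coloring ::
    "'a set \<Rightarrow> 'a set set \<Rightarrow> ('a set \<Rightarrow> int) \<Rightarrow> ('a \<Rightarrow> int set) \<Rightarrow> ('a \<Rightarrow> int) \<Rightarrow> bool" where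
  "L_coloring V E \<sigma> L c \<longleftrightarrow> proper_coloring E \<sigma> c \<and> (\<forall>v\<in>V. c v \<in> L v)"

definition choosable :: "nat \<Rightarrow> 'a set \<Rightarrow> 'a set set \<Rightarrow> ('a set \<Rightarrow> int) \<Rightarrow> bool" where
  "choosable m V E \<sigma> \<longleftrightarrow>
     (\<forall>L. m_list_assignment m V L \<longrightarrow> (\<exists>c. L_coloring V E \<sigma> L c))"

end

theory Submission
  imports Defs "HOL-Complex_Analysis.Winding_Numbers"
begin

text \<open>
  A planar graph without \<open>k\<close>-circuits has a vertex of degree at most three or a small set of vertices of
  degree four from which any colouring of the rest can be extended: for \<open>k = 4\<close> a 5-circuit with a triangle
  on one edge, for \<open>k = 6\<close> two triangles sharing an edge. Removing it gives the colouring by induction;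
  the extension works because each edge of a signed graph forbids, for every colour of one end, just one
  colour of the other end.

  To find the configuration in a graph of minimum degree four, take a smallest vertex set that is attached
  to the rest of the graph along a clique of at most three vertices. The graph on this set together with the
  clique has no separating clique of at most three vertices, so it is 2-connected and each of its triangles
  bounds a face. The faces of a drawing of a 2-connected graph are obtained from an ear decomposition: by the
  Jordan curve theorem for theta graphs an ear splits one face into two. Euler's formula then
  yields a contradiction by discharging; the at most three vertices of the clique can be given a negative final charge.
\<close>

section \<open>Regions of theta curves\<close>

text \<open>Separating triangles are the obstacle: the local arguments build a forbidden circuit
  from faces, so every triangle has to bound one. Restricting to a minimal piece achieves this, but
  the clique along which it hangs loses its degree bound. The loss is affordable since Euler's
  formula leaves a total charge of \<open>- (2 * q)\<close>: with charges degree minus 4 and length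
  minus 4 the total is -8, which three vertices at -2 do not reach. Most transferred amounts are
  exact quotients. A triangle lacks 1, that is 1/3 per side; a 5-face owns 1/5 per edge; a face of
  length n at least 7 owns n - 4, which is at least 3/7 per edge, and faces of length 6 are absent
  where 3/7 is used. Signs do not hinder the reductions. For a fixed edge, multiplication by its
  sign is a bijection of colours, so an end with more available colours than the other end has one
  that blocks none of the other's.\<close>

definition side_of :: "complex set \<Rightarrow> complex set \<Rightarrow> bool" where
  "side_of J R \<longleftrightarrow> R = inside J \<or> R = outside J"

text \<open>An arc is kept as a point set with two ends, so that parametrisation and direction need
  no adjustment when arcs are recombined.\<close>

definition joins_by :: "complex \<Rightarrow> complex \<Rightarrow> complex set \<Rightarrow> bool" where
  "joins_by a b X \<longleftrightarrow> (\<exists>g. arc g \<and> pathstart g = a \<and> pathfinish g = b \<and> path_image g = X)"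

lemma joins_by_commute: "joins_by a b X \<Longrightarrow> joins_by b a X"
  unfolding joins_by_def by (metis arc_reversepath path_image_reversepath pathfinish_reversepath pathstart_reversepath)

lemma joins_by_trans:
  assumes "joins_by a b X" "joins_by b c Y" "X \<inter> Y \<subseteq> {b}"
  shows "joins_by a c (X \<union> Y)"
  using assms unfolding joins_by_def by (metis arc_join path_image_join pathfinish_join pathstart_join)

lemma joins_by_endpoints: "joins_by a b X \<Longrightarrow> a \<in> X \<and> b \<in> X \<and> a \<noteq> b"
  unfolding joins_by_def by (metis arc_distinct_ends pathfinish_in_path_image pathstart_in_path_image)

lemma joins_by_connected_diff: "joins_by a b X \<Longrightarrow> connected (X - {a, b})"
  unfolding joins_by_def by (metis arc_imp_simple_path connected_simple_path_endless)

lemma joins_by_diff_nonempty: "joins_by a b X \<Longrightarrow> X - {a, b} \<noteq> {}"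
  unfolding joins_by_def by (metis arc_imp_simple_path nonempty_simple_path_endless)

text \<open>By continuity of the parametrisation at its two ends. It later shows that an ear drawn
  inside a face has its ends on the boundary of that face.\<close>

lemma joins_by_subset_closure: "joins_by a b X \<Longrightarrow> X \<subseteq> closure (X - {a, b})"
proof -
  assume X: "joins_by a b X"
  then obtain g where g: "arc g" "pathstart g = a" "pathfinish g = b" "path_image g = X"
    by (auto simp: joins_by_def)
  have "g ` closure {0<..<1} \<subseteq> closure (g ` {0<..<1})"
    by (rule continuous_image_closure_subset[where A = "{0..1}"])
      (use g(1) in \<open>auto simp: arc_def path_def\<close>)
  then show ?thesis
    using simple_path_endless[of g] g arc_imp_simple_path[of g] by (simp add: path_image_def)
qed

lemma joins_by_loop:
  assumes "joins_by a b X" "joins_by a b Y" "X \<inter> Y = {a, b}"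
  obtains g where "simple_path g" "pathfinish g = pathstart g" "path_image g = X \<union> Y"
proof -
  obtain g h where "arc g" "pathstart g = a" "pathfinish g = b" "path_image g = X"
    "arc h" "pathstart h = a" "pathfinish h = b" "path_image h = Y"
    using assms by (auto simp: joins_by_def)
  then show thesis
    using assms(3) by (intro that[of "g +++ reversepath h"])
      (auto simp: simple_path_join_loop_eq arc_reversepath path_image_join)
qed

lemma closed_joins_by: "joins_by a b X \<Longrightarrow> closed X"
  by (auto simp: joins_by_def closed_arc_image)

lemma joins_by_Jordan:
  assumes "joins_by a b X" "joins_by a b Y" "X \<inter> Y = {a, b}"
  shows "inside (X \<union> Y) \<noteq> {}" "outside (X \<union> Y) \<noteq> {}"
    "open (inside (X \<union> Y))" "open (outside (X \<union> Y))"
    "connected (inside (X \<union> Y))" "connected (outside (X \<union> Y))"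
    "inside (X \<union> Y) \<inter> outside (X \<union> Y) = {}" "inside (X \<union> Y) \<union> outside (X \<union> Y) = - (X \<union> Y)"
    "frontier (inside (X \<union> Y)) = X \<union> Y" "frontier (outside (X \<union> Y)) = X \<union> Y"
  using Jordan_inside_outside joins_by_loop[OF assms] by metis+

lemma connected_inside_or_outside:
  fixes J :: "complex set"
  assumes "connected T" "T \<inter> J = {}" "closed J"
  shows "T \<subseteq> inside J \<or> T \<subseteq> outside J"
proof -
  have *: "T \<subseteq> inside J \<union> outside J"
    using assms(2) by (auto simp: inside_Un_outside)
  have "inside J \<inter> outside J = {}" by simp
  then show ?thesis
    using connectedD[OF assms(1) open_inside[OF assms(3)] open_outside[OF assms(3)]] *
    by blast
qed

lemma theta_inside:
  assumes 1: "joins_by a b X" and 2: "joins_by a b Y" and 3: "joins_by a b W"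
    and "X \<inter> Y = {a, b}" "X \<inter> W = {a, b}" "Y \<inter> W = {a, b}"
    and W: "W - {a, b} \<subseteq> inside (X \<union> Y)"
  shows "inside (X \<union> W) \<inter> inside (Y \<union> W) = {}"
    "inside (X \<union> W) \<union> inside (Y \<union> W) \<union> (W - {a, b}) = inside (X \<union> Y)"
proof -
  obtain c1 c2 c where c: "arc c1" "pathstart c1 = a" "pathfinish c1 = b" "path_image c1 = X"
    "arc c2" "pathstart c2 = a" "pathfinish c2 = b" "path_image c2 = Y"
    "arc c" "pathstart c = a" "pathfinish c = b" "path_image c = W"
    using 1 2 3 unfolding joins_by_def by metis
  have "path_image c \<inter> inside (path_image c1 \<union> path_image c2) \<noteq> {}"
    using W joins_by_diff_nonempty[OF 3] c by blast
  then show "inside (X \<union> W) \<inter> inside (Y \<union> W) = {}"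
    "inside (X \<union> W) \<union> inside (Y \<union> W) \<union> (W - {a, b}) = inside (X \<union> Y)"
    using split_inside_simple_closed_curve[of c1 a b c2 c] c assms joins_by_endpoints[OF 1]
    by (metis arc_imp_simple_path)+
qed

text \<open>The winding number of a point about \<open>X \<union> Y\<close> is the difference of its winding numbers about
  \<open>X \<union> W\<close> and \<open>Y \<union> W\<close>, so it cannot be enclosed by the first curve alone.\<close>

lemma theta_inside_cover:
  assumes 1: "joins_by a b X" and 2: "joins_by a b Y" and 3: "joins_by a b W"
    and "X \<inter> Y = {a, b}" "X \<inter> W = {a, b}" "Y \<inter> W = {a, b}"
    and q: "q \<in> inside (X \<union> Y)" "q \<in> outside (X \<union> W)" "q \<in> outside (Y \<union> W)"
  shows False
proof -
  obtain c1 c2 c where c: "arc c1" "pathstart c1 = a" "pathfinish c1 = b" "path_image c1 = X"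
    "arc c2" "pathstart c2 = a" "pathfinish c2 = b" "path_image c2 = Y"
    "arc c" "pathstart c = a" "pathfinish c = b" "path_image c = W"
    using 1 2 3 unfolding joins_by_def by metis
  have nq: "q \<notin> X" "q \<notin> Y" "q \<notin> W"
    using q by (auto simp: inside_def outside_def)
  have im: "path_image (c1 +++ reversepath c2) = X \<union> Y" "path_image (c1 +++ reversepath c) = X \<union> W"
    "path_image (c2 +++ reversepath c) = Y \<union> W"
    using c by (auto simp: path_image_join)
  have wn: "winding_number (g +++ reversepath h) q = winding_number g q - winding_number h q"
    if "arc g" "arc h" "pathfinish g = pathfinish h" "q \<notin> path_image g" "q \<notin> path_image h" for g h
    using that by (simp add: winding_number_join winding_number_reversepath arc_imp_path)
  have sp: "simple_path (c1 +++ reversepath c2)"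
    using c assms by (auto simp: simple_path_join_loop_eq arc_reversepath)
  have "winding_number (c1 +++ reversepath c2) q \<noteq> 0"
    using simple_closed_path_winding_number_inside[OF sp] q(1) im(1)
    by (metis zero_neq_one zero_neq_neg_one)
  moreover have "winding_number (c1 +++ reversepath c) q = 0"
    using winding_number_zero_in_outside[of "c1 +++ reversepath c" q] q(2) im(2) c
    by (simp add: arc_imp_path)
  moreover have "winding_number (c2 +++ reversepath c) q = 0"
    using winding_number_zero_in_outside[of "c2 +++ reversepath c" q] q(3) im(3) c
    by (simp add: arc_imp_path)
  ultimately show False
    using wn[of c1 c2] wn[of c1 c] wn[of c2 c] c nq by simp
qed

text \<open>Here \<open>Y\<close> is a chord of the disc bounded by \<open>X \<union> W\<close>, so
  \<open>theta_inside\<close> applies with \<open>Y\<close> and \<open>W\<close> exchanged; taking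
  complements turns its statement about insides into one about outsides.\<close>

lemma theta_outside_aux:
  assumes 1: "joins_by a b X" and 2: "joins_by a b Y" and 3: "joins_by a b W"
    and XY: "X \<inter> Y = {a, b}" and XW: "X \<inter> W = {a, b}" and YW: "Y \<inter> W = {a, b}"
    and Y: "Y - {a, b} \<subseteq> inside (X \<union> W)"
  shows "outside (X \<union> W) \<inter> inside (Y \<union> W) = {}"
    "outside (X \<union> W) \<union> inside (Y \<union> W) = outside (X \<union> Y) - W"
proof -
  have t: "inside (X \<union> Y) \<inter> inside (W \<union> Y) = {}"
    "inside (X \<union> Y) \<union> inside (W \<union> Y) \<union> (Y - {a, b}) = inside (X \<union> W)"
    using theta_inside[OF 1 3 2 XW XY _ Y] YW by (auto simp: Int_commute)
  have e: "W \<union> Y = Y \<union> W" by auto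
  show "outside (X \<union> W) \<inter> inside (Y \<union> W) = {}"
    using t(2) joins_by_Jordan(7)[OF 1 3 XW] unfolding e by blast
  have o: "outside (X \<union> W) = - (X \<union> W) - inside (X \<union> W)" "outside (X \<union> Y) = - (X \<union> Y) - inside (X \<union> Y)"
    using joins_by_Jordan(7,8)[OF 1 3 XW] joins_by_Jordan(7,8)[OF 1 2 XY] by blast+
  have i: "\<And>x. x \<in> inside (Y \<union> W) \<Longrightarrow> x \<notin> Y \<and> x \<notin> W" "\<And>x. x \<in> inside (X \<union> W) \<Longrightarrow> x \<notin> X \<and> x \<notin> W"
    by (auto simp: inside_def)
  have ab: "a \<in> X" "b \<in> X" using joins_by_endpoints[OF 1] by auto
  have t': "x \<in> inside (X \<union> W) \<longleftrightarrow> x \<in> inside (X \<union> Y) \<or> x \<in> inside (Y \<union> W) \<or> x \<in> Y \<and> x \<noteq> a \<and> x \<noteq> b" for x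
    using t(2) unfolding e by blast
  have t1: "x \<in> inside (X \<union> Y) \<Longrightarrow> x \<notin> inside (Y \<union> W)" for x
    using t(1) unfolding e by blast
  show "outside (X \<union> W) \<union> inside (Y \<union> W) = outside (X \<union> Y) - W"
  proof (rule set_eqI)
    fix x
    show "x \<in> outside (X \<union> W) \<union> inside (Y \<union> W) \<longleftrightarrow> x \<in> outside (X \<union> Y) - W"
      using t'[of x] t1[of x] i(1)[of x] i(2)[of x] ab unfolding o by blast
  qed
qed

text \<open>The outer face is not singled out later, so both sides of the curve are covered. If
  \<open>W\<close> runs outside, the endless parts of the arcs are connected and each lies on one
  side of the curve formed by the other two; the cases record whether \<open>X\<close> or
  \<open>Y\<close> is the enclosed one.\<close>

lemma theta_split:
  assumes 1: "joins_by a b X" and 2: "joins_by a b Y" and 3: "joins_by a b W"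
    and XY: "X \<inter> Y = {a, b}" and XW: "X \<inter> W = {a, b}" and YW: "Y \<inter> W = {a, b}"
    and R: "side_of (X \<union> Y) R" and W: "W - {a, b} \<subseteq> R"
  obtains R1 R2 where "side_of (X \<union> W) R1" "side_of (Y \<union> W) R2" "R1 \<inter> R2 = {}"
    "R1 \<union> R2 = R - W"
proof (cases "R = inside (X \<union> Y)")
  case True
  have t: "inside (X \<union> W) \<inter> inside (Y \<union> W) = {}"
    "inside (X \<union> W) \<union> inside (Y \<union> W) \<union> (W - {a, b}) = inside (X \<union> Y)"
    using theta_inside[OF 1 2 3 XY XW YW] W True by auto
  have "inside (X \<union> W) \<inter> W = {}" "inside (Y \<union> W) \<inter> W = {}" "R \<inter> {a,b} = {}"
    using joins_by_endpoints[OF 1] by (auto simp: inside_def True)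
  then have "inside (X \<union> W) \<union> inside (Y \<union> W) = R - W" using t(2) True by blast
  with t(1) show thesis using that by (auto simp: side_of_def)
next
  case False
  then have Ro: "R = outside (X \<union> Y)" using R by (auto simp: side_of_def)
  have sd: "T - {a, b} \<subseteq> inside J \<or> T - {a, b} \<subseteq> outside J" if "joins_by a b T" "closed J" "T \<inter> J \<subseteq> {a, b}" for T J
    using connected_inside_or_outside[of "T - {a, b}" J] joins_by_connected_diff[OF that(1)] that by blast
  have cl: "closed X" "closed Y" "closed W" using closed_joins_by 1 2 3 by auto
  consider "Y - {a, b} \<subseteq> inside (X \<union> W)" | "X - {a, b} \<subseteq> inside (Y \<union> W)"
    | "Y - {a, b} \<subseteq> outside (X \<union> W)" "X - {a, b} \<subseteq> outside (Y \<union> W)"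
    using sd[OF 2, of "X \<union> W"] sd[OF 1, of "Y \<union> W"] cl XY XW YW by (auto simp: Int_Un_distrib)
  then show thesis
  proof cases
    case 1
    then show thesis
      using that theta_outside_aux[OF assms(1-6)] by (metis Ro side_of_def)
  next
    case 2
    have e: "Y \<union> X = X \<union> Y" by auto
    show thesis
      using that theta_outside_aux[OF assms(2,1,3) _ YW XW 2] XY by (metis Ro side_of_def e Int_commute sup_commute)
  next
    \<comment> \<open>This case is impossible: the inside of \<open>X \<union> Y\<close> would lie
      outside both other curves, which the winding numbers rule out.\<close>
    case 3
    let ?I = "inside (X \<union> Y)"
    note J = joins_by_Jordan[OF 1 2 XY]
    have dis: "?I \<inter> (X \<union> Y \<union> W) = {}"
      using W J(7) joins_by_endpoints[OF 1] unfolding Ro by (auto simp: inside_def)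
    \<comment> \<open>Otherwise \<open>?I\<close> lies inside \<open>Z \<union> W\<close>, and so
      its closure, which contains \<open>Z'\<close>, lies in the closed disc, although
      \<open>Z'\<close> runs outside.\<close>
    have "?I \<subseteq> outside (Z \<union> W)" if Z: "Z \<inter> Z' = {a,b}" "Z \<union> Z' = X \<union> Y" "Z' - {a,b} \<subseteq> outside (Z \<union> W)"
      "joins_by a b Z" "joins_by a b Z'" "Z \<inter> W = {a,b}" "Z' \<inter> W = {a,b}" for Z Z'
    proof (rule ccontr)
      assume "\<not> ?I \<subseteq> outside (Z \<union> W)"
      moreover have "closed (Z \<union> W)" using closed_joins_by that(4) cl(3) by auto
      moreover have "?I \<inter> (Z \<union> W) = {}" using dis Z(2) by blast
      ultimately have "?I \<subseteq> inside (Z \<union> W)"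
        using connected_inside_or_outside[of ?I "Z \<union> W"] J(5) by blast
      then have "closure ?I \<subseteq> closure (inside (Z \<union> W))" by (rule closure_mono)
      also have "\<dots> = inside (Z \<union> W) \<union> (Z \<union> W)"
        using joins_by_Jordan(9)[OF that(4) assms(3) that(6)] by (simp add: closure_Un_frontier)
      finally have "X \<union> Y \<subseteq> inside (Z \<union> W) \<union> (Z \<union> W)"
        using J(9) by (auto simp: closure_Un_frontier)
      then have sub: "Z \<union> Z' \<subseteq> inside (Z \<union> W) \<union> (Z \<union> W)" unfolding Z(2) .
      have ZW: "x \<notin> Z \<union> W" if "x \<in> Z' - {a,b}" for x
        using that Z(1,7) by blast
      obtain x where x: "x \<in> Z' - {a,b}" using joins_by_diff_nonempty[OF Z(5)] by blast
      then have "x \<in> inside (Z \<union> W)" using sub ZW[OF x] by blast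
      moreover have "x \<in> outside (Z \<union> W)" using x Z(3) by blast
      ultimately show False by (auto simp: inside_def outside_def)
    qed
    from this[of X Y] this[of Y X] have "?I \<subseteq> outside (X \<union> W)" "?I \<subseteq> outside (Y \<union> W)"
      using 3 1 2 XY XW YW by (auto simp: Int_commute Un_commute)
    then show thesis
      using theta_inside_cover[OF assms(1-6)] J(1) by blast
  qed
qed

section \<open>Paths and circuits as edge sets\<close>

fun path_edges :: "'a list \<Rightarrow> 'a set set" where
  "path_edges (x # y # zs) = insert {x, y} (path_edges (y # zs))"
| "path_edges _ = {}"

lemma path_edges_append: "path_edges (xs @ y # zs) = path_edges (xs @ [y]) \<union> path_edges (y # zs)"
proof (induction xs)
  case (Cons x xs)
  then show ?case by (cases xs) auto
qed simp

lemma path_edges_rev: "path_edges (rev xs) = path_edges xs"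
proof (induction xs rule: path_edges.induct)
  case (1 x y zs)
  have "path_edges (rev (x # y # zs)) = path_edges (rev zs @ [y]) \<union> path_edges [y, x]"
    using path_edges_append[of "rev zs" y "[x]"] by simp
  then show ?case using 1 by auto
qed simp_all

lemma finite_path_edges [simp]: "finite (path_edges xs)"
  by (induction xs rule: path_edges.induct) auto

lemma path_edges_subset: "e \<in> path_edges xs \<Longrightarrow> e \<subseteq> set xs"
  by (induction xs rule: path_edges.induct) auto

lemma Union_path_edges: "length xs \<ge> 2 \<Longrightarrow> \<Union>(path_edges xs) = set xs"
proof (induction xs rule: path_edges.induct)
  case (1 x y zs)
  then show ?case by (cases zs) auto
qed auto

lemma Union_path_edges_path [simp]: "\<Union>(path_edges (a # xs @ [b])) = insert a (insert b (set xs))"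
  by (subst Union_path_edges) auto

lemma card_path_edges: "distinct xs \<Longrightarrow> card (path_edges xs) = length xs - 1"
proof (induction xs rule: path_edges.induct)
  case (1 x y zs)
  then have "{x, y} \<notin> path_edges (y # zs)" using path_edges_subset[of "{x,y}" "y # zs"] by auto
  then show ?case using 1 by simp
qed auto

lemma path_edges_edge_card: "distinct xs \<Longrightarrow> e \<in> path_edges xs \<Longrightarrow> card e = 2"
  by (induction xs rule: path_edges.induct) auto

lemma path_edges_at_hd: "distinct (a # xs) \<Longrightarrow> xs \<noteq> [] \<Longrightarrow> {e \<in> path_edges (a # xs). a \<in> e} = {{a, hd xs}}"
proof -
  assume d: "distinct (a # xs)" and "xs \<noteq> []"
  then obtain y ys where [simp]: "xs = y # ys" by (cases xs) auto
  have "a \<notin> e" if "e \<in> path_edges (y # ys)" for e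
    using path_edges_subset[OF that] d by auto
  then show ?thesis by auto
qed

lemma path_edges_at_last:
  assumes "distinct (xs @ [b])" "xs \<noteq> []"
  shows "{e \<in> path_edges (xs @ [b]). b \<in> e} = {{b, last xs}}"
  using path_edges_at_hd[of b "rev xs"] path_edges_rev[of "xs @ [b]"] assms by (simp add: hd_rev)

lemma path_edges_ends_notin: "distinct (a # xs @ [b]) \<Longrightarrow> xs \<noteq> [] \<Longrightarrow> {a, b} \<notin> path_edges (a # xs @ [b])"
proof
  assume d: "distinct (a # xs @ [b])" and n: "xs \<noteq> []" and m: "{a, b} \<in> path_edges (a # xs @ [b])"
  obtain y ys where y: "xs = y # ys" using n by (cases xs) auto
  have "{e \<in> path_edges (a # xs @ [b]). a \<in> e} = {{a, hd (xs @ [b])}}" using path_edges_at_hd[of a "xs @ [b]"] d by simp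
  moreover have "{a, b} \<in> {e \<in> path_edges (a # xs @ [b]). a \<in> e}" by (intro CollectI conjI m insertI1)
  ultimately have "{a, b} \<in> {{a, hd (xs @ [b])}}" by (rule subst)
  then have "{a, b} = {a, y}" using y by simp
  then have "b = y" by (metis doubleton_eq_iff)
  then show False using d y by simp
qed

text \<open>A circuit is its edge set: starting vertex and direction disappear, and boundaries of
  faces can be compared by equality.\<close>

definition is_circuit :: "'a set set \<Rightarrow> bool" where
  "is_circuit C \<longleftrightarrow> (\<exists>vs. 3 \<le> length vs \<and> distinct vs \<and> C = path_edges (vs @ [hd vs]))"

lemma path_edges_rotate:
  "xs \<noteq> [] \<Longrightarrow> ys \<noteq> [] \<Longrightarrow> path_edges ((xs @ ys) @ [hd (xs @ ys)]) = path_edges ((ys @ xs) @ [hd (ys @ xs)])"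
proof -
  assume "xs \<noteq> []" "ys \<noteq> []"
  then obtain x xs' y ys' where [simp]: "xs = x # xs'" "ys = y # ys'" by (metis list.exhaust)
  show ?thesis
    using path_edges_append[of "x # xs'" y "ys' @ [x]"] path_edges_append[of "y # ys'" x "xs' @ [y]"] by auto
qed

lemma is_circuit_from:
  assumes "is_circuit C" "a \<in> \<Union>C"
  obtains xs where "2 \<le> length xs" "distinct (a # xs)" "C = path_edges (a # xs @ [a])"
proof -
  obtain vs where vs: "3 \<le> length vs" "distinct vs" "C = path_edges (vs @ [hd vs])"
    using assms by (auto simp: is_circuit_def)
  then have "a \<in> set vs" using assms(2) path_edges_subset[of _ "vs @ [hd vs]"] by (cases vs) auto
  then obtain us ws where us: "vs = us @ a # ws" by (meson split_list)
  show thesis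
  proof (cases "us = []")
    case True
    then show thesis using that[of ws] vs us by auto
  next
    case False
    then show thesis
      using that[of "ws @ us"] vs us path_edges_rotate[of us "a # ws"] by auto
  qed
qed

text \<open>The two paths become two of the three arcs of a theta curve. The disjunction excludes
  the walk from \<open>a\<close> to \<open>b\<close> and back along a single edge.\<close>

lemma is_circuit_split:
  assumes "is_circuit C" "a \<in> \<Union>C" "b \<in> \<Union>C" "a \<noteq> b"
  obtains xs ys where "distinct (a # xs @ b # ys)" "xs \<noteq> [] \<or> ys \<noteq> []"
    "C = path_edges (a # xs @ [b]) \<union> path_edges (b # ys @ [a])"
proof -
  obtain zs where zs: "2 \<le> length zs" "distinct (a # zs)" "C = path_edges (a # zs @ [a])"
    using is_circuit_from[OF assms(1,2)] .
  then have "b \<in> set zs" using assms(3,4) by auto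
  then obtain xs ys where xy: "zs = xs @ b # ys" by (meson split_list)
  show thesis
  proof (rule that[of xs ys])
    show "xs \<noteq> [] \<or> ys \<noteq> []" using zs(1) xy by auto
  qed (use zs xy path_edges_append[of "a # xs" b "ys @ [a]"] in auto)
qed

lemma is_circuit_join:
  assumes "distinct (a # xs @ b # ys)" "xs \<noteq> [] \<or> ys \<noteq> []"
  shows "is_circuit (path_edges (a # xs @ [b]) \<union> path_edges (b # ys @ [a]))"
  unfolding is_circuit_def
proof (intro exI conjI)
  show "3 \<le> length (a # xs @ b # ys)" using assms(2) by (cases xs; cases ys) auto
  show "path_edges (a # xs @ [b]) \<union> path_edges (b # ys @ [a]) = path_edges ((a # xs @ b # ys) @ [hd (a # xs @ b # ys)])"
    using path_edges_append[of "a # xs" b "ys @ [a]"] by simp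
qed (rule assms(1))

lemma path_edges_two_paths_disjoint:
  assumes "distinct (a # xs @ b # ys)" "xs \<noteq> [] \<or> ys \<noteq> []"
  shows "path_edges (a # xs @ [b]) \<inter> path_edges (b # ys @ [a]) = {}"
proof (rule ccontr)
  assume "\<not> ?thesis"
  then obtain e where e: "e \<in> path_edges (a # xs @ [b])" "e \<in> path_edges (b # ys @ [a])" by auto
  have "e \<subseteq> {a, b}" using path_edges_subset[OF e(1)] path_edges_subset[OF e(2)] assms(1) by auto
  moreover have "card e = 2" using path_edges_edge_card[OF _ e(1)] assms(1) by auto
  ultimately have "e = {a, b}" by (auto simp: card_2_iff)
  then show False
    using path_edges_ends_notin[of a xs b] path_edges_ends_notin[of b ys a] assms e by (auto simp: insert_commute)
qed

lemma is_circuit_finite: "is_circuit C \<Longrightarrow> finite C"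
  by (auto simp: is_circuit_def)

lemma is_circuit_nonempty: "is_circuit C \<Longrightarrow> C \<noteq> {}"
proof -
  assume "is_circuit C"
  then obtain vs where "3 \<le> length vs" "C = path_edges (vs @ [hd vs])" by (auto simp: is_circuit_def)
  then obtain x y zs where "vs = x # y # zs" by (cases vs rule: path_edges.cases) auto
  then show ?thesis using \<open>C = _\<close> by simp
qed

lemma is_circuit_two_vertices:
  assumes "is_circuit C"
  obtains a b where "a \<in> \<Union>C" "b \<in> \<Union>C" "a \<noteq> b"
proof -
  obtain vs where "3 \<le> length vs" "distinct vs" "C = path_edges (vs @ [hd vs])" using assms by (auto simp: is_circuit_def)
  moreover from this obtain x y zs where "vs = x # y # zs" by (cases vs rule: path_edges.cases) auto
  ultimately show thesis using that[of x y] by auto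
qed

text \<open>This is the starting case of Euler's formula, where a circuit has just two
  faces.\<close>

lemma is_circuit_card: "is_circuit C \<Longrightarrow> card C = card (\<Union>C)"
proof -
  assume C: "is_circuit C"
  obtain a b where ab: "a \<in> \<Union>C" "b \<in> \<Union>C" "a \<noteq> b" by (rule is_circuit_two_vertices[OF C])
  obtain xs ys where xy: "distinct (a # xs @ b # ys)" "xs \<noteq> [] \<or> ys \<noteq> []"
    "C = path_edges (a # xs @ [b]) \<union> path_edges (b # ys @ [a])" by (rule is_circuit_split[OF C ab])
  have d: "distinct (a # xs @ [b])" "distinct (b # ys @ [a])" using xy(1) by auto
  have "card C = (length xs + 1) + (length ys + 1)"
    using path_edges_two_paths_disjoint[OF xy(1,2)] card_path_edges[OF d(1)] card_path_edges[OF d(2)]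
    by (simp add: xy(3) card_Un_disjoint)
  also have "\<dots> = card (set (a # xs @ b # ys))" using distinct_card[OF xy(1)] by simp
  also have "set (a # xs @ b # ys) = \<Union>C" using xy(3) by auto
  finally show ?thesis .
qed

lemma is_circuit_card_ge_3: "is_circuit C \<Longrightarrow> 3 \<le> card C"
proof -
  assume C: "is_circuit C"
  then obtain vs where vs: "3 \<le> length vs" "distinct vs" "C = path_edges (vs @ [hd vs])" by (auto simp: is_circuit_def)
  then have "\<Union>C = set vs" using Union_path_edges[of "vs @ [hd vs]"] by (cases vs) auto
  then show ?thesis using is_circuit_card[OF C] vs distinct_card[of vs] by simp
qed

lemma is_circuit_edges_at:
  assumes "is_circuit C" "v \<in> \<Union>C"
  obtains a b where "{e \<in> C. v \<in> e} = {{v, a}, {v, b}}" "a \<noteq> b" "a \<noteq> v" "b \<noteq> v"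
proof -
  obtain xs where xs: "2 \<le> length xs" "distinct (v # xs)" "C = path_edges (v # xs @ [v])"
    using is_circuit_from[OF assms] .
  obtain a zs where "xs = a # zs" using xs(1) by (cases xs) auto
  with xs(1) have a: "xs = a # zs" "zs \<noteq> []" by auto
  then obtain ys b where "zs = ys @ [b]" by (metis rev_exhaust)
  with a have y: "xs = a # ys @ [b]" by simp
  have "C = path_edges (v # xs) \<union> path_edges [b, v]" using xs path_edges_append[of "v # a # ys" b "[v]"] y by simp
  then have "{e \<in> C. v \<in> e} = {{v, a}, {v, b}}"
    using path_edges_at_hd[of v xs] xs(2) y by auto
  then show thesis using that[of a b] xs(2) y by auto
qed

section \<open>Faces of plane drawings\<close>

lemma card2_joins: "card e = 2 \<Longrightarrow> u \<in> e \<Longrightarrow> v \<in> e \<Longrightarrow> u \<noteq> v \<Longrightarrow> e = {u, v}"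
  by (auto simp: card_2_iff)

lemma path_edges_one_edge_hd: "distinct (a # xs @ [b]) \<Longrightarrow> \<exists>q. {e \<in> path_edges (a # xs @ [b]). a \<in> e} = {q}"
  using path_edges_at_hd[of a "xs @ [b]"] by auto

lemma path_edges_one_edge_last: "distinct (a # xs @ [b]) \<Longrightarrow> \<exists>q. {e \<in> path_edges (a # xs @ [b]). b \<in> e} = {q}"
  using path_edges_at_last[of "a # xs" b] by auto

locale drawing =
  fixes V :: "'a set" and E :: "'a set set" and p :: "'a \<Rightarrow> complex" and \<gamma> :: "'a set \<Rightarrow> real \<Rightarrow> complex"
  assumes graph: "simple_graph V E" and plane: "plane_drawing V E p \<gamma>"
begin

definition U :: "'a set set \<Rightarrow> complex set" where
  "U S = (\<Union>e\<in>S. path_image (\<gamma> e))"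

lemma U_Un: "U (S \<union> T) = U S \<union> U T" by (auto simp: U_def)

lemma finV: "finite V" using graph by (simp add: simple_graph_def)

lemma edge: "e \<in> E \<Longrightarrow> e \<subseteq> V \<and> card e = 2" using graph by (simp add: simple_graph_def)

lemma finE: "finite E"
  by (rule finite_subset[of _ "Pow V"]) (use edge finV in auto)

lemma inj: "inj_on p V" using plane by (simp add: plane_drawing_def)

lemma edge_obtain: "e \<in> E \<Longrightarrow> (\<And>u v. e = {u, v} \<Longrightarrow> u \<noteq> v \<Longrightarrow> u \<in> V \<Longrightarrow> v \<in> V \<Longrightarrow> th) \<Longrightarrow> th"
  using edge by (metis card_2_iff insert_subset)

lemma edge_neq: "{u, v} \<in> E \<Longrightarrow> u \<noteq> v \<and> u \<in> V \<and> v \<in> V"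
  using edge[of "{u,v}"] by auto

lemma joins_edge: "{u, v} \<in> E \<Longrightarrow> joins_by (p u) (p v) (path_image (\<gamma> {u, v}))"
proof -
  assume e: "{u, v} \<in> E"
  then have g: "arc (\<gamma> {u, v})" "{pathstart (\<gamma> {u, v}), pathfinish (\<gamma> {u, v})} = {p u, p v}"
    using plane by (auto simp: plane_drawing_def)
  then consider "pathstart (\<gamma> {u, v}) = p u" "pathfinish (\<gamma> {u, v}) = p v"
    | "pathstart (\<gamma> {u, v}) = p v" "pathfinish (\<gamma> {u, v}) = p u"
    by (metis doubleton_eq_iff)
  then show ?thesis
  proof cases
    case 1
    then show ?thesis using g(1) by (auto simp: joins_by_def)
  next
    case 2
    then have "joins_by (p v) (p u) (path_image (\<gamma> {u, v}))" using g(1) by (auto simp: joins_by_def)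
    then show ?thesis by (rule joins_by_commute)
  qed
qed

lemma vertex_on_edge: "e \<in> E \<Longrightarrow> v \<in> V \<Longrightarrow> p v \<in> path_image (\<gamma> e) \<longleftrightarrow> v \<in> e"
proof
  assume e: "e \<in> E" "v \<in> V"
  {
    assume "p v \<in> path_image (\<gamma> e)"
    moreover have "(path_image (\<gamma> e) - p ` e) \<inter> p ` V = {}" using plane e(1) by (simp add: plane_drawing_def)
    ultimately have "p v \<in> p ` e" using e(2) by blast
    then show "v \<in> e" using inj e edge[OF e(1)] by (metis inj_on_image_mem_iff)
  }
  assume "v \<in> e"
  moreover obtain u w where "e = {u, w}" using edge_obtain[OF e(1)] by metis
  ultimately show "p v \<in> path_image (\<gamma> e)" using joins_edge[of u w] e(1) joins_by_endpoints by fastforce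
qed

lemma vertex_in_U: "S \<subseteq> E \<Longrightarrow> v \<in> V \<Longrightarrow> p v \<in> U S \<longleftrightarrow> v \<in> \<Union>S"
  using vertex_on_edge by (auto simp: U_def)

lemma edges_meet:
  assumes "e \<in> E" "f \<in> E" "e \<noteq> f" "q \<in> path_image (\<gamma> e)" "q \<in> path_image (\<gamma> f)"
  shows "\<exists>v\<in>e \<inter> f. q = p v"
proof -
  have "(path_image (\<gamma> e) - p ` e) \<inter> path_image (\<gamma> f) = {}" "(path_image (\<gamma> f) - p ` f) \<inter> path_image (\<gamma> e) = {}"
    using plane assms(1-3) by (simp_all add: plane_drawing_def)
  then have "q \<in> p ` e \<inter> p ` f" using assms(4,5) by blast
  then obtain v w where vw: "v \<in> e" "q = p v" "w \<in> f" "q = p w" by blast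
  then have "v = w" using inj edge[OF assms(1)] edge[OF assms(2)] by (auto dest: inj_onD)
  then show ?thesis using vw by blast
qed

text \<open>Distinct drawn edges meet only in common ends, so intersections of drawings can be
  computed from vertex sets.\<close>

lemma U_meet:
  assumes "S \<subseteq> E" "T \<subseteq> E" "S \<inter> T = {}"
  shows "U S \<inter> U T = p ` (\<Union>S \<inter> \<Union>T)"
proof
  show "U S \<inter> U T \<subseteq> p ` (\<Union>S \<inter> \<Union>T)"
  proof
    fix q assume "q \<in> U S \<inter> U T"
    then obtain e f where ef: "e \<in> S" "f \<in> T" "q \<in> path_image (\<gamma> e)" "q \<in> path_image (\<gamma> f)"
      by (auto simp: U_def)
    then obtain v where "v \<in> e \<inter> f" "q = p v" using edges_meet[of e f q] assms by blast
    then show "q \<in> p ` (\<Union>S \<inter> \<Union>T)" using ef by blast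
  qed
  show "p ` (\<Union>S \<inter> \<Union>T) \<subseteq> U S \<inter> U T"
    using vertex_in_U assms(1,2) edge by blast
qed

lemma joins_path:
  "distinct (a # xs) \<Longrightarrow> xs \<noteq> [] \<Longrightarrow> path_edges (a # xs) \<subseteq> E \<Longrightarrow> joins_by (p a) (p (last xs)) (U (path_edges (a # xs)))"
proof (induction xs arbitrary: a)
  case (Cons b xs)
  have e: "{a, b} \<in> E" using Cons.prems by simp
  show ?case
  proof (cases "xs = []")
    case True
    then show ?thesis using joins_edge[OF e] by (simp add: U_def)
  next
    case False
    have ih: "joins_by (p b) (p (last xs)) (U (path_edges (b # xs)))"
      using Cons False by auto
    have "{a, b} \<notin> path_edges (b # xs)" using path_edges_subset[of "{a,b}" "b # xs"] Cons.prems(1) by auto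
    then have "U {{a, b}} \<inter> U (path_edges (b # xs)) = p ` (\<Union>{{a, b}} \<inter> \<Union>(path_edges (b # xs)))"
      using Cons.prems(3) by (intro U_meet) auto
    also have "\<dots> \<subseteq> {p b}"
    proof -
      have "\<Union>(path_edges (b # xs)) \<subseteq> set (b # xs)" using path_edges_subset by blast
      then show ?thesis using Cons.prems(1) by auto
    qed
    finally have "joins_by (p a) (p (last xs)) (path_image (\<gamma> {a, b}) \<union> U (path_edges (b # xs)))"
      using joins_by_trans[OF joins_edge[OF e] ih] by (simp add: U_def)
    then show ?thesis using False by (simp add: U_def)
  qed
qed simp

lemma joins_path': "distinct (a # xs @ [b]) \<Longrightarrow> path_edges (a # xs @ [b]) \<subseteq> E \<Longrightarrow> joins_by (p a) (p b) (U (path_edges (a # xs @ [b])))"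
  using joins_path[of a "xs @ [b]"] by simp

lemma two_paths_meet:
  assumes "distinct (a # xs @ b # ys)" "xs \<noteq> [] \<or> ys \<noteq> []" "path_edges (a # xs @ [b]) \<subseteq> E" "path_edges (b # ys @ [a]) \<subseteq> E"
  shows "U (path_edges (a # xs @ [b])) \<inter> U (path_edges (b # ys @ [a])) = {p a, p b}"
proof -
  have "insert a (insert b (set xs)) \<inter> insert b (insert a (set ys)) = {a, b}" using assms(1) by auto
  then show ?thesis using U_meet[OF assms(3,4) path_edges_two_paths_disjoint[OF assms(1,2)]] by simp
qed

lemma is_circuit_Jordan:
  assumes "is_circuit C" "C \<subseteq> E"
  shows "inside (U C) \<noteq> {}" "outside (U C) \<noteq> {}" "open (inside (U C))" "open (outside (U C))"
    "connected (inside (U C))" "connected (outside (U C))"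
    "inside (U C) \<inter> outside (U C) = {}" "inside (U C) \<union> outside (U C) = - U C"
    "frontier (inside (U C)) = U C" "frontier (outside (U C)) = U C" "closed (U C)"
proof -
  obtain a b where ab: "a \<in> \<Union>C" "b \<in> \<Union>C" "a \<noteq> b" by (rule is_circuit_two_vertices[OF assms(1)])
  obtain xs ys where xy: "distinct (a # xs @ b # ys)" "xs \<noteq> [] \<or> ys \<noteq> []"
    "C = path_edges (a # xs @ [b]) \<union> path_edges (b # ys @ [a])" by (rule is_circuit_split[OF assms(1) ab])
  have E: "path_edges (a # xs @ [b]) \<subseteq> E" "path_edges (b # ys @ [a]) \<subseteq> E" using xy(3) assms(2) by auto
  have j: "joins_by (p a) (p b) (U (path_edges (a # xs @ [b])))" "joins_by (p a) (p b) (U (path_edges (b # ys @ [a])))"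
    using joins_path'[of a xs b] joins_path'[of b ys a] E xy(1) joins_by_commute by auto
  note J = joins_by_Jordan[OF j two_paths_meet[OF xy(1,2) E]]
  show "inside (U C) \<noteq> {}" "outside (U C) \<noteq> {}" "open (inside (U C))" "open (outside (U C))"
    "connected (inside (U C))" "connected (outside (U C))"
    "inside (U C) \<inter> outside (U C) = {}" "inside (U C) \<union> outside (U C) = - U C"
    "frontier (inside (U C)) = U C" "frontier (outside (U C)) = U C"
    using J by (simp_all add: xy(3) U_Un)
  show "closed (U C)" using closed_joins_by[OF j(1)] closed_joins_by[OF j(2)] by (simp add: xy(3) U_Un closed_Un)
qed

lemma side_of_circuit:
  assumes "is_circuit C" "C \<subseteq> E" "side_of (U C) R"
  shows "R \<noteq> {}" "open R" "connected R" "frontier R = U C" "R \<inter> U C = {}"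
proof -
  show "R \<inter> U C = {}" using assms(3) by (auto simp: side_of_def inside_def outside_def)
qed (use is_circuit_Jordan[OF assms(1,2)] assms(3) in \<open>auto simp: side_of_def\<close>)

text \<open>Every drawn edge has a point other than its ends, and no other edge passes through that
  point.\<close>

lemma U_subset_imp: "C \<subseteq> E \<Longrightarrow> D \<subseteq> E \<Longrightarrow> U C \<subseteq> U D \<Longrightarrow> C \<subseteq> D"
proof
  fix e assume a: "C \<subseteq> E" "D \<subseteq> E" "U C \<subseteq> U D" "e \<in> C"
  obtain u v where e: "e = {u, v}" "e \<in> E" using edge_obtain a(1,4) by (metis subsetD)
  obtain q where q: "q \<in> path_image (\<gamma> e)" "q \<noteq> p u" "q \<noteq> p v"
    using joins_by_diff_nonempty[OF joins_edge[of u v]] e by auto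
  then have "q \<in> U D" using a(3,4) by (auto simp: U_def)
  then obtain f where f: "f \<in> D" "q \<in> path_image (\<gamma> f)" by (auto simp: U_def)
  then show "e \<in> D" using edges_meet[OF e(2), of f q] a(2) q e(1) by auto
qed

text \<open>The last condition says that the faces around each vertex form a single cycle.\<close>

definition face_structure :: "'a set set \<Rightarrow> ('a set set \<times> complex set) set \<Rightarrow> bool" where
  "face_structure S F \<longleftrightarrow> S \<subseteq> E \<and> finite F \<and> (\<forall>(C, R)\<in>F. is_circuit C \<and> C \<subseteq> S \<and> side_of (U C) R) \<and>
     (\<forall>f\<in>F. \<forall>g\<in>F. f \<noteq> g \<longrightarrow> snd f \<inter> snd g = {}) \<and> \<Union>(snd ` F) = - U S \<and>
     (\<forall>e\<in>S. card {f \<in> F. e \<in> fst f} = 2) \<and> card F + card (\<Union>S) = card S + 2 \<and>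
     (\<forall>v A. A \<subseteq> {e \<in> S. v \<in> e} \<and> A \<noteq> {} \<and> A \<noteq> {e \<in> S. v \<in> e} \<longrightarrow>
        (\<exists>f\<in>F. \<exists>e\<in>A. \<exists>e'\<in>{e \<in> S. v \<in> e} - A. e \<in> fst f \<and> e' \<in> fst f))"

lemma face_structure_circuit:
  assumes "is_circuit C" "C \<subseteq> E"
  shows "face_structure C {(C, inside (U C)), (C, outside (U C))}"
proof -
  note J = is_circuit_Jordan[OF assms]
  have ne: "inside (U C) \<noteq> outside (U C)" using J by blast
  have dj: "\<And>x. x \<in> inside (U C) \<Longrightarrow> x \<notin> outside (U C)" using J(7) by blast
  have "{f \<in> {(C, inside (U C)), (C, outside (U C))}. e \<in> fst f} = {(C, inside (U C)), (C, outside (U C))}"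
    if "e \<in> C" for e using that by auto
  then show ?thesis
    unfolding face_structure_def using assms J dj ne is_circuit_card[OF assms(1)]
    by (auto simp: side_of_def)
qed

lemma connected_in_one_region:
  fixes T :: "complex set"
  assumes "connected T" "T \<subseteq> \<Union>(snd ` F)" "\<forall>f\<in>F. open (snd f)" "\<forall>f\<in>F. \<forall>g\<in>F. f \<noteq> g \<longrightarrow> snd f \<inter> snd g = {}" "T \<noteq> {}"
  obtains f where "f \<in> F" "T \<subseteq> snd f"
proof -
  obtain x f where x: "x \<in> T" "f \<in> F" "x \<in> snd f" using assms(2,5) by blast
  let ?O = "\<Union>(snd ` (F - {f}))"
  have "open (snd f)" "open ?O" using assms(3) x(2) by auto
  moreover have "snd f \<inter> ?O = {}" using assms(4) x(2) by blast
  moreover have "T \<subseteq> snd f \<union> ?O" using assms(2) by blast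
  ultimately have "snd f \<inter> T = {} \<or> ?O \<inter> T = {}"
    using connectedD[OF assms(1), of "snd f" ?O] by blast
  then show thesis using that[OF x(2)] x \<open>T \<subseteq> snd f \<union> ?O\<close> by blast
qed

text \<open>The ear without its ends is connected and avoids the drawing, so it runs within one face
  and completes the boundary circuit of that face to a theta curve. This face is replaced by two,
  and all others stay.\<close>

lemma face_structure_ear:
  assumes FS: "face_structure S F" and P: "distinct (a # ps @ [b])" "path_edges (a # ps @ [b]) \<subseteq> E - S"
    "set ps \<inter> \<Union>S = {}" "a \<in> \<Union>S" "b \<in> \<Union>S"
  shows "\<exists>F'. face_structure (S \<union> path_edges (a # ps @ [b])) F'"
proof -
  let ?P = "path_edges (a # ps @ [b])"
  let ?W = "U ?P"
  have SE: "S \<subseteq> E" and finF: "finite F" and cycF: "\<And>f. f \<in> F \<Longrightarrow> is_circuit (fst f) \<and> fst f \<subseteq> S \<and> side_of (U (fst f)) (snd f)"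
    and disj: "\<forall>f\<in>F. \<forall>g\<in>F. f \<noteq> g \<longrightarrow> snd f \<inter> snd g = {}" and cover: "\<Union>(snd ` F) = - U S"
    and two: "\<And>e. e \<in> S \<Longrightarrow> card {f \<in> F. e \<in> fst f} = 2" and euler: "card F + card (\<Union>S) = card S + 2"
    and link: "\<And>v A. A \<subseteq> {e \<in> S. v \<in> e} \<Longrightarrow> A \<noteq> {} \<Longrightarrow> A \<noteq> {e \<in> S. v \<in> e} \<Longrightarrow>
        \<exists>f\<in>F. \<exists>e\<in>A. \<exists>e'\<in>{e \<in> S. v \<in> e} - A. e \<in> fst f \<and> e' \<in> fst f"
    using FS unfolding face_structure_def by (auto simp: split_beta)
  have PE: "?P \<subseteq> E" and PS: "?P \<inter> S = {}" using P(2) by auto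
  have ab: "a \<noteq> b" using P(1) by auto
  have abV: "a \<in> V" "b \<in> V" using P(4,5) SE edge by blast+
  have W: "joins_by (p a) (p b) ?W" using joins_path'[OF P(1) PE] .
  have WS: "?W \<inter> U S = {p a, p b}"
  proof -
    have "insert a (insert b (set ps)) \<inter> \<Union>S = {a, b}" using P(3-5) by auto
    then show ?thesis using U_meet[OF PE SE PS] by simp
  qed
  obtain f0 where f0: "f0 \<in> F" "?W - {p a, p b} \<subseteq> snd f0"
  proof (rule connected_in_one_region[of "?W - {p a, p b}" F])
    show "connected (?W - {p a, p b})" by (rule joins_by_connected_diff[OF W])
    show "?W - {p a, p b} \<subseteq> \<Union>(snd ` F)" using WS cover by blast
    show "\<forall>f\<in>F. open (snd f)" using cycF side_of_circuit(2) SE by (meson subset_trans)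
    show "?W - {p a, p b} \<noteq> {}" by (rule joins_by_diff_nonempty[OF W])
  qed (use disj in auto)
  obtain C R where CR: "f0 = (C, R)" by (cases f0)
  have C: "is_circuit C" "C \<subseteq> S" "side_of (U C) R" using cycF[OF f0(1)] CR by auto
  have CE: "C \<subseteq> E" using C(2) SE by auto
  note Rp = side_of_circuit[OF C(1) CE C(3)]
  have RS: "R \<inter> U S = {}" using Sup_upper[OF imageI[OF f0(1)], of snd] CR unfolding cover by auto
  \<comment> \<open>The ends of the ear are limits of points of \<open>R\<close> but lie on the
    drawing, which \<open>R\<close> avoids; hence they lie on the frontier
    \<open>U C\<close>.\<close>
  have "?W \<subseteq> closure R"
    using joins_by_subset_closure[OF W] closure_mono[OF f0(2)] CR by auto
  then have "?W \<subseteq> R \<union> U C" using Rp(4) by (simp add: closure_Un_frontier)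
  then have "p a \<in> U C" "p b \<in> U C" using WS RS by blast+
  then have abC: "a \<in> \<Union>C" "b \<in> \<Union>C" using vertex_in_U[OF CE] abV by auto
  obtain xs ys where xy: "distinct (a # xs @ b # ys)" "xs \<noteq> [] \<or> ys \<noteq> []"
    "C = path_edges (a # xs @ [b]) \<union> path_edges (b # ys @ [a])" by (rule is_circuit_split[OF C(1) abC ab])
  let ?X = "path_edges (a # xs @ [b])" and ?Y = "path_edges (b # ys @ [a])"
  have XE: "?X \<subseteq> E" "?Y \<subseteq> E" "?X \<subseteq> S" "?Y \<subseteq> S" using xy(3) CE C(2) by auto
  have jX: "joins_by (p a) (p b) (U ?X)" using joins_path'[of a xs b] xy(1) XE by auto
  have jY: "joins_by (p a) (p b) (U ?Y)" using joins_path'[of b ys a] xy(1) XE joins_by_commute by auto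
  have XY: "U ?X \<inter> U ?Y = {p a, p b}" using two_paths_meet[OF xy(1,2) XE(1,2)] .
  have XW: "U ?X \<inter> ?W = {p a, p b}" "U ?Y \<inter> ?W = {p a, p b}"
    using WS XE(3,4) joins_by_endpoints[OF jX] joins_by_endpoints[OF jY] joins_by_endpoints[OF W]
    unfolding U_def by blast+
  obtain R1 R2 where R12: "side_of (U ?X \<union> ?W) R1" "side_of (U ?Y \<union> ?W) R2" "R1 \<inter> R2 = {}" "R1 \<union> R2 = R - ?W"
    using theta_split[OF jX jY W XY XW, of R] C(3) f0(2) CR xy(3) by (auto simp: U_Un)
  define C1 where "C1 = ?X \<union> ?P"
  define C2 where "C2 = ?Y \<union> ?P"
  \<comment> \<open>If an arc of \<open>C\<close> and the ear were both the single edge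
    \<open>{a, b}\<close>, this edge would be in \<open>S\<close> and not in
    \<open>S\<close>.\<close>
  have ne1: "xs \<noteq> [] \<or> ps \<noteq> []" "ys \<noteq> [] \<or> ps \<noteq> []"
    using PS XE(3,4) by (auto simp: insert_commute)
  have rv: "path_edges (b # rev ps @ [a]) = ?P" using path_edges_rev[of "a # ps @ [b]"] by simp
  have xsS: "insert a (insert b (set xs)) \<subseteq> \<Union>S" "insert a (insert b (set ys)) \<subseteq> \<Union>S"
    using Union_mono[OF XE(3)] Union_mono[OF XE(4)] unfolding Union_path_edges_path by (simp_all add: insert_commute)
  have dps: "set xs \<inter> set ps = {}" "set ys \<inter> set ps = {}" using xsS P(3) by auto
  have c1: "is_circuit C1"
    using is_circuit_join[of a xs b "rev ps"] xy(1) P(1) dps ne1(1) unfolding C1_def rv by auto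
  have c2: "is_circuit C2"
    using is_circuit_join[of b ys a ps] xy(1) P(1) dps ne1(2) unfolding C2_def by auto
  have CiE: "C1 \<subseteq> E" "C2 \<subseteq> E" "C1 \<subseteq> S \<union> ?P" "C2 \<subseteq> S \<union> ?P" using XE PE by (auto simp: C1_def C2_def)
  have sd: "side_of (U C1) R1" "side_of (U C2) R2" using R12 by (auto simp: C1_def C2_def U_Un)
  have Rne: "R1 \<noteq> {}" "R2 \<noteq> {}" using side_of_circuit(1) c1 c2 sd CiE by auto
  have Pne: "?P \<noteq> {}" by (cases ps) auto
  define f1 where "f1 = (C1, R1)"
  define f2 where "f2 = (C2, R2)"
  have f12: "f1 \<noteq> f2" using R12(3) Rne by (auto simp: f1_def f2_def)
  have nF: "f1 \<notin> F" "f2 \<notin> F"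
    using cycF Pne PS by (force simp: f1_def f2_def C1_def C2_def)+
  define F' where "F' = insert f1 (insert f2 (F - {f0}))"
  have oth: "snd g \<inter> R = {}" if "g \<in> F - {f0}" for g using disj[rule_format, of g f0] that f0(1) CR by auto
  have oW: "snd g \<inter> ?W = {}" if "g \<in> F - {f0}" for g
  proof -
    have "snd g \<inter> U S = {}" using Sup_upper[OF imageI[of g F snd]] that unfolding cover by auto
    moreover have "snd g \<inter> (?W - {p a, p b}) = {}" using oth[OF that] f0(2) CR by auto
    moreover have "p a \<in> U S" "p b \<in> U S" using WS by auto
    ultimately show ?thesis by auto
  qed
  have edges_f: "e \<in> C1 \<longleftrightarrow> e \<in> ?X" "e \<in> C2 \<longleftrightarrow> e \<in> ?Y" if "e \<in> S" for e
    using that PS by (auto simp: C1_def C2_def)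
  have XYd: "?X \<inter> ?Y = {}" by (rule path_edges_two_paths_disjoint[OF xy(1,2)])
  have "face_structure (S \<union> ?P) F'"
    unfolding face_structure_def
  proof (intro conjI)
    show "S \<union> ?P \<subseteq> E" using SE PE by auto
    show "finite F'" using finF by (simp add: F'_def)
    show "\<forall>(C, R)\<in>F'. is_circuit C \<and> C \<subseteq> S \<union> ?P \<and> side_of (U C) R"
      using cycF c1 c2 CiE sd by (fastforce simp: F'_def f1_def f2_def)
    have s12: "snd f1 \<subseteq> R" "snd f2 \<subseteq> R" "snd f1 \<inter> snd f2 = {}" using R12 by (auto simp: f1_def f2_def)
    show "\<forall>f\<in>F'. \<forall>g\<in>F'. f \<noteq> g \<longrightarrow> snd f \<inter> snd g = {}"
    proof (intro ballI impI)
      fix f g assume fg: "f \<in> F'" "g \<in> F'" "f \<noteq> g"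
      have o1: "snd h \<inter> snd f1 = {}" "snd h \<inter> snd f2 = {}" "snd f1 \<inter> snd h = {}" "snd f2 \<inter> snd h = {}"
        if "h \<in> F - {f0}" for h using oth[OF that] s12 by auto
      consider "f \<in> F - {f0}" "g \<in> F - {f0}" | "f \<in> F - {f0}" "g = f1 \<or> g = f2" | "f = f1 \<or> f = f2" "g \<in> F - {f0}"
        | "f = f1" "g = f2" | "f = f2" "g = f1"
        using fg unfolding F'_def by auto
      then show "snd f \<inter> snd g = {}"
      proof cases
        case 1
        then show ?thesis using disj fg(3) by simp
      next
        case 2
        then show ?thesis using o1[of f] by auto
      next
        case 3
        then show ?thesis using o1[of g] by auto
      qed (use s12(3) in \<open>auto simp: Int_commute\<close>)
    qed
    have "\<Union>(snd ` F') = (R - ?W) \<union> \<Union>(snd ` (F - {f0}))"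
      using R12(4) by (auto simp: F'_def f1_def f2_def)
    also have "\<dots> = \<Union>(snd ` F) - ?W" using oW f0(1) CR by force
    finally show "\<Union>(snd ` F') = - U (S \<union> ?P)" using cover by (auto simp: U_Un)
    show "\<forall>e\<in>S \<union> ?P. card {f \<in> F'. e \<in> fst f} = 2"
    proof
      fix e assume "e \<in> S \<union> ?P"
      then consider "e \<in> ?P" | "e \<in> S" "e \<notin> C" | "e \<in> S" "e \<in> ?X" "e \<notin> ?Y" | "e \<in> S" "e \<notin> ?X" "e \<in> ?Y"
        using xy(3) XYd by blast
      then show "card {f \<in> F'. e \<in> fst f} = 2"
      proof cases
        case 1
        then have "{f \<in> F'. e \<in> fst f} = {f1, f2}"
          using cycF PS by (auto simp: F'_def f1_def f2_def C1_def C2_def)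
        then show ?thesis using f12 by simp
      next
        case 2
        then have "e \<notin> fst f1" "e \<notin> fst f2" "e \<notin> fst f0"
          using edges_f[OF 2(1)] xy(3) CR by (simp_all add: f1_def f2_def)
        then have "{f \<in> F'. e \<in> fst f} = {f \<in> F. e \<in> fst f}"
          unfolding F'_def by auto
        then show ?thesis using two[OF 2(1)] by simp
      next
        case 3
        have "e \<in> fst f1" "e \<notin> fst f2" using edges_f[OF 3(1)] 3 by (simp_all add: f1_def f2_def)
        then have "{f \<in> F'. e \<in> fst f} = insert f1 ({f \<in> F. e \<in> fst f} - {f0})"
          unfolding F'_def by auto
        moreover have "f0 \<in> {f \<in> F. e \<in> fst f}" using f0(1) CR 3 xy(3) by auto
        ultimately show ?thesis using two[OF 3(1)] nF(1) finF by simp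
      next
        case 4
        have "e \<notin> fst f1" "e \<in> fst f2" using edges_f[OF 4(1)] 4 by (simp_all add: f1_def f2_def)
        then have "{f \<in> F'. e \<in> fst f} = insert f2 ({f \<in> F. e \<in> fst f} - {f0})"
          unfolding F'_def by auto
        moreover have "f0 \<in> {f \<in> F. e \<in> fst f}" using f0(1) CR 4 xy(3) by auto
        ultimately show ?thesis using two[OF 4(1)] nF(2) finF by simp
      qed
    qed
    \<comment> \<open>One face, \<open>length ps + 1\<close> edges and \<open>length ps\<close>
      vertices are added, so Euler's formula stays balanced.\<close>
    have "card F' = card F + 1"
    proof -
      have "card F = Suc (card (F - {f0}))" using finF f0(1) by (rule card.remove)
      then show ?thesis using f12 nF finF by (simp add: F'_def)
    qed
    moreover have "card (S \<union> ?P) = card S + (length ps + 1)"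
      using card_path_edges[OF P(1)] PS finE SE by (subst card_Un_disjoint) (auto intro: finite_subset)
    moreover have "card (\<Union>(S \<union> ?P)) = card (\<Union>S) + length ps"
    proof -
      have "\<Union>(S \<union> ?P) = \<Union>S \<union> set ps" using P(4,5) by (auto simp del: Union_iff)
      moreover have "finite (\<Union>S)" by (rule finite_subset[OF _ finV]) (use SE edge in blast)
      ultimately show ?thesis using P(1,3) by (simp add: card_Un_disjoint Int_commute distinct_card)
    qed
    ultimately show "card F' + card (\<Union>(S \<union> ?P)) = card (S \<union> ?P) + 2" using euler by simp
    show "\<forall>v A. A \<subseteq> {e \<in> S \<union> ?P. v \<in> e} \<and> A \<noteq> {} \<and> A \<noteq> {e \<in> S \<union> ?P. v \<in> e} \<longrightarrow>
        (\<exists>f\<in>F'. \<exists>e\<in>A. \<exists>e'\<in>{e \<in> S \<union> ?P. v \<in> e} - A. e \<in> fst f \<and> e' \<in> fst f)"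
    proof (intro allI impI)
      fix v A assume A: "A \<subseteq> {e \<in> S \<union> ?P. v \<in> e} \<and> A \<noteq> {} \<and> A \<noteq> {e \<in> S \<union> ?P. v \<in> e}"
      let ?D = "{e \<in> S \<union> ?P. v \<in> e}"
      let ?goal = "\<exists>f\<in>F'. \<exists>e\<in>A. \<exists>e'\<in>?D - A. e \<in> fst f \<and> e' \<in> fst f"
      obtain e0 e0' where e0: "e0 \<in> A" "e0' \<in> ?D - A" using A by blast
      have f1F: "f1 \<in> F'" "f2 \<in> F'" "fst f1 = C1" "fst f2 = C2" by (auto simp: F'_def f1_def f2_def)
      \<comment> \<open>An inner vertex of the ear carries only ear edges, and these lie on both new
        faces. At an old vertex other than \<open>a\<close> and \<open>b\<close> only the loss of
        \<open>f0\<close> matters; the vertex is on at most one of the two arcs, so its edges on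
        \<open>C\<close> stay together on one new face. At the ends of the ear the cycle of faces
        really changes.\<close>
      consider "v \<in> set ps" | "v \<notin> set ps" "v \<noteq> a" "v \<noteq> b" | "v = a \<or> v = b" by blast
      then show ?goal
      proof cases
        case 1
        then have "e0 \<in> ?P" "e0' \<in> ?P" using P(3) A e0 by blast+
        then show ?goal using e0 f1F unfolding C1_def by blast
      next
        case 2
        have "v \<notin> \<Union>?P" unfolding Union_path_edges_path using 2 by simp
        then have D: "?D = {e \<in> S. v \<in> e}" by blast
        obtain f e e' where f: "f \<in> F" "e \<in> A" "e' \<in> ?D - A" "e \<in> fst f" "e' \<in> fst f"
          using link[of A v] A unfolding D by blast
        show ?goal
        proof (cases "f = f0")
          case False
          then have "f \<in> F'" using f(1) by (simp add: F'_def)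
          then show ?goal using f by blast
        next
          case True
          have v: "v \<in> e" "v \<in> e'" using A f(2,3) by auto
          have "v \<notin> \<Union>?X \<or> v \<notin> \<Union>?Y" unfolding Union_path_edges_path using 2 xy(1) by auto
          moreover have "e \<in> ?X \<union> ?Y" "e' \<in> ?X \<union> ?Y" using f(4,5) True CR xy(3) by auto
          ultimately have "e \<in> ?X \<and> e' \<in> ?X \<or> e \<in> ?Y \<and> e' \<in> ?Y" using v by blast
          then show ?goal using f(2,3) f1F unfolding C1_def C2_def by blast
        qed
      next
        case 3
        obtain p0 q1 q2 where pq: "{e \<in> ?P. v \<in> e} = {p0}" "{e \<in> ?X. v \<in> e} = {q1}" "{e \<in> ?Y. v \<in> e} = {q2}"
        proof -
          have d: "distinct (a # xs @ [b])" "distinct (b # ys @ [a])" using xy(1) by auto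
          show thesis
          proof (cases "v = a")
            case True
            then show thesis
              using that path_edges_one_edge_hd[OF P(1)] path_edges_one_edge_hd[OF d(1)] path_edges_one_edge_last[OF d(2)] by metis
          next
            case False
            then have "v = b" using 3 by simp
            then show thesis
              using that path_edges_one_edge_last[OF P(1)] path_edges_one_edge_last[OF d(1)] path_edges_one_edge_hd[OF d(2)] by metis
          qed
        qed
        have D: "?D = insert p0 {e \<in> S. v \<in> e}" using pq(1) by blast
        have q: "q1 \<in> ?X" "v \<in> q1" "q2 \<in> ?Y" "v \<in> q2" "p0 \<in> ?P" "v \<in> p0" using pq by blast+
        then have qS: "q1 \<in> S" "q2 \<in> S" "p0 \<notin> S" using XE PS by blast+
        have inC: "q1 \<in> C1" "p0 \<in> C1" "q2 \<in> C2" "p0 \<in> C2" using q by (auto simp: C1_def C2_def)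
        have qD: "q1 \<in> ?D" "q2 \<in> ?D" "p0 \<in> ?D" using q qS by auto
        have atC: "e = q1 \<or> e = q2" if "e \<in> C" "v \<in> e" for e using that xy(3) pq by blast
        have keep: "f \<in> F'" if "f \<in> F" "f \<noteq> f0" for f using that by (simp add: F'_def)
        \<comment> \<open>\<open>f1\<close> joins \<open>p0\<close> to \<open>q1\<close>, and
          \<open>f2\<close> joins \<open>p0\<close> to \<open>q2\<close>. What remains is that all
          three edges are on the same side of the cut. Then the old condition, applied without
          \<open>p0\<close>, yields a face, and it is not \<open>f0\<close>, whose only edges at
          \<open>v\<close> are \<open>q1\<close> and \<open>q2\<close>.\<close>
        consider "p0 \<in> A" "q1 \<notin> A" | "p0 \<in> A" "q2 \<notin> A" | "p0 \<notin> A" "q1 \<in> A" | "p0 \<notin> A" "q2 \<in> A"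
          | "p0 \<in> A" "q1 \<in> A" "q2 \<in> A" | "p0 \<notin> A" "q1 \<notin> A" "q2 \<notin> A" by blast
        then show ?goal
        proof cases
          case 5
          have "A - {p0} \<subseteq> {e \<in> S. v \<in> e}" "A - {p0} \<noteq> {}" "A - {p0} \<noteq> {e \<in> S. v \<in> e}"
            using A 5 qS D by blast+
          then obtain f e e' where f: "f \<in> F" "e \<in> A - {p0}" "e' \<in> {e \<in> S. v \<in> e} - (A - {p0})" "e \<in> fst f" "e' \<in> fst f"
            using link[of "A - {p0}" v] by blast
          have e': "e' \<in> ?D - A" using f(3) qS(3) by auto
          have "f \<noteq> f0" using atC[of e'] f(3,5) 5 CR e' by auto
          then show ?goal using f(2,4,5) e' keep[OF f(1)] by blast
        next
          case 6
          have "A \<subseteq> {e \<in> S. v \<in> e}" "A \<noteq> {}" "A \<noteq> {e \<in> S. v \<in> e}"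
            using A 6 qS q D by blast+
          then obtain f e e' where f: "f \<in> F" "e \<in> A" "e' \<in> {e \<in> S. v \<in> e} - A" "e \<in> fst f" "e' \<in> fst f"
            using link[of A v] by blast
          have "f \<noteq> f0" using atC[of e] f(2,4) 6 CR A by auto
          then show ?goal using f(2-5) keep[OF f(1)] D by blast
        qed (use inC qD f1F in blast)+
      qed
    qed
  qed
  then show ?thesis by blast
qed

end

section \<open>Connectedness by cuts, ear decompositions, and facial triangles\<close>

definition conn_in :: "'a set set \<Rightarrow> 'a set \<Rightarrow> bool" where
  "conn_in E W \<longleftrightarrow> (\<forall>A. A \<subseteq> W \<and> A \<noteq> {} \<and> A \<noteq> W \<longrightarrow> (\<exists>u\<in>A. \<exists>v\<in>W - A. {u, v} \<in> E))"

lemma conn_inD: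
  "conn_in E W \<Longrightarrow> A \<subseteq> W \<Longrightarrow> A \<noteq> {} \<Longrightarrow> A \<noteq> W \<Longrightarrow> \<exists>u\<in>A. \<exists>v\<in>W - A. {u, v} \<in> E"
  by (simp add: conn_in_def)

text \<open>\<open>A\<close> collects the ends of all paths from \<open>a\<close>. A vertex on such
  a path is itself the end of a shorter one, so an edge leaving \<open>A\<close> would prolong some
  path.\<close>

lemma conn_in_path:
  assumes W: "conn_in E W" and ab: "a \<in> W" "b \<in> W"
  obtains xs where "xs \<noteq> []" "distinct xs" "set xs \<subseteq> W" "hd xs = a" "last xs = b" "path_edges xs \<subseteq> E"
proof -
  define ok where "ok xs \<longleftrightarrow> xs \<noteq> [] \<and> distinct xs \<and> set xs \<subseteq> W \<and> hd xs = a \<and> path_edges xs \<subseteq> E" for xs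
  define A where "A = last ` {xs. ok xs}"
  have mem: "x \<in> A" if o: "ok xs" and x: "x \<in> set xs" for x xs
  proof -
    obtain us vs where xs: "xs = us @ x # vs" using x by (meson split_list)
    have "ok (us @ [x])" using o path_edges_append[of us x vs] unfolding ok_def xs by (cases us) auto
    then show ?thesis unfolding A_def by force
  qed
  have "ok [a]" using ab by (simp add: ok_def)
  then have "a \<in> A" using mem by simp
  moreover have AW: "A \<subseteq> W" by (auto simp: A_def ok_def)
  moreover have nA: "\<not> (\<exists>u\<in>A. \<exists>v\<in>W - A. {u, v} \<in> E)"
  proof
    assume "\<exists>u\<in>A. \<exists>v\<in>W - A. {u, v} \<in> E"
    then obtain xs v where v: "ok xs" "v \<in> W - A" "{last xs, v} \<in> E" by (auto simp: A_def)
    then have "v \<notin> set xs" using mem by blast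
    obtain us x where xs: "xs = us @ [x]" using v(1) by (metis ok_def rev_exhaust)
    have "ok (xs @ [v])"
      using v \<open>v \<notin> set xs\<close> path_edges_append[of us x "[v]"] unfolding ok_def xs by (cases us) auto
    then have "v \<in> A" using mem by simp
    then show False using v(2) by simp
  qed
  ultimately have "A = W" using conn_inD[OF W AW] by (metis empty_iff)
  then have "b \<in> A" using ab by simp
  then obtain xs where "ok xs" "last xs = b" by (auto simp: A_def)
  then show thesis using that by (auto simp: ok_def)
qed

context drawing
begin

lemma exists_circuit:
  assumes "v \<in> V" "{v, a} \<in> E" "{v, b} \<in> E" "a \<noteq> b" "conn_in E (V - {v})"
  obtains C where "is_circuit C" "C \<subseteq> E"
proof -
  have "a \<in> V - {v}" "b \<in> V - {v}" using edge_neq assms(2,3) by auto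
  then obtain xs where xs: "xs \<noteq> []" "distinct xs" "set xs \<subseteq> V - {v}" "hd xs = a" "last xs = b" "path_edges xs \<subseteq> E"
    using conn_in_path[OF assms(5)] by metis
  obtain y ys where y: "xs = y # ys" using xs(1) by (cases xs) auto
  obtain us z where us: "xs = us @ [z]" using xs(1) by (metis rev_exhaust)
  have "length xs \<ge> 2" using xs(4,5) assms(4) y by (cases ys) auto
  then have "is_circuit (path_edges ((v # xs) @ [hd (v # xs)]))"
    unfolding is_circuit_def using xs by (intro exI[of _ "v # xs"]) auto
  moreover have "path_edges ((v # xs) @ [hd (v # xs)]) \<subseteq> E"
  proof -
    have "path_edges (xs @ [v]) = path_edges xs \<union> {{z, v}}" using path_edges_append[of us z "[v]"] us by simp
    moreover have "z = b" using xs(5) us by simp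
    moreover have "path_edges (v # xs @ [v]) = insert {v, a} (path_edges (xs @ [v]))" using y xs(4) by simp
    ultimately show ?thesis using xs(6) assms(2,3) by (simp add: insert_commute)
  qed
  ultimately show thesis using that by blast
qed

text \<open>If no missing edge joins two vertices of \<open>S\<close>, leave \<open>S\<close> at
  \<open>a\<close> towards some \<open>z\<close> and return from \<open>z\<close> to another vertex
  of \<open>S\<close> in the graph without \<open>a\<close>. The first vertex of \<open>S\<close>
  met on the way back is the other end of the ear and differs from \<open>a\<close>.\<close>

lemma exists_ear:
  assumes "S \<subseteq> E" "S \<noteq> E" "conn_in E V" "\<And>v. v \<in> V \<Longrightarrow> conn_in E (V - {v})"
    and ne: "x \<in> \<Union>S" "y \<in> \<Union>S" "x \<noteq> y"
  obtains a ps b where "distinct (a # ps @ [b])" "path_edges (a # ps @ [b]) \<subseteq> E - S"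
    "set ps \<inter> \<Union>S = {}" "a \<in> \<Union>S" "b \<in> \<Union>S"
proof (cases "\<exists>e\<in>E - S. e \<subseteq> \<Union>S")
  case True
  then obtain e where e: "e \<in> E - S" "e \<subseteq> \<Union>S" by blast
  then obtain u v where "e = {u, v}" "u \<noteq> v" using edge_obtain by (metis DiffD1)
  then show thesis using that[of u "[]" v] e by auto
next
  case False
  have SV: "\<Union>S \<subseteq> V" using assms(1) edge by blast
  obtain e where "e \<in> E - S" using assms(1,2) by blast
  then have "\<Union>S \<noteq> V" using False edge by blast
  then obtain a z where az: "a \<in> \<Union>S" "z \<in> V - \<Union>S" "{a, z} \<in> E"
    using conn_inD[OF assms(3) SV] ne(1) by blast
  obtain w where w: "w \<in> \<Union>S" "w \<noteq> a" using ne by metis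
  have "conn_in E (V - {a})" "z \<in> V - {a}" "w \<in> V - {a}" using assms(4) az w SV by auto
  then obtain xs where xs: "xs \<noteq> []" "distinct xs" "set xs \<subseteq> V - {a}" "hd xs = z" "last xs = w" "path_edges xs \<subseteq> E"
    using conn_in_path by metis
  have "\<exists>b\<in>set xs. b \<in> \<Union>S" using xs(1,5) w(1) last_in_set by blast
  then obtain ps b rest where split: "xs = ps @ b # rest" "b \<in> \<Union>S" "\<forall>q\<in>set ps. q \<notin> \<Union>S"
    using split_list_first_prop[of xs "\<lambda>q. q \<in> \<Union>S"] by blast
  have "ps \<noteq> []" using split xs(4) az(2) by (cases ps) auto
  then obtain qs where ps: "ps = z # qs" using split(1) xs(4) by (cases ps) auto
  have "path_edges (a # ps @ [b]) \<subseteq> E" using ps az(3) xs(6) path_edges_append[of ps b rest] split(1) by auto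
  moreover have "e \<notin> S" if "e \<in> path_edges (a # ps @ [b])" for e
  proof
    assume "e \<in> S"
    then have "e \<subseteq> \<Union>S" by blast
    then have "e \<subseteq> {a, b}" using path_edges_subset[OF that] split(3) by auto
    moreover have d: "distinct (a # ps @ [b])" using xs(2,3) split(1) by auto
    moreover have "card e = 2" using path_edges_edge_card[OF d that] .
    ultimately have "e = {a, b}" by (auto simp: card_2_iff)
    then show False using path_edges_ends_notin[OF d \<open>ps \<noteq> []\<close>] that by simp
  qed
  ultimately show thesis
    using that[of a ps b] xs(2,3) split az(1) by auto
qed

lemma face_structure_extend:
  assumes "conn_in E V" "\<And>v. v \<in> V \<Longrightarrow> conn_in E (V - {v})"
  shows "face_structure S F \<Longrightarrow> S \<noteq> {} \<Longrightarrow> \<exists>F'. face_structure E F'"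
proof (induction "card (E - S)" arbitrary: S F rule: less_induct)
  case less
  show ?case
  proof (cases "S = E")
    case True
    then show ?thesis using less.prems by blast
  next
    case False
    have SE: "S \<subseteq> E" using less.prems(1) by (simp add: face_structure_def)
    obtain e where "e \<in> S" using less.prems(2) by blast
    then obtain x y where xy: "x \<in> \<Union>S" "y \<in> \<Union>S" "x \<noteq> y" using edge_obtain SE by (metis UnionI insertCI subsetD)
    obtain a ps b where P: "distinct (a # ps @ [b])" "path_edges (a # ps @ [b]) \<subseteq> E - S"
      "set ps \<inter> \<Union>S = {}" "a \<in> \<Union>S" "b \<in> \<Union>S"
      using exists_ear[OF SE False assms xy] by metis
    obtain F' where F': "face_structure (S \<union> path_edges (a # ps @ [b])) F'"
      using face_structure_ear[OF less.prems(1) P] by blast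
    have "path_edges (a # ps @ [b]) \<noteq> {}" by (cases ps) auto
    then have "E - (S \<union> path_edges (a # ps @ [b])) \<subset> E - S" using P(2) by blast
    then have "card (E - (S \<union> path_edges (a # ps @ [b]))) < card (E - S)" using finE by (intro psubset_card_mono) auto
    from less.hyps[OF this F'] show ?thesis using less.prems(2) by blast
  qed
qed

text \<open>As the rest of the graph is connected, one side of \<open>C\<close> contains no vertex.
  It then meets no edge either, because every edge not in \<open>C\<close> has an end off
  \<open>C\<close>. So this side misses the whole drawing and has to be a face.\<close>

lemma triangle_is_face:
  assumes FS: "face_structure E F" and C: "is_circuit C" "C \<subseteq> E" and sep: "conn_in E (V - \<Union>C)"
    and induced: "\<And>e. e \<in> E \<Longrightarrow> e \<subseteq> \<Union>C \<Longrightarrow> e \<in> C"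
  shows "\<exists>f\<in>F. fst f = C"
proof -
  note J = is_circuit_Jordan[OF C]
  define Q where "Q = p ` \<Union>C"
  have CV: "\<Union>C \<subseteq> V" using C(2) edge by blast
  have QU: "Q \<subseteq> U C" using vertex_in_U[OF C(2)] CV unfolding Q_def by blast
  \<comment> \<open>The points of \<open>Q\<close> are removed because an edge not in
    \<open>C\<close> may still end on \<open>C\<close>; the remainder of the edge is connected and
    avoids the curve.\<close>
  have edge_side: "T - Q \<subseteq> inside (U C) \<or> T - Q \<subseteq> outside (U C)"
    if a1: "e \<in> E" and a2: "e \<notin> C" and a3: "T = path_image (\<gamma> e)" for e T
  proof -
    obtain u v where e: "e = {u, v}" "u \<noteq> v" by (rule edge_obtain[OF a1]) auto
    have eE: "{u, v} \<in> E" using a1 e(1) by simp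
    have j: "joins_by (p u) (p v) T" using joins_edge[OF eE] a3 e(1) by simp
    have "T \<inter> U C = U {e} \<inter> U C" by (simp add: U_def a3)
    also have "\<dots> = p ` (\<Union>{e} \<inter> \<Union>C)" using a1 a2 C(2) by (intro U_meet) auto
    finally have TU: "T \<inter> U C = p ` (e \<inter> \<Union>C)" by simp
    have "connected (T - Q)"
    proof (rule connected_intermediate_closure[OF joins_by_connected_diff[OF j]])
      have "Q \<inter> T \<subseteq> {p u, p v}"
      proof -
        have "Q \<inter> T \<subseteq> T \<inter> U C" using QU by blast
        also have "\<dots> \<subseteq> p ` e" unfolding TU by (rule image_mono) blast
        finally show ?thesis by (simp add: e(1))
      qed
      then show "T - {p u, p v} \<subseteq> T - Q" by blast
      show "T - Q \<subseteq> closure (T - {p u, p v})" using joins_by_subset_closure[OF j] by blast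
    qed
    moreover have "(T - Q) \<inter> U C = {}"
    proof -
      have gen: "\<And>A B D :: complex set. A \<inter> B \<subseteq> D \<Longrightarrow> (A - D) \<inter> B = {}" by blast
      show ?thesis by (rule gen) (simp add: TU Q_def image_mono)
    qed
    ultimately show ?thesis by (rule connected_inside_or_outside[OF _ _ J(11)])
  qed
  have vert: "p v \<in> inside (U C) \<or> p v \<in> outside (U C)" if "v \<in> V - \<Union>C" for v
  proof -
    have "p v \<notin> U C" using vertex_in_U[OF C(2), of v] that by blast
    then show ?thesis using J(8) by (metis ComplI UnE)
  qed
  have io: "x \<in> inside (U C) \<Longrightarrow> x \<notin> outside (U C)" for x using J(7) by blast
  have pnC: "p v \<notin> Q" if "v \<in> V - \<Union>C" for v
    using inj_on_image_mem_iff[OF inj, of v "\<Union>C"] CV that unfolding Q_def by blast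
  have "\<exists>R. side_of (U C) R \<and> (\<forall>v\<in>V - \<Union>C. p v \<notin> R)"
  proof (rule ccontr)
    assume a: "\<not> ?thesis"
    define A where "A = {v \<in> V - \<Union>C. p v \<in> inside (U C)}"
    have "\<exists>v\<in>V - \<Union>C. p v \<in> inside (U C)" "\<exists>v\<in>V - \<Union>C. p v \<in> outside (U C)"
      using a unfolding side_of_def by metis+
    then have "A \<subseteq> V - \<Union>C" "A \<noteq> {}" "A \<noteq> V - \<Union>C"
      using io unfolding A_def by blast+
    then obtain u v where uv: "u \<in> A" "v \<in> V - \<Union>C - A" "{u, v} \<in> E"
      using conn_inD[OF sep] by metis
    then have "u \<notin> \<Union>C" by (auto simp: A_def)
    then have "{u, v} \<notin> C" by auto
    moreover have "p u \<in> path_image (\<gamma> {u, v}) - Q" "p v \<in> path_image (\<gamma> {u, v}) - Q"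
      using vertex_on_edge[OF uv(3)] pnC uv(1,2) unfolding A_def by auto
    moreover have "p u \<in> inside (U C)" "p v \<in> outside (U C)" using uv vert[of v] by (auto simp: A_def)
    ultimately show False using edge_side[OF uv(3) _ refl] io by blast
  qed
  then obtain R where R: "side_of (U C) R" "\<forall>v\<in>V - \<Union>C. p v \<notin> R" by blast
  note Rp = side_of_circuit[OF C R(1)]
  have RU: "R \<inter> U E = {}"
  proof (rule ccontr)
    assume "\<not> ?thesis"
    then obtain q e where q: "q \<in> R" "e \<in> E" "q \<in> path_image (\<gamma> e)" by (auto simp: U_def)
    have "q \<notin> U C" using q(1) Rp(5) by blast
    then have "e \<notin> C" using q(3) by (auto simp: U_def)
    then obtain v where v: "v \<in> e" "v \<notin> \<Union>C" using induced q(2) by blast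
    then have vV: "v \<in> V - \<Union>C" using edge q(2) by blast
    have "p v \<in> path_image (\<gamma> e) - Q" using vertex_on_edge[OF q(2)] v pnC[OF vV] vV by auto
    moreover have "q \<in> path_image (\<gamma> e) - Q"
      using q(3) \<open>q \<notin> U C\<close> QU by blast
    moreover have "p v \<notin> R" using R(2) vV by blast
    ultimately show False
      using edge_side[OF q(2) \<open>e \<notin> C\<close> refl] R(1) q(1) io unfolding side_of_def by blast
  qed
  have F: "\<And>f. f \<in> F \<Longrightarrow> is_circuit (fst f) \<and> fst f \<subseteq> E \<and> side_of (U (fst f)) (snd f)"
    "\<forall>f\<in>F. \<forall>g\<in>F. f \<noteq> g \<longrightarrow> snd f \<inter> snd g = {}" "\<Union>(snd ` F) = - U E"
    using FS unfolding face_structure_def by (auto simp: split_beta)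
  obtain f where f: "f \<in> F" "R \<subseteq> snd f"
  proof (rule connected_in_one_region[of R F])
    show "R \<subseteq> \<Union>(snd ` F)" using RU F(3) by blast
    show "\<forall>f\<in>F. open (snd f)" using F(1) side_of_circuit(2) by blast
  qed (use Rp F(2) in auto)
  have D: "is_circuit (fst f)" "fst f \<subseteq> E" "side_of (U (fst f)) (snd f)" using F(1)[OF f(1)] by auto
  note Dp = side_of_circuit[OF D]
  \<comment> \<open>Conversely, the face containing \<open>R\<close> avoids the curve and so cannot
    exceed the side \<open>R\<close>. Equal regions have equal frontiers, and the frontier
    determines the circuit.\<close>
  have "snd f \<inter> U C = {}"
  proof -
    have "snd f \<subseteq> - U E" using F(3) f(1) by blast
    then show ?thesis using C(2) by (auto simp: U_def)
  qed
  then have "snd f \<subseteq> inside (U C) \<or> snd f \<subseteq> outside (U C)"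
    using connected_inside_or_outside[OF Dp(3) _ J(11)] by blast
  then have "snd f = R" using f(2) R(1) Rp(1) io unfolding side_of_def by blast
  then have "U (fst f) = U C" using Dp(4) Rp(4) by simp
  then have "fst f = C" using U_subset_imp C(2) D(2) by (metis subset_antisym subset_refl)
  then show ?thesis using f(1) by blast
qed

end

section \<open>Combinatorial faces and discharging\<close>

lemma path_edges_nth: "Suc i < length xs \<Longrightarrow> {xs ! i, xs ! Suc i} \<in> path_edges xs"
proof (induction xs arbitrary: i rule: path_edges.induct)
  case (1 x y zs)
  then show ?case by (cases i) auto
qed auto

lemma has_circuitI:
  assumes "distinct vs" "3 \<le> length vs" "path_edges (vs @ [hd vs]) \<subseteq> E" "\<And>e. e \<in> E \<Longrightarrow> e \<subseteq> V"
  shows "has_circuit V E (length vs)"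
  unfolding has_circuit_def
proof (intro conjI exI[of _ vs] allI impI)
  have "set vs \<subseteq> \<Union>(path_edges (vs @ [hd vs]))" using assms(2) by (subst Union_path_edges) auto
  then show "set vs \<subseteq> V" using assms(3,4) by blast
  fix i assume i: "i < length vs"
  have "{(vs @ [hd vs]) ! i, (vs @ [hd vs]) ! Suc i} \<in> E"
    using path_edges_nth[of i "vs @ [hd vs]"] i assms(3) by auto
  moreover have "(vs @ [hd vs]) ! Suc i = vs ! (Suc i mod length vs)"
  proof (cases "Suc i < length vs")
    case True
    then show ?thesis by (simp add: nth_append)
  next
    case False
    then have "Suc i = length vs" using i by simp
    then show ?thesis using i by (simp add: nth_append hd_conv_nth flip: length_greater_0_conv)
  qed
  ultimately show "{vs ! i, vs ! (Suc i mod length vs)} \<in> E" using i by (simp add: nth_append)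
qed (use assms in auto)

lemma is_circuit_from_edge:
  assumes "is_circuit C" "{a, b} \<in> C" "a \<noteq> b"
  obtains xs where "distinct (a # b # xs)" "C = path_edges (a # b # xs @ [a])" "card C = length xs + 2"
proof -
  have "a \<in> \<Union>C" using assms(2) by blast
  then obtain zs where zs: "2 \<le> length zs" "distinct (a # zs)" "C = path_edges (a # zs @ [a])"
    using is_circuit_from[OF assms(1)] by metis
  have len: "card C = length zs + 1"
  proof -
    have "\<Union>C = set (a # zs)" using zs(3) by auto
    then show ?thesis using is_circuit_card[OF assms(1)] distinct_card[OF zs(2)] by simp
  qed
  obtain h ys where h: "zs = h # ys" using zs(1) by (cases zs) auto
  obtain us l where l: "zs = us @ [l]" using zs(1) by (cases zs rule: rev_cases) auto
  have "C = path_edges (a # zs) \<union> {{l, a}}" using zs(3) path_edges_append[of "a # us" l "[a]"] l by simp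
  then have in_C: "{a, b} \<in> path_edges (a # zs) \<or> {a, b} = {l, a}" using assms(2) by (metis UnE singletonD)
  have at: "{e \<in> path_edges (a # zs). a \<in> e} = {{a, h}}" using path_edges_at_hd[OF zs(2)] h by simp
  have "e = {a, h}" if "e \<in> path_edges (a # zs)" "a \<in> e" for e
    using that at by (metis (mono_tags, lifting) mem_Collect_eq singletonD)
  with in_C have "{a, b} = {a, h} \<or> {a, b} = {l, a}" by (metis insertI1)
  then consider "b = h" | "b = l" by (metis doubleton_eq_iff)
  then show thesis
  proof cases
    case 1
    then show thesis using that[of ys] zs len h by auto
  next
    case 2
    \<comment> \<open>Here \<open>b\<close> precedes \<open>a\<close> in the cyclic order, so the
      circuit is traversed backwards.\<close>
    have "C = path_edges (a # rev zs @ [a])" using zs(3) path_edges_rev[of "a # zs @ [a]"] by simp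
    then show thesis using that[of "rev us"] zs len l 2 by auto
  qed
qed

text \<open>What discharging uses of a drawing: regions are forgotten, and a face is only known by
  its boundary \<open>bd\<close>. \<open>Z\<close> is the clique along which the piece hangs, whose
  vertices may have lost edges. \<open>triangle_deg\<close> and \<open>K4_deg\<close> express that
  an edge or a triangle does not separate the piece, so that a vertex adjacent to all of it has a
  further neighbour.\<close>

locale plane_faces =
  fixes V :: "'a set" and E :: "'a set set" and F :: "'f set" and bd :: "'f \<Rightarrow> 'a set set" and Z :: "'a set"
  assumes finV: "finite V" and edge: "\<And>e. e \<in> E \<Longrightarrow> e \<subseteq> V \<and> card e = 2" and finF: "finite F"
    and cycF: "\<And>f. f \<in> F \<Longrightarrow> is_circuit (bd f) \<and> bd f \<subseteq> E"
    and two: "\<And>e. e \<in> E \<Longrightarrow> card {f \<in> F. e \<in> bd f} = 2"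
    and euler: "card F + card V = card E + 2"
    and link: "\<And>v A. A \<subseteq> {e \<in> E. v \<in> e} \<Longrightarrow> A \<noteq> {} \<Longrightarrow> A \<noteq> {e \<in> E. v \<in> e} \<Longrightarrow>
      \<exists>f\<in>F. \<exists>e\<in>A. \<exists>e'\<in>{e \<in> E. v \<in> e} - A. e \<in> bd f \<and> e' \<in> bd f"
    and ZV: "Z \<subseteq> V" and Z3: "card Z \<le> 3"
    and deg4: "\<And>v. v \<in> V - Z \<Longrightarrow> 4 \<le> card {e \<in> E. v \<in> e}"
    and deg2: "\<And>v. v \<in> V \<Longrightarrow> 2 \<le> card {e \<in> E. v \<in> e}"
    and triangle_face: "\<And>a b c. {a, b} \<in> E \<Longrightarrow> {b, c} \<in> E \<Longrightarrow> {c, a} \<in> E \<Longrightarrow> \<exists>f\<in>F. bd f = {{a, b}, {b, c}, {c, a}}"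
    and triangle_deg: "\<And>a b c. {a, b} \<in> E \<Longrightarrow> {b, c} \<in> E \<Longrightarrow> {c, a} \<in> E \<Longrightarrow> 3 \<le> card {e \<in> E. a \<in> e}"
    and K4_deg: "\<And>v a b c. {v, a} \<in> E \<Longrightarrow> {v, b} \<in> E \<Longrightarrow> {v, c} \<in> E \<Longrightarrow>
      {a, b} \<in> E \<Longrightarrow> {b, c} \<in> E \<Longrightarrow> {c, a} \<in> E \<Longrightarrow> 4 \<le> card {e \<in> E. v \<in> e}"
begin

definition star :: "'a \<Rightarrow> 'a set set" where "star v = {e \<in> E. v \<in> e}"

abbreviation deg :: "'a \<Rightarrow> nat" where "deg v \<equiv> card (star v)"

abbreviation sz :: "'f \<Rightarrow> nat" where "sz f \<equiv> card (bd f)"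

lemma finE: "finite E" by (rule finite_subset[of _ "Pow V"]) (use edge finV in auto)

lemma fin_star [simp]: "finite (star v)" using finE by (simp add: star_def)

lemma fin_bd: "f \<in> F \<Longrightarrow> finite (bd f)" using cycF is_circuit_finite by blast

lemma edge_neq: "{u, v} \<in> E \<Longrightarrow> u \<noteq> v" using edge[of "{u, v}"] by auto

lemma bdE: "f \<in> F \<Longrightarrow> e \<in> bd f \<Longrightarrow> e \<in> E" using cycF by blast

lemma in_star: "{v, a} \<in> star v \<longleftrightarrow> {v, a} \<in> E" by (simp add: star_def)

lemma star_obtain: "e \<in> star v \<Longrightarrow> (\<And>a. e = {v, a} \<Longrightarrow> a \<noteq> v \<Longrightarrow> th) \<Longrightarrow> th"
  unfolding star_def using edge card2_joins by (metis (no_types, lifting) card_2_iff' mem_Collect_eq)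

lemma bd_at:
  assumes "f \<in> F" "{v, a} \<in> bd f"
  obtains b where "b \<noteq> a" "{v, b} \<in> bd f" "\<And>e. e \<in> bd f \<Longrightarrow> v \<in> e \<Longrightarrow> e = {v, a} \<or> e = {v, b}"
proof -
  have c: "is_circuit (bd f)" "v \<in> \<Union>(bd f)" using cycF assms by auto
  obtain x y where xy: "{e \<in> bd f. v \<in> e} = {{v, x}, {v, y}}" "x \<noteq> y" by (rule is_circuit_edges_at[OF c]) auto
  have "{v, a} \<in> {e \<in> bd f. v \<in> e}" using assms(2) by simp
  then have "a = x \<or> a = y" unfolding xy(1) by (auto simp: doubleton_eq_iff)
  moreover have "{v, x} \<in> bd f" "{v, y} \<in> bd f" using xy(1) by blast+
  moreover have "e = {v, x} \<or> e = {v, y}" if "e \<in> bd f" "v \<in> e" for e using that xy(1) by blast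
  ultimately show thesis using that[of x] that[of y] xy(2) by metis
qed

lemma bd_third:
  assumes "f \<in> F" "{v, a} \<in> bd f" "{v, b} \<in> bd f" "a \<noteq> b" "e \<in> bd f" "v \<in> e"
  shows "e = {v, a} \<or> e = {v, b}"
proof -
  obtain c where c: "\<And>e. e \<in> bd f \<Longrightarrow> v \<in> e \<Longrightarrow> e = {v, a} \<or> e = {v, c}"
    using bd_at[OF assms(1,2)] by blast
  have "{v, b} = {v, a} \<or> {v, b} = {v, c}" using c[OF assms(3)] by simp
  then have "b = c" using assms(4) by (auto simp: doubleton_eq_iff)
  then show ?thesis using c[OF assms(5,6)] by simp
qed

lemma faces_of:
  assumes "e \<in> bd f" "e \<in> bd g" "f \<in> F" "g \<in> F" "f \<noteq> g"
  shows "{h \<in> F. e \<in> bd h} = {f, g}"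
proof -
  have "card {h \<in> F. e \<in> bd h} = 2" using two bdE assms by blast
  moreover have "{f, g} \<subseteq> {h \<in> F. e \<in> bd h}" using assms by auto
  ultimately show ?thesis using finF assms(5) card_subset_eq[of "{h \<in> F. e \<in> bd h}" "{f, g}"] by simp
qed

lemma faces_of_D: "e \<in> bd f \<Longrightarrow> e \<in> bd g \<Longrightarrow> f \<in> F \<Longrightarrow> g \<in> F \<Longrightarrow> f \<noteq> g \<Longrightarrow> h \<in> F \<Longrightarrow> e \<in> bd h \<Longrightarrow> h = f \<or> h = g"
  using faces_of[of e f g] by blast

lemma other_face:
  assumes "f \<in> F" "e \<in> bd f"
  obtains g where "g \<in> F" "g \<noteq> f" "e \<in> bd g"
proof -
  have "card {h \<in> F. e \<in> bd h} = 2" using two bdE assms by blast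
  moreover have "f \<in> {h \<in> F. e \<in> bd h}" using assms by auto
  ultimately have "\<exists>g\<in>{h \<in> F. e \<in> bd h}. g \<noteq> f" by (metis card_2_iff')
  then show thesis using that by blast
qed

lemma edge_faces:
  assumes "e \<in> E"
  obtains f g where "f \<in> F" "g \<in> F" "f \<noteq> g" "e \<in> bd f" "e \<in> bd g" "{h \<in> F. e \<in> bd h} = {f, g}"
  using two[OF assms] that by (auto simp: card_2_iff)

text \<open>The faces around \<open>v\<close> form a single cycle, so edges at \<open>v\<close> that
  are closed under passing through a face are all edges at \<open>v\<close>. This turns coincidences
  of faces into degrees.\<close>

lemma closed_star:
  assumes "A \<subseteq> star v" "A \<noteq> {}" "\<And>f e e'. f \<in> F \<Longrightarrow> e \<in> A \<Longrightarrow> e \<in> bd f \<Longrightarrow> e' \<in> bd f \<Longrightarrow> v \<in> e' \<Longrightarrow> e' \<in> A"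
  shows "star v = A"
  using link[of A v] assms unfolding star_def by blast

lemma two_faces_closed:
  assumes "f \<in> F" "g \<in> F" "f \<noteq> g" "{v, a} \<in> bd f" "{v, b} \<in> bd f" "{v, a} \<in> bd g" "{v, b} \<in> bd g" "a \<noteq> b"
  shows "star v = {{v, a}, {v, b}}" "deg v = 2"
proof -
  show s: "star v = {{v, a}, {v, b}}"
  proof (rule closed_star)
    show "{{v, a}, {v, b}} \<subseteq> star v" using bdE assms by (auto simp: star_def)
    fix h e e' assume h: "h \<in> F" "e \<in> {{v, a}, {v, b}}" "e \<in> bd h" "e' \<in> bd h" "v \<in> e'"
    have "h = f \<or> h = g" using faces_of_D[of e f g h] h assms by auto
    moreover have "h = f \<Longrightarrow> e' \<in> {{v, a}, {v, b}}" using bd_third[of f v a b e'] h(4,5) assms by simp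
    moreover have "h = g \<Longrightarrow> e' \<in> {{v, a}, {v, b}}" using bd_third[of g v a b e'] h(4,5) assms by simp
    ultimately show "e' \<in> {{v, a}, {v, b}}" by (elim disjE)
  qed simp
  show "deg v = 2" using assms(8) by (simp add: s doubleton_eq_iff)
qed

lemma three_faces_closed:
  assumes F: "f \<in> F" "g \<in> F" "h \<in> F" "f \<noteq> g" "g \<noteq> h" "f \<noteq> h"
    and b: "{v, a} \<in> bd f" "{v, b} \<in> bd f" "{v, b} \<in> bd g" "{v, c} \<in> bd g" "{v, c} \<in> bd h" "{v, a} \<in> bd h"
    and "a \<noteq> b" "b \<noteq> c" "a \<noteq> c"
  shows "star v = {{v, a}, {v, b}, {v, c}}" "deg v = 3"
proof -
  show s: "star v = {{v, a}, {v, b}, {v, c}}"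
  proof (rule closed_star)
    show "{{v, a}, {v, b}, {v, c}} \<subseteq> star v" using bdE F b by (auto simp: star_def)
    fix k e e' assume k: "k \<in> F" "e \<in> {{v, a}, {v, b}, {v, c}}" "e \<in> bd k" "e' \<in> bd k" "v \<in> e'"
    from k(2) consider "e = {v, a}" | "e = {v, b}" | "e = {v, c}" by blast
    then have "k = f \<or> k = g \<or> k = h"
    proof cases
      case 1
      then show ?thesis using faces_of_D[of "{v, a}" f h k] k F b by auto
    next
      case 2
      then show ?thesis using faces_of_D[of "{v, b}" f g k] k F b by auto
    next
      case 3
      then show ?thesis using faces_of_D[of "{v, c}" g h k] k F b by auto
    qed
    moreover have "k = f \<Longrightarrow> e' \<in> {{v, a}, {v, b}}" using bd_third[of f v a b e'] k(4,5) F b assms(13) by simp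
    moreover have "k = g \<Longrightarrow> e' \<in> {{v, b}, {v, c}}" using bd_third[of g v b c e'] k(4,5) F b assms(14) by simp
    moreover have "k = h \<Longrightarrow> e' \<in> {{v, a}, {v, c}}" using bd_third[of h v a c e'] k(4,5) F b assms(15) by simp
    ultimately show "e' \<in> {{v, a}, {v, b}, {v, c}}" by (metis insert_iff)
  qed simp
  show "deg v = 3" using assms(13-15) by (simp add: s doubleton_eq_iff)
qed

lemma sz_ge_3: "f \<in> F \<Longrightarrow> 3 \<le> sz f" using cycF is_circuit_card_ge_3 by blast

lemma face3:
  assumes "f \<in> F" "sz f = 3" "{a, b} \<in> bd f"
  obtains c where "c \<noteq> a" "c \<noteq> b" "a \<noteq> b" "bd f = {{a, b}, {b, c}, {c, a}}"
proof -
  have n: "a \<noteq> b" using edge_neq bdE assms by blast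
  then obtain xs where xs: "distinct (a # b # xs)" "bd f = path_edges (a # b # xs @ [a])" "sz f = length xs + 2"
    using is_circuit_from_edge[of "bd f" a b] cycF[OF assms(1)] assms(3) by metis
  then obtain c where "xs = [c]" using assms(2) by (cases xs) auto
  then show thesis using that[of c] xs n by auto
qed

lemma face4:
  assumes "f \<in> F" "sz f = 4" "{a, b} \<in> bd f"
  obtains c d where "distinct [a, b, c, d]" "bd f = {{a, b}, {b, c}, {c, d}, {d, a}}"
proof -
  have "a \<noteq> b" using edge_neq bdE assms by blast
  then obtain xs where xs: "distinct (a # b # xs)" "bd f = path_edges (a # b # xs @ [a])" "sz f = length xs + 2"
    using is_circuit_from_edge[of "bd f" a b] cycF[OF assms(1)] assms(3) by metis
  then obtain c ys where c: "xs = c # ys" using assms(2) by (cases xs) auto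
  then obtain d where "ys = [d]" using assms(2) xs(3) by (cases ys) auto
  then show thesis using that[of c d] xs c by auto
qed

lemma face5:
  assumes "f \<in> F" "sz f = 5" "{a, b} \<in> bd f"
  obtains c d e where "distinct [a, b, c, d, e]" "bd f = {{a, b}, {b, c}, {c, d}, {d, e}, {e, a}}"
proof -
  have "a \<noteq> b" using edge_neq bdE assms by blast
  then obtain xs where xs: "distinct (a # b # xs)" "bd f = path_edges (a # b # xs @ [a])" "sz f = length xs + 2"
    using is_circuit_from_edge[of "bd f" a b] cycF[OF assms(1)] assms(3) by metis
  then obtain c ys where c: "xs = c # ys" using assms(2) by (cases xs) auto
  then obtain d zs where d: "ys = d # zs" using assms(2) xs(3) by (cases ys) auto
  then obtain e where "zs = [e]" using assms(2) xs(3) c by (cases zs) auto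
  then show thesis using that[of c d e] xs c d by auto
qed

lemma no_circuit:
  assumes "\<not> has_circuit V E k" "distinct vs" "length vs = k" "3 \<le> k"
  shows "\<not> path_edges (vs @ [hd vs]) \<subseteq> E"
  using has_circuitI[of vs E V] assms edge by blast

lemma sz_neq:
  assumes "\<not> has_circuit V E k" "f \<in> F"
  shows "sz f \<noteq> k"
proof
  assume k: "sz f = k"
  obtain vs where vs: "3 \<le> length vs" "distinct vs" "bd f = path_edges (vs @ [hd vs])"
    using cycF[OF assms(2)] by (auto simp: is_circuit_def)
  have "\<Union>(bd f) = set vs" using Union_path_edges[of "vs @ [hd vs]"] vs by (cases vs) auto
  then have "length vs = k" using is_circuit_card cycF[OF assms(2)] k distinct_card[OF vs(2)] by metis
  then show False using no_circuit[OF assms(1) vs(2)] vs cycF[OF assms(2)] by simp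
qed

lemma triangle_deg_face: "f \<in> F \<Longrightarrow> bd f = {{a, b}, {b, c}, {c, a}} \<Longrightarrow> 3 \<le> deg a"
  using triangle_deg[of a b c] bdE[of f] unfolding star_def by simp

text \<open>With the same third vertex the two triangles would close up around \<open>v\<close> and
  leave it degree two, against \<open>triangle_deg\<close>.\<close>

lemma two_triangles:
  assumes "f \<in> F" "g \<in> F" "f \<noteq> g" "sz f = 3" "sz g = 3" "{v, a} \<in> bd f" "{v, a} \<in> bd g"
  obtains b c where "distinct [v, a, b, c]" "bd f = {{v, a}, {a, b}, {b, v}}" "bd g = {{v, a}, {a, c}, {c, v}}"
proof -
  obtain b where b: "b \<noteq> v" "b \<noteq> a" "v \<noteq> a" "bd f = {{v, a}, {a, b}, {b, v}}" using face3[OF assms(1,4,6)] by metis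
  obtain c where c: "c \<noteq> v" "c \<noteq> a" "bd g = {{v, a}, {a, c}, {c, v}}" using face3[OF assms(2,5,7)] by metis
  have "b \<noteq> c"
  proof
    assume "b = c"
    then have "deg v = 2" using two_faces_closed(2)[OF assms(1-3), of v a b] b c by (auto simp: insert_commute)
    then show False using triangle_deg_face[OF assms(1) b(4)] by simp
  qed
  then show thesis using that[of b c] b c by auto
qed

text \<open>The three faces close up and leave \<open>v\<close> degree three, while
  \<open>K4_deg\<close> provides a fourth edge.\<close>

lemma triangles_around_deg3:
  assumes "f \<in> F" "g \<in> F" "h \<in> F" "f \<noteq> g" "g \<noteq> h" "f \<noteq> h"
    and b: "bd f = {{v, a}, {a, b}, {b, v}}" "bd g = {{v, b}, {b, c}, {c, v}}" "bd h = {{v, c}, {c, a}, {a, v}}"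
    and "a \<noteq> b" "b \<noteq> c" "a \<noteq> c"
  shows False
proof -
  have "deg v = 3" by (rule three_faces_closed(2)[of f g h v a b c]) (use assms in \<open>auto simp: insert_commute\<close>)
  moreover have "4 \<le> deg v" unfolding star_def
    by (rule K4_deg[of v a b c]) (use b bdE[of f] bdE[of g] bdE[of h] assms(1-3) in \<open>auto simp: insert_commute\<close>)
  ultimately show False by simp
qed

section \<open>Double counting and the balance of charges\<close>

lemma sum_deg: "(\<Sum>v\<in>V. real (deg v)) = 2 * real (card E)"
proof -
  have "(\<Sum>v\<in>V. real (deg v)) = (\<Sum>v\<in>V. \<Sum>e | e \<in> E \<and> v \<in> e. 1)" by (simp add: star_def)
  also have "\<dots> = (\<Sum>e\<in>E. \<Sum>v | v \<in> V \<and> v \<in> e. 1)" by (rule sum.swap_restrict[OF finV finE])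
  also have "\<dots> = (\<Sum>e\<in>E. 2)"
  proof (rule sum.cong)
    fix e assume "e \<in> E"
    then have "{v \<in> V. v \<in> e} = e" "card e = 2" using edge by auto
    then show "(\<Sum>v | v \<in> V \<and> v \<in> e. 1) = (2::real)" by simp
  qed simp
  finally show ?thesis by simp
qed

lemma sum_bd: "(\<Sum>f\<in>F. \<Sum>e\<in>bd f. \<phi> f e) = (\<Sum>e\<in>E. \<Sum>f | f \<in> F \<and> e \<in> bd f. \<phi> f e)"
proof -
  have "(\<Sum>f\<in>F. \<Sum>e\<in>bd f. \<phi> f e) = (\<Sum>f\<in>F. \<Sum>e | e \<in> E \<and> e \<in> bd f. \<phi> f e)"
    by (intro sum.cong) (use cycF in \<open>auto intro!: arg_cong[where f = "sum _"]\<close>)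
  also have "\<dots> = (\<Sum>e\<in>E. \<Sum>f | f \<in> F \<and> e \<in> bd f. \<phi> f e)" by (rule sum.swap_restrict[OF finF finE])
  finally show ?thesis .
qed

lemma sum_sz: "(\<Sum>f\<in>F. real (sz f)) = 2 * real (card E)"
proof -
  have "(\<Sum>f\<in>F. real (sz f)) = (\<Sum>f\<in>F. \<Sum>e\<in>bd f. 1)" by simp
  also have "\<dots> = (\<Sum>e\<in>E. \<Sum>f | f \<in> F \<and> e \<in> bd f. 1)" by (rule sum_bd)
  also have "\<dots> = (\<Sum>e\<in>E. 2)" by (intro sum.cong) (use two in auto)
  finally show ?thesis by simp
qed

text \<open>Charge \<open>\<phi> f e\<close> moves from the face \<open>f\<close> to the edge \<open>e\<close>, \<open>\<psi> e v\<close> from \<open>e\<close> to its end \<open>v\<close>, and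
  \<open>\<theta> v f\<close> from \<open>v\<close> to \<open>f\<close>.\<close>

lemma discharging:
  fixes p q r c :: real and \<phi> :: "'f \<Rightarrow> 'a set \<Rightarrow> real" and \<psi> :: "'a set \<Rightarrow> 'a \<Rightarrow> real" and \<theta> :: "'a \<Rightarrow> 'f \<Rightarrow> real"
  assumes q: "q = 2 * p + 2 * r"
    and face: "\<And>f. f \<in> F \<Longrightarrow> 0 \<le> r * sz f - q - (\<Sum>e\<in>bd f. \<phi> f e) + (\<Sum>v | v \<in> V \<and> v \<in> \<Union>(bd f). \<theta> v f)"
    and edge_ch: "\<And>e. e \<in> E \<Longrightarrow> 0 \<le> (\<Sum>f | f \<in> F \<and> e \<in> bd f. \<phi> f e) - (\<Sum>v\<in>e. \<psi> e v)"
    and vert: "\<And>v. v \<in> V - Z \<Longrightarrow> 0 \<le> p * deg v - q + (\<Sum>e\<in>star v. \<psi> e v) - (\<Sum>f | f \<in> F \<and> v \<in> \<Union>(bd f). \<theta> v f)"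
    and vertZ: "\<And>v. v \<in> Z \<Longrightarrow> - c \<le> p * deg v - q + (\<Sum>e\<in>star v. \<psi> e v) - (\<Sum>f | f \<in> F \<and> v \<in> \<Union>(bd f). \<theta> v f)"
    and c: "card Z * c < 2 * q"
  shows False
proof -
  let ?cv = "\<lambda>v. p * deg v - q + (\<Sum>e\<in>star v. \<psi> e v) - (\<Sum>f | f \<in> F \<and> v \<in> \<Union>(bd f). \<theta> v f)"
  let ?cf = "\<lambda>f. r * sz f - q - (\<Sum>e\<in>bd f. \<phi> f e) + (\<Sum>v | v \<in> V \<and> v \<in> \<Union>(bd f). \<theta> v f)"
  let ?ce = "\<lambda>e. (\<Sum>f | f \<in> F \<and> e \<in> bd f. \<phi> f e) - (\<Sum>v\<in>e. \<psi> e v)"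
  have s1: "(\<Sum>v\<in>V. \<Sum>e\<in>star v. \<psi> e v) = (\<Sum>e\<in>E. \<Sum>v\<in>e. \<psi> e v)"
  proof -
    have "(\<Sum>v\<in>V. \<Sum>e\<in>star v. \<psi> e v) = (\<Sum>e\<in>E. \<Sum>v | v \<in> V \<and> v \<in> e. \<psi> e v)"
      unfolding star_def by (rule sum.swap_restrict[OF finV finE])
    also have "\<dots> = (\<Sum>e\<in>E. \<Sum>v\<in>e. \<psi> e v)"
      by (intro sum.cong) (use edge in \<open>auto intro!: arg_cong[where f = "sum _"]\<close>)
    finally show ?thesis .
  qed
  have s2: "(\<Sum>v\<in>V. \<Sum>f | f \<in> F \<and> v \<in> \<Union>(bd f). \<theta> v f) = (\<Sum>f\<in>F. \<Sum>v | v \<in> V \<and> v \<in> \<Union>(bd f). \<theta> v f)"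
    by (rule sum.swap_restrict[OF finV finF])
  have e: "real (card F) + real (card V) = real (card E) + 2" using euler by linarith
  \<comment> \<open>All transfers cancel. By \<open>q = 2 * p + 2 * r\<close> the edge terms then
    cancel too, and Euler's formula leaves \<open>- (2 * q)\<close>.\<close>
  have "(\<Sum>v\<in>V. ?cv v) + (\<Sum>e\<in>E. ?ce e) + (\<Sum>f\<in>F. ?cf f)
      = p * (\<Sum>v\<in>V. real (deg v)) + r * (\<Sum>f\<in>F. real (sz f)) - q * (real (card F) + real (card V))"
    unfolding sum.distrib sum_subtractf sum_bd s1 s2 by (simp add: sum_distrib_left algebra_simps)
  also have "\<dots> = - (2 * q)" unfolding sum_deg sum_sz e q by (simp add: algebra_simps)
  finally have tot: "(\<Sum>v\<in>V. ?cv v) + (\<Sum>e\<in>E. ?ce e) + (\<Sum>f\<in>F. ?cf f) = - (2 * q)" .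
  have "0 \<le> (\<Sum>e\<in>E. ?ce e)" "0 \<le> (\<Sum>f\<in>F. ?cf f)" by (intro sum_nonneg face edge_ch; assumption)+
  moreover have "(\<Sum>v\<in>V. ?cv v) = (\<Sum>v\<in>V - Z. ?cv v) + (\<Sum>v\<in>Z. ?cv v)"
    by (rule sum.subset_diff[OF ZV finV])
  moreover have "0 \<le> (\<Sum>v\<in>V - Z. ?cv v)" by (intro sum_nonneg vert)
  moreover have "(\<Sum>v\<in>Z. ?cv v) \<ge> (\<Sum>v\<in>Z. - c)" by (intro sum_mono vertZ)
  ultimately show False using tot c by simp
qed

section \<open>Circuits of length three\<close>

lemma circuit3: "has_circuit V E 3"
proof (rule ccontr)
  assume n: "\<not> has_circuit V E 3"
  have "real (card Z) \<le> 3" using Z3 by simp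
  then show False
  \<comment> \<open>No charge has to move: faces have length at least four, and three vertices at -2
    cannot make up the total of -8.\<close>
  proof (intro discharging[of 4 1 1 "\<lambda>_ _. 0" "\<lambda>_ _. 0" "\<lambda>_ _. 0" 2])
    fix f assume "f \<in> F"
    then have "4 \<le> sz f" using sz_ge_3[of f] sz_neq[OF n, of f] by linarith
    then show "0 \<le> 1 * real (sz f) - 4 - (\<Sum>e\<in>bd f. 0) + (\<Sum>v | v \<in> V \<and> v \<in> \<Union>(bd f). 0)" by simp
  next
    fix v assume "v \<in> V - Z"
    then show "0 \<le> 1 * real (deg v) - 4 + (\<Sum>e\<in>star v. 0) - (\<Sum>f | f \<in> F \<and> v \<in> \<Union>(bd f). 0)"
      using deg4[of v] by (simp add: star_def)
  next
    fix v assume "v \<in> Z"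
    then show "- 2 \<le> 1 * real (deg v) - 4 + (\<Sum>e\<in>star v. 0) - (\<Sum>f | f \<in> F \<and> v \<in> \<Union>(bd f). 0)"
      using deg2[of v] ZV by (auto simp: star_def)
  qed auto
qed

subsection \<open>Circuits of length five\<close>

lemma circuit4I: "distinct [a, b, c, d] \<Longrightarrow> {{a, b}, {b, c}, {c, d}, {d, a}} \<subseteq> E \<Longrightarrow> has_circuit V E 4"
  using no_circuit[of 4 "[a, b, c, d]"] by auto

lemma circuit5I: "distinct [a, b, c, d, e] \<Longrightarrow> {{a, b}, {b, c}, {c, d}, {d, e}, {e, a}} \<subseteq> E \<Longrightarrow> has_circuit V E 5"
  using no_circuit[of 5 "[a, b, c, d, e]"] by auto

lemma circuit6I: "distinct [a, b, c, d, e, f] \<Longrightarrow> {{a, b}, {b, c}, {c, d}, {d, e}, {e, f}, {f, a}} \<subseteq> E \<Longrightarrow> has_circuit V E 6"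
  using no_circuit[of 6 "[a, b, c, d, e, f]"] by auto

lemma bd_subset: "f \<in> F \<Longrightarrow> bd f \<subseteq> E" using cycF by blast

lemma triangle_deg_at:
  assumes "f \<in> F" "sz f = 3" "{v, a} \<in> bd f"
  shows "3 \<le> deg v"
proof -
  obtain b where "bd f = {{v, a}, {a, b}, {b, v}}" using face3[OF assms] by metis
  then show ?thesis by (rule triangle_deg_face[OF assms(1)])
qed

lemma triangle_shares_one_edge:
  assumes "f \<in> F" "g \<in> F" "f \<noteq> g" "sz f = 3" "{v, a} \<in> bd f" "{v, b} \<in> bd f" "{v, a} \<in> bd g" "{v, b} \<in> bd g"
  shows "a = b"
  using two_faces_closed(2)[OF assms(1-3,5-8)] triangle_deg_at[OF assms(1,4,5)] by auto

text \<open>With \<open>x = y\<close> the three triangles would close up around \<open>v\<close>.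
  For graphs without 5-circuits this excludes three consecutive triangles, because
  \<open>v x a b y\<close> is a circuit.\<close>

lemma three_triangles:
  assumes F: "f \<in> F" "g \<in> F" "h \<in> F" "f \<noteq> g" "g \<noteq> h" and s: "sz f = 3" "sz g = 3" "sz h = 3"
    and b: "{v, a} \<in> bd f" "{v, a} \<in> bd g" "{v, b} \<in> bd g" "{v, b} \<in> bd h" "a \<noteq> b"
  obtains x y where "f \<noteq> h" "distinct [v, x, a, b, y]" "bd f = {{v, a}, {a, x}, {x, v}}"
    "bd g = {{v, a}, {a, b}, {b, v}}" "bd h = {{v, b}, {b, y}, {y, v}}"
proof -
  obtain x b' where x: "distinct [v, a, x, b']" "bd f = {{v, a}, {a, x}, {x, v}}" "bd g = {{v, a}, {a, b'}, {b', v}}"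
    by (rule two_triangles[OF F(1,2,4) s(1,2) b(1,2)])
  have "b' = b"
  proof -
    have "{v, b} \<in> {{v, a}, {a, b'}, {b', v}}" using b(3) x(3) by simp
    then show ?thesis using b(5) x(1) by (auto simp: doubleton_eq_iff)
  qed
  obtain y a' where y: "distinct [v, b, y, a']" "bd h = {{v, b}, {b, y}, {y, v}}" "bd g = {{v, b}, {b, a'}, {a', v}}"
    by (rule two_triangles[OF F(3,2) F(5)[symmetric] s(3,2) b(4,3)])
  have "a' = a"
  proof -
    have "{v, a} \<in> {{v, b}, {b, a'}, {a', v}}" using b(2) y(3) by simp
    then show ?thesis using b(5) y(1) by (auto simp: doubleton_eq_iff)
  qed
  have fh: "f \<noteq> h" using triangle_shares_one_edge[OF F(1,2,4) s(1), of v a b] b by auto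
  have "x \<noteq> y"
  proof
    assume "x = y"
    then show False
      using triangles_around_deg3[of g h f v a b x] F fh x y \<open>b' = b\<close> \<open>a' = a\<close> b(5)
      by (auto simp: insert_commute)
  qed
  then show thesis using that[of x y] fh x y \<open>b' = b\<close> \<open>a' = a\<close> by auto
qed

text \<open>The cyclic order at \<open>v\<close> is \<open>b, a, c, d\<close>: the face beyond
  \<open>{v, b}\<close> cannot return to \<open>{v, a}\<close>, which already has two faces, nor to
  \<open>{v, c}\<close>, which would close the cycle after three faces.\<close>

lemma deg4_fan:
  assumes F: "f \<in> F" "g \<in> F" "f \<noteq> g" and b: "{v, a} \<in> bd f" "{v, a} \<in> bd g" "{v, b} \<in> bd f" "{v, c} \<in> bd g"
    and n: "b \<noteq> a" "c \<noteq> a" "b \<noteq> c" and d4: "deg v = 4"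
  obtains d h k where "star v = {{v, a}, {v, b}, {v, c}, {v, d}}" "distinct [a, b, c, d]" "h \<in> F" "k \<in> F" "h \<noteq> k"
    "h \<noteq> f" "h \<noteq> g" "k \<noteq> f" "k \<noteq> g" "{v, b} \<in> bd h" "{v, d} \<in> bd h" "{v, c} \<in> bd k" "{v, d} \<in> bd k"
proof -
  have st: "{v, a} \<in> star v" "{v, b} \<in> star v" "{v, c} \<in> star v" using in_star bdE F b by auto
  have c3: "card {{v, a}, {v, b}, {v, c}} = 3" using n by (auto simp: doubleton_eq_iff)
  have "card (star v - {{v, a}, {v, b}, {v, c}}) = 1"
    using st d4 c3 by (subst card_Diff_subset) auto
  then obtain e where e: "star v - {{v, a}, {v, b}, {v, c}} = {e}" by (auto simp: card_1_singleton_iff)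
  then have "e \<in> star v" by blast
  then obtain d where d: "e = {v, d}" by (rule star_obtain) auto
  have star: "star v = {{v, a}, {v, b}, {v, c}, {v, d}}" using e d st by blast
  have dn: "d \<noteq> a" "d \<noteq> b" "d \<noteq> c" using e d by auto
  have fa: "x \<in> {{v, a}, {v, b}}" if "x \<in> bd f" "v \<in> x" for x using bd_third[OF F(1) b(1,3) _ that] n by auto
  have ga: "x \<in> {{v, a}, {v, c}}" if "x \<in> bd g" "v \<in> x" for x using bd_third[OF F(2) b(2,4) _ that] n by auto
  have fc: "{v, c} \<notin> bd f" using fa[of "{v, c}"] n by (auto simp: doubleton_eq_iff)
  have gb: "{v, b} \<notin> bd g" using ga[of "{v, b}"] n by (auto simp: doubleton_eq_iff)
  have nclosed: "\<not> ({v, b} \<in> bd h \<and> {v, c} \<in> bd h)" if "h \<in> F" "h \<noteq> f" "h \<noteq> g" for h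
  proof
    assume "{v, b} \<in> bd h \<and> {v, c} \<in> bd h"
    then have "deg v = 3"
      using three_faces_closed(2)[of f h g v a b c] F b n that by auto
    then show False using d4 by simp
  qed
  have face: "\<exists>h\<in>F. h \<noteq> f \<and> h \<noteq> g \<and> {v, z} \<in> bd h \<and> {v, d} \<in> bd h" if z: "z = b \<or> z = c" for z
  proof -
    obtain h where h: "h \<in> F" "{v, z} \<in> bd h" "h \<noteq> f" "h \<noteq> g"
      using z other_face[OF F(1) b(3)] other_face[OF F(2) b(4)] fc gb by metis
    obtain y where y: "y \<noteq> z" "{v, y} \<in> bd h" using bd_at[OF h(1,2)] by metis
    have "y \<noteq> a" using faces_of_D[OF b(1,2) F h(1)] h(3,4) y(2) by auto
    moreover have "{v, y} \<in> star v" using in_star bdE h(1) y(2) by blast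
    ultimately have "y = b \<or> y = c \<or> y = d" unfolding star by (auto simp: doubleton_eq_iff)
    then have "y = d" using nclosed[OF h(1,3,4)] h(2) y z by auto
    then show ?thesis using h y by auto
  qed
  obtain h where h: "h \<in> F" "h \<noteq> f" "h \<noteq> g" "{v, b} \<in> bd h" "{v, d} \<in> bd h" using face[of b] by auto
  obtain k where k: "k \<in> F" "k \<noteq> f" "k \<noteq> g" "{v, c} \<in> bd k" "{v, d} \<in> bd k" using face[of c] by auto
  have "h \<noteq> k" using nclosed[OF h(1-3)] h(4) k(4) by auto
  then show thesis using that[of d h k] star dn n h k by auto
qed

lemma triangle_quad_circuit5:
  assumes F: "f \<in> F" "g \<in> F" "sz f = 3" "sz g = 4" "e \<in> bd f" "e \<in> bd g"
  shows "has_circuit V E 5"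
proof -
  obtain a b where e: "e = {a, b}" using edge[OF bdE[OF F(1,5)]] by (metis card_2_iff)
  obtain c where c: "c \<noteq> a" "c \<noteq> b" "a \<noteq> b" "bd f = {{a, b}, {b, c}, {c, a}}" using face3[OF F(1,3)] F(5) e by metis
  obtain x y where q: "distinct [a, b, x, y]" "bd g = {{a, b}, {b, x}, {x, y}, {y, a}}" using face4[OF F(2,4)] F(6) e by metis
  have fg: "f \<noteq> g" using F(3,4) by auto
  have "c \<noteq> x" using triangle_shares_one_edge[OF F(1,2) fg F(3), of b a c] c q by (auto simp: insert_commute)
  moreover have "c \<noteq> y" using triangle_shares_one_edge[OF F(1,2) fg F(3), of a b c] c q by (auto simp: insert_commute)
  ultimately show ?thesis
    using circuit5I[of a c b x y] c q bd_subset[OF F(1)] bd_subset[OF F(2)] by (auto simp: insert_commute)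
qed

definition TT :: "'a set \<Rightarrow> bool" where
  "TT e \<longleftrightarrow> e \<in> E \<and> (\<forall>f\<in>F. e \<in> bd f \<longrightarrow> sz f = 3)"

lemma TT_faces:
  assumes "TT {v, a}"
  obtains f g b c where "f \<in> F" "g \<in> F" "f \<noteq> g" "sz f = 3" "sz g = 3" "distinct [v, a, b, c]"
    "bd f = {{v, a}, {a, b}, {b, v}}" "bd g = {{v, a}, {a, c}, {c, v}}" "{h \<in> F. {v, a} \<in> bd h} = {f, g}"
proof -
  have "{v, a} \<in> E" using assms by (simp add: TT_def)
  then obtain f g where fg: "f \<in> F" "g \<in> F" "f \<noteq> g" "{v, a} \<in> bd f" "{v, a} \<in> bd g" "{h \<in> F. {v, a} \<in> bd h} = {f, g}"
    by (rule edge_faces)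
  have s: "sz f = 3" "sz g = 3" using assms fg by (auto simp: TT_def)
  obtain b c where "distinct [v, a, b, c]" "bd f = {{v, a}, {a, b}, {b, v}}" "bd g = {{v, a}, {a, c}, {c, v}}"
    by (rule two_triangles[OF fg(1-3) s fg(4,5)])
  then show thesis by (rule that[OF fg(1-3) s _ _ _ fg(6)])
qed

text \<open>The initial charges will be \<open>2 * deg v - 6\<close> and \<open>sz f - 6\<close>, so
  a triangle lacks 3 and a 4-face lacks 2; spread over the boundary this is 1 and 1/2 per edge. From
  length six on nothing is lacking, and length five does not occur without 5-circuits.\<close>

definition wt5 :: "'f \<Rightarrow> real" where
  "wt5 f = (if sz f = 3 then 1 else if sz f = 4 then 1 / 2 else 0)"

definition dem5 :: "'a set \<Rightarrow> real" where "dem5 e = (\<Sum>f | f \<in> F \<and> e \<in> bd f. wt5 f)"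

lemma dem5_le2: "e \<in> E \<Longrightarrow> dem5 e \<le> 2"
  by (erule edge_faces) (simp add: dem5_def wt5_def)

text \<open>A triangle bordering a 4-face would give a 5-circuit, so away from \<open>TT\<close>
  edges the worst demands are 1 + 0 and 1/2 + 1/2.\<close>

lemma dem5_le1:
  assumes N: "\<not> has_circuit V E 5" and "e \<in> E" "\<not> TT e"
  shows "dem5 e \<le> 1"
proof -
  obtain f g where fg: "f \<in> F" "g \<in> F" "f \<noteq> g" "e \<in> bd f" "e \<in> bd g" "{h \<in> F. e \<in> bd h} = {f, g}"
    by (rule edge_faces[OF assms(2)])
  have "\<not> (sz f = 3 \<and> sz g = 3)" using fg assms(2,3) faces_of_D[of e f g] unfolding TT_def by metis
  moreover have "\<not> (sz f = 3 \<and> sz g = 4)" "\<not> (sz f = 4 \<and> sz g = 3)"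
    using triangle_quad_circuit5 N fg by blast+
  ultimately show ?thesis using fg by (auto simp: dem5_def wt5_def)
qed

text \<open>Each end pays half the demand of an edge, so the bound is twice the charge of
  \<open>v\<close>. Without \<open>TT\<close> edges the total is at most the degree. Next to a
  \<open>TT\<close> edge both neighbouring edges at \<open>v\<close> are not \<open>TT\<close>, as
  three consecutive triangles are excluded, so these three edges demand at most 2 + 1 + 1.\<close>

lemma dem5_vertex:
  assumes N: "\<not> has_circuit V E 5" and v: "4 \<le> deg v"
  shows "(\<Sum>e\<in>star v. dem5 e) \<le> 4 * real (deg v) - 12"
proof (cases "\<exists>e\<in>star v. TT e")
  case False
  then have "(\<Sum>e\<in>star v. dem5 e) \<le> (\<Sum>e\<in>star v. 1)"
    by (intro sum_mono dem5_le1[OF N]) (auto simp: star_def)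
  then show ?thesis using v by simp
next
  case True
  then obtain a where a: "{v, a} \<in> star v" "TT {v, a}" using star_obtain by metis
  obtain f g b c where f: "f \<in> F" "g \<in> F" "f \<noteq> g" "sz f = 3" "sz g = 3" "distinct [v, a, b, c]"
    "bd f = {{v, a}, {a, b}, {b, v}}" "bd g = {{v, a}, {a, c}, {c, v}}" by (rule TT_faces[OF a(2)])
  have nTT: False if t: "TT {v, z}" "{v, z} \<in> bd k" and k: "k \<in> F" "sz k = 3" "k' \<in> F" "sz k' = 3" "k' \<noteq> k"
      "{v, a} \<in> bd k'" "{v, a} \<in> bd k" "a \<noteq> z" for z k k'
  proof -
    obtain h where h: "h \<in> F" "h \<noteq> k" "{v, z} \<in> bd h" using other_face[OF k(1) t(2)] by metis
    have s: "sz h = 3" using t(1) h by (simp add: TT_def)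
    obtain x y where x: "distinct [v, x, a, z, y]" "bd k' = {{v, a}, {a, x}, {x, v}}"
      "bd k = {{v, a}, {a, z}, {z, v}}" "bd h = {{v, z}, {z, y}, {y, v}}"
      by (rule three_triangles[OF k(3,1) h(1) k(5) h(2)[symmetric] k(4,2) s k(6,7) t(2) h(3) k(8)])
    then show False
      using circuit5I[of v x a z y] N bd_subset[OF h(1)] bd_subset[OF k(1)] bd_subset[OF k(3)]
      by (auto simp: insert_commute)
  qed
  have "\<not> TT {v, b}" using nTT[of b f g] f by (auto simp: insert_commute)
  moreover have "\<not> TT {v, c}" using nTT[of c g f] f by (auto simp: insert_commute)
  moreover have bc: "{v, b} \<in> E" "{v, c} \<in> E" using bd_subset[OF f(1)] bd_subset[OF f(2)] f by (auto simp: insert_commute)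
  ultimately have d1: "dem5 {v, b} \<le> 1" "dem5 {v, c} \<le> 1" using dem5_le1[OF N] by auto
  have aE: "{v, a} \<in> E" using a(1) by (simp add: star_def)
  have dis: "{v, a} \<noteq> {v, b}" "{v, a} \<noteq> {v, c}" "{v, b} \<noteq> {v, c}" using f(6) by (auto simp: doubleton_eq_iff)
  have sum3: "(\<Sum>e\<in>{{v, a}, {v, b}, {v, c}}. dem5 e) \<le> 4"
    using d1 dem5_le2[OF aE] dis by simp
  have sub: "{{v, a}, {v, b}, {v, c}} \<subseteq> star v" using aE bc by (auto simp: star_def)
  define D where "D = star v - {{v, a}, {v, b}, {v, c}}"
  have "(\<Sum>e\<in>star v. dem5 e) = (\<Sum>e\<in>D. dem5 e) + (\<Sum>e\<in>{{v, a}, {v, b}, {v, c}}. dem5 e)"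
    unfolding D_def by (rule sum.subset_diff[OF sub]) simp
  then have split: "(\<Sum>e\<in>star v. dem5 e) \<le> (\<Sum>e\<in>D. dem5 e) + 4" using sum3 by simp
  have cd: "card D = deg v - 3"
    unfolding D_def using sub dis by (subst card_Diff_subset) auto
  show ?thesis
  proof (cases "deg v = 4")
    \<comment> \<open>\<open>4 + 2 * (deg v - 3)\<close> is at most \<open>4 * deg v - 12\<close>
      from degree five on.\<close>
    case False
    have "(\<Sum>e\<in>D. dem5 e) \<le> (\<Sum>e\<in>D. 2)"
      by (intro sum_mono dem5_le2) (auto simp: star_def D_def)
    also have "\<dots> = 2 * real (deg v) - 6" using cd v by (simp add: of_nat_diff)
    finally show ?thesis using split v False by linarith
  next
    case True
    have vf: "{v, a} \<in> bd f" "{v, a} \<in> bd g" "{v, b} \<in> bd f" "{v, c} \<in> bd g" using f by (auto simp: insert_commute)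
    have n: "b \<noteq> a" "c \<noteq> a" "b \<noteq> c" using f(6) by auto
    obtain d h k where d: "star v = {{v, a}, {v, b}, {v, c}, {v, d}}" "distinct [a, b, c, d]" "h \<in> F" "k \<in> F" "h \<noteq> k"
      "h \<noteq> f" "h \<noteq> g" "k \<noteq> f" "k \<noteq> g" "{v, b} \<in> bd h" "{v, d} \<in> bd h" "{v, c} \<in> bd k" "{v, d} \<in> bd k"
      using deg4_fan[OF f(1-3) vf n True] .
    \<comment> \<open>Degree four is tight, so the last edge must demand nothing. Its two faces
      border the triangles \<open>f\<close> and \<open>g\<close> along edges that are not
      \<open>TT\<close>; hence they are not triangles, and next to a triangle there is no
      4-face.\<close>
    have "wt5 h = 0"
    proof -
      have "sz h \<noteq> 3" using \<open>\<not> TT {v, b}\<close> faces_of_D[of "{v, b}" f h] d vf f bc unfolding TT_def by metis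
      moreover have "sz h \<noteq> 4" using triangle_quad_circuit5[OF f(1) d(3) f(4) _ vf(3) d(10)] N by blast
      ultimately show ?thesis by (simp add: wt5_def)
    qed
    moreover have "wt5 k = 0"
    proof -
      have "sz k \<noteq> 3" using \<open>\<not> TT {v, c}\<close> faces_of_D[of "{v, c}" g k] d vf f bc unfolding TT_def by metis
      moreover have "sz k \<noteq> 4" using triangle_quad_circuit5[OF f(2) d(4) f(5) _ vf(4) d(12)] N by blast
      ultimately show ?thesis by (simp add: wt5_def)
    qed
    ultimately have "dem5 {v, d} = 0" using faces_of[OF d(11,13,3,4,5)] d(5) by (simp add: dem5_def)
    moreover have "D = {{v, d}}" unfolding D_def using d(1,2) by (auto simp: doubleton_eq_iff)
    ultimately show ?thesis using split True by simp
  qed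
qed

lemma circuit5: "has_circuit V E 5"
proof (rule ccontr)
  assume N: "\<not> has_circuit V E 5"
  have fin: "finite e" if "e \<in> E" for e using edge[OF that] finV by (meson finite_subset)
  have vb: "2 * real (deg v) - 6 + (\<Sum>e\<in>star v. - (dem5 e / 2)) = (4 * real (deg v) - 12 - (\<Sum>e\<in>star v. dem5 e)) / 2" for v
    by (simp add: sum_negf sum_divide_distrib[symmetric] field_simps)
  have "real (card Z) \<le> 3" using Z3 by simp
  then show False
  \<comment> \<open>A vertex of \<open>Z\<close> may fall to -3 because
    \<open>3 * 3 < 2 * 6\<close>; at degrees two and three the estimates just suffice.\<close>
  proof (intro discharging[of 6 2 1 "\<lambda>f e. - wt5 f" "\<lambda>_ _. 0" "\<lambda>e v. - (dem5 e / 2)" 3])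
    fix f assume f: "f \<in> F"
    have "sz f \<noteq> 5" "3 \<le> sz f" using sz_neq[OF N f] sz_ge_3[OF f] by auto
    then have "0 \<le> 1 * real (sz f) - 6 + real (sz f) * wt5 f"
      by (cases "sz f = 3"; cases "sz f = 4") (auto simp: wt5_def)
    then show "0 \<le> 1 * real (sz f) - 6 - (\<Sum>e\<in>bd f. - wt5 f) + (\<Sum>v | v \<in> V \<and> v \<in> \<Union>(bd f). 0)" by simp
  next
    fix e assume "e \<in> E"
    then show "0 \<le> (\<Sum>f | f \<in> F \<and> e \<in> bd f. - wt5 f) - (\<Sum>v\<in>e. - (dem5 e / 2))"
      using edge by (simp add: dem5_def sum_negf)
  next
    fix v assume "v \<in> V - Z"
    then have "4 \<le> deg v" using deg4 by (simp add: star_def)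
    then show "0 \<le> 2 * real (deg v) - 6 + (\<Sum>e\<in>star v. - (dem5 e / 2)) - (\<Sum>f | f \<in> F \<and> v \<in> \<Union>(bd f). 0)"
      unfolding vb using dem5_vertex[OF N] by simp
  next
    fix v assume "v \<in> Z"
    then have d2: "2 \<le> deg v" using deg2[of v] ZV by (auto simp: star_def)
    have "(\<Sum>e\<in>star v. dem5 e) \<le> 4 * real (deg v) - 6"
    proof -
      consider "deg v = 2" | "deg v = 3" | "4 \<le> deg v" using d2 by linarith
      then show ?thesis
      proof cases
        case 1
        have "dem5 e \<le> 1" if st: "e \<in> star v" for e
        proof (rule dem5_le1[OF N])
          show "e \<in> E" using st by (simp add: star_def)
          show "\<not> TT e"
          proof
            assume t: "TT e"
            obtain a where a: "e = {v, a}" using st by (rule star_obtain) auto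
            obtain f b where "f \<in> F" "bd f = {{v, a}, {a, b}, {b, v}}" using TT_faces t a by metis
            then show False using triangle_deg_face[of f v a b] 1 by simp
          qed
        qed
        then have "(\<Sum>e\<in>star v. dem5 e) \<le> (\<Sum>e\<in>star v. 1)" by (intro sum_mono)
        then show ?thesis using 1 by simp
      next
        case 2
        have "(\<Sum>e\<in>star v. dem5 e) \<le> (\<Sum>e\<in>star v. 2)" by (intro sum_mono dem5_le2) (auto simp: star_def)
        then show ?thesis using 2 by simp
      next
        case 3
        then show ?thesis using dem5_vertex[OF N 3] by simp
      qed
    qed
    then show "- 3 \<le> 2 * real (deg v) - 6 + (\<Sum>e\<in>star v. - (dem5 e / 2)) - (\<Sum>f | f \<in> F \<and> v \<in> \<Union>(bd f). 0)"
      unfolding vb by simp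
  qed auto
qed

subsection \<open>Circuits of length four\<close>

text \<open>The vertices of initial charge zero whose degree is that in the whole graph; only these
  may take part in a reducible configuration.\<close>

definition small :: "'a \<Rightarrow> bool" where "small v \<longleftrightarrow> v \<in> V - Z \<and> deg v = 4"

definition opp :: "'f \<Rightarrow> 'a set \<Rightarrow> 'f" where "opp f e = (SOME g. g \<in> F \<and> g \<noteq> f \<and> e \<in> bd g)"

lemma opp: "f \<in> F \<Longrightarrow> e \<in> bd f \<Longrightarrow> opp f e \<in> F \<and> opp f e \<noteq> f \<and> e \<in> bd (opp f e)"
  unfolding opp_def by (rule someI_ex) (metis other_face)

lemma oppI: "f \<in> F \<Longrightarrow> e \<in> bd f \<Longrightarrow> g \<in> F \<Longrightarrow> g \<noteq> f \<Longrightarrow> e \<in> bd g \<Longrightarrow> opp f e = g"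
  using opp[of f e] faces_of_D[of e f g "opp f e"] by auto

definition tedge :: "'a set \<Rightarrow> bool" where "tedge e \<longleftrightarrow> (\<exists>f\<in>F. e \<in> bd f \<and> sz f = 3)"

definition tcount :: "'f \<Rightarrow> nat" where "tcount f = card {e \<in> bd f. tedge e}"

text \<open>Every adjacent triangle should get 1/3, and a 5-face has charge 1: enough for three
  triangles, but not for four.\<close>

definition deficient :: "'f \<Rightarrow> bool" where "deficient f \<longleftrightarrow> f \<in> F \<and> sz f = 5 \<and> 4 \<le> tcount f"

definition lone :: "'f \<Rightarrow> 'a \<Rightarrow> bool" where "lone f v \<longleftrightarrow> (\<forall>u\<in>\<Union>(bd f). u \<noteq> v \<longrightarrow> small u)"

text \<open>The amount that \<open>v\<close> sends to the deficient 5-face \<open>f\<close> over each edge at \<open>v\<close> that \<open>f\<close> shares with a triangle.\<close>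

definition aid :: "'a \<Rightarrow> 'f \<Rightarrow> real" where
  "aid v f = (if small v \<or> \<not> deficient f then 0
     else if lone f v \<and> (tcount f = 5 \<or> card {e \<in> bd f. v \<in> e \<and> tedge e} = 1) then 1 / 3 else 1 / 6)"

text \<open>The amount that a deficient 5-face all of whose vertices are small gets from the apex of each adjacent triangle.\<close>

definition apex_aid :: "'f \<Rightarrow> real" where
  "apex_aid f = (if deficient f \<and> (\<forall>u\<in>\<Union>(bd f). small u) then 2 / 15 else 0)"

definition house :: bool where
  "house \<longleftrightarrow> (\<exists>a b x y z c. distinct [a, b, x, y, z, c] \<and> (\<forall>u\<in>{a, b, x, y, z, c}. small u) \<and>
     {{a, b}, {b, x}, {x, y}, {y, z}, {z, a}, {a, c}, {b, c}} \<subseteq> E)"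

lemma aid_bounds: "0 \<le> aid v f" "aid v f \<le> 1 / 3" by (simp_all add: aid_def)

lemma apex_aid_bounds: "0 \<le> apex_aid f" "apex_aid f \<le> 2 / 15" by (simp_all add: apex_aid_def)

text \<open>Aid for a 5-face is paid straight to the triangle across the edge, and the face pays
  correspondingly less, namely \<open>cost\<close>. Over each edge the triangle receives 1/3 in
  total: from the face, the two ends, and its opposite vertex.\<close>

definition send :: "'a \<Rightarrow> 'f \<Rightarrow> real" where
  "send v f = (\<Sum>e\<in>bd f. if v \<in> e then aid v (opp f e) else apex_aid (opp f e))"

definition cost :: "'a set \<Rightarrow> 'f \<Rightarrow> real" where
  "cost e f = 1 / 3 - (\<Sum>v\<in>e. aid v f) - apex_aid f"

lemma send_eq:
  assumes "distinct [v, a, b]" "bd f = {{v, a}, {a, b}, {b, v}}"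
  shows "send v f = aid v (opp f {v, a}) + aid v (opp f {v, b}) + apex_aid (opp f {a, b})"
proof -
  have d: "{v, a} \<notin> {{a, b}, {b, v}}" "{a, b} \<notin> {{b, v}}" using assms(1) by (auto simp: doubleton_eq_iff)
  have v: "v \<notin> {a, b}" using assms(1) by auto
  show ?thesis unfolding send_def assms(2) using d v by (simp add: insert_commute[of v b "{}"])
qed

text \<open>The apex must avoid the 5-face. At \<open>x\<close> or \<open>z\<close> the triangle
  would share two edges with it; \<open>c = y\<close> would give the 4-circuit
  \<open>a c x b\<close>.\<close>

lemma houseI:
  assumes N: "\<not> has_circuit V E 4"
    and Q: "Q \<in> F" "sz Q = 5" "\<forall>u\<in>\<Union>(bd Q). small u" "{a, b} \<in> bd Q"
    and T: "T \<in> F" "bd T = {{a, b}, {b, c}, {c, a}}" "distinct [a, b, c]" "small c"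
  shows house
proof -
  obtain x y z where q: "distinct [a, b, x, y, z]" "bd Q = {{a, b}, {b, x}, {x, y}, {y, z}, {z, a}}"
    using face5[OF Q(1,2,4)] by metis
  have s3: "sz T = 3" using T(2,3) by (auto simp: doubleton_eq_iff)
  then have n: "T \<noteq> Q" using Q(2) by auto
  have E: "bd T \<subseteq> E" "bd Q \<subseteq> E" using bd_subset T(1) Q(1) by auto
  have "c \<noteq> x" using triangle_shares_one_edge[OF T(1) Q(1) n s3, of b a c] T q by (auto simp: insert_commute)
  moreover have "c \<noteq> z" using triangle_shares_one_edge[OF T(1) Q(1) n s3, of a b c] T q by (auto simp: insert_commute)
  moreover have "c \<noteq> y"
  proof
    assume "c = y"
    then show False using circuit4I[of a c x b] N E T(2,3) q by (auto simp: insert_commute)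
  qed
  ultimately have "distinct [a, b, x, y, z, c]" using q(1) T(3) by auto
  moreover have "\<forall>u\<in>{a, b, x, y, z, c}. small u" using Q(3) T(4) q(2) by auto
  moreover have "{{a, b}, {b, x}, {x, y}, {y, z}, {z, a}, {a, c}, {b, c}} \<subseteq> E"
    using E T(2) q(2) by (auto simp: insert_commute)
  ultimately show house unfolding house_def by blast
qed

lemma no_adjacent_triangles:
  assumes N: "\<not> has_circuit V E 4" and T: "f \<in> F" "g \<in> F" "sz f = 3" "sz g = 3" "e \<in> bd f" "e \<in> bd g"
  shows "f = g"
proof (rule ccontr)
  assume n: "f \<noteq> g"
  obtain v a where e: "e = {v, a}" using edge[OF bdE[OF T(1,5)]] by (metis card_2_iff)
  obtain b c where "distinct [v, a, b, c]" "bd f = {{v, a}, {a, b}, {b, v}}" "bd g = {{v, a}, {a, c}, {c, v}}"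
    using two_triangles[OF T(1,2) n T(3,4)] T(5,6) unfolding e by metis
  then show False using circuit4I[of v b a c] N bd_subset[OF T(1)] bd_subset[OF T(2)] by (auto simp: insert_commute)
qed

lemma not_tedge:
  assumes "f \<in> F" "g \<in> F" "f \<noteq> g" "e \<in> bd f" "e \<in> bd g" "sz f \<noteq> 3" "sz g \<noteq> 3"
  shows "\<not> tedge e"
  unfolding tedge_def using faces_of_D[OF assms(4,5,1,2,3)] assms(6,7) by blast

lemma tedge_other:
  assumes "f \<in> F" "g \<in> F" "f \<noteq> g" "e \<in> bd f" "e \<in> bd g" "sz f \<noteq> 3" "tedge e"
  shows "sz g = 3"
  using not_tedge[OF assms(1-6)] assms(7) by blast

text \<open>A triangle at \<open>v\<close> whose opposite edge lies on a deficient 5-face without big vertices forces the other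
  two neighbouring faces to have a second big vertex or a free edge.\<close>

lemma aid_le_if_apex_aid:
  assumes N: "\<not> has_circuit V E 4" and H: "\<not> house"
    and T: "T \<in> F" "bd T = {{v, p}, {p, w}, {w, v}}" "distinct [v, p, w]"
    and Q: "Q \<in> F" "Q \<noteq> T" "{p, w} \<in> bd Q" "apex_aid Q \<noteq> 0" and P: "P \<in> F" "P \<noteq> T" "{v, p} \<in> bd P"
  shows "aid v P \<le> 1 / 6"
proof (rule ccontr)
  assume "\<not> aid v P \<le> 1 / 6"
  then have a: "\<not> small v" "deficient P" "lone P v" "tcount P = 5 \<or> card {e \<in> bd P. v \<in> e \<and> tedge e} = 1"
    by (auto simp: aid_def split: if_splits)
  have s3: "sz T = 3" using T(2,3) by (auto simp: doubleton_eq_iff)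
  have Qs: "deficient Q" "\<forall>u\<in>\<Union>(bd Q). small u" using Q(4) by (auto simp: apex_aid_def split: if_splits)
  have Q5: "sz Q = 5" and P5: "sz P = 5" using Qs a by (auto simp: deficient_def)
  have "small p" using Qs(2) Q(3) by blast
  then have d4: "deg p = 4" by (simp add: small_def)
  obtain c d' e where P': "distinct [v, p, c, d', e]" "bd P = {{v, p}, {p, c}, {c, d'}, {d', e}, {e, v}}"
    using face5[OF P(1) P5 P(3)] by metis
  have "c \<noteq> w" using triangle_shares_one_edge[OF T(1) P(1) P(2)[symmetric] s3, of p v w] T P' by (auto simp: insert_commute)
  then have n: "c \<noteq> v" "w \<noteq> v" "c \<noteq> w" using P'(1) T(3) by auto
  have b: "{p, v} \<in> bd P" "{p, v} \<in> bd T" "{p, c} \<in> bd P" "{p, w} \<in> bd T" using P' T by (auto simp: insert_commute)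
  obtain d h k where d: "star p = {{p, v}, {p, c}, {p, w}, {p, d}}" "distinct [v, c, w, d]" "h \<in> F" "k \<in> F" "h \<noteq> k"
      "h \<noteq> P" "h \<noteq> T" "k \<noteq> P" "k \<noteq> T" "{p, c} \<in> bd h" "{p, d} \<in> bd h" "{p, w} \<in> bd k" "{p, d} \<in> bd k"
    by (rule deg4_fan[OF P(1) T(1) P(2) b n d4])
  have kQ: "k = Q" using faces_of_D[OF b(4) Q(3) T(1) Q(1) Q(2)[symmetric] d(4,12)] d(9) by blast
  show False
  \<comment> \<open>If a triangle lies beyond \<open>{p, c}\<close>, it borders \<open>Q\<close>
    along \<open>{p, d}\<close>, and with the small apex \<open>c\<close> it makes a house.
    Otherwise the other four edges of \<open>P\<close> all border triangles; two of these edges are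
    at \<open>v\<close>, so the aid is only 1/6.\<close>
  proof (cases "sz h = 3")
    case True
    obtain z where z: "bd h = {{p, d}, {d, z}, {z, p}}" "z \<noteq> p" "z \<noteq> d" using face3[OF d(3) True d(11)] by metis
    have "{p, c} \<in> {{p, d}, {d, z}, {z, p}}" using d(10) z(1) by simp
    then have "z = c" using d(2) P'(1) z(2,3) by (auto simp: doubleton_eq_iff)
    then have h: "bd h = {{p, d}, {d, c}, {c, p}}" using z(1) by simp
    have hd: "distinct [p, d, c]" using z \<open>z = c\<close> edge_neq[of p d] bdE[OF d(3,11)] by simp
    have "c \<in> \<Union>(bd P)" using b(3) by blast
    then have "small c" using a(3) n(1) unfolding lone_def by blast
    then show False using houseI[OF N Q(1) Q5 Qs(2) _ d(3) h hd] d(13) kQ H by blast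
  next
    case False
    then have nt: "\<not> tedge {p, c}" using not_tedge[OF P(1) d(3) d(6)[symmetric] b(3) d(10)] P5 by simp
    let ?R = "{{v, p}, {c, d'}, {d', e}, {e, v}}"
    have sub: "{x \<in> bd P. tedge x} \<subseteq> ?R" using nt P'(2) by auto
    have c4: "card ?R = 4" using P'(1) by (auto simp: doubleton_eq_iff)
    have "4 \<le> tcount P" using a(2) by (simp add: deficient_def)
    then have eq: "{x \<in> bd P. tedge x} = ?R"
      using card_seteq[of ?R "{x \<in> bd P. tedge x}"] sub c4 by (simp add: tcount_def)
    then have "tcount P = 4" using c4 by (simp add: tcount_def)
    moreover have "card {x \<in> bd P. v \<in> x \<and> tedge x} = 2"
    proof -
      have "{x \<in> bd P. v \<in> x \<and> tedge x} = {x \<in> ?R. v \<in> x}" using eq by blast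
      also have "\<dots> = {{v, p}, {e, v}}" using P'(1) by auto
      finally show ?thesis using P'(1) by (auto simp: doubleton_eq_iff)
    qed
    ultimately show False using a(4) by simp
  qed
qed

text \<open>Two aids of at most 1/3 make 2/3. A nonzero apex aid lowers both aids to 1/6, and 1/6 +
  1/6 + 2/15 is smaller still.\<close>

lemma send_le:
  assumes N: "\<not> has_circuit V E 4" and H: "\<not> house" and T: "T \<in> F" "sz T = 3" "v \<in> \<Union>(bd T)"
  shows "send v T \<le> 2 / 3"
proof -
  obtain a where "{v, a} \<in> bd T" using T(3) bdE[OF T(1)] edge card2_joins by (metis UnionE card_2_iff insert_iff doubleton_eq_iff singletonD)
  then obtain b where b: "distinct [v, a, b]" "bd T = {{v, a}, {a, b}, {b, v}}" using face3[OF T(1,2)] by (metis distinct_length_2_or_more distinct_singleton)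
  have o: "opp T {v, a} \<in> F" "opp T {v, a} \<noteq> T" "{v, a} \<in> bd (opp T {v, a})"
    "opp T {v, b} \<in> F" "opp T {v, b} \<noteq> T" "{v, b} \<in> bd (opp T {v, b})"
    "opp T {a, b} \<in> F" "opp T {a, b} \<noteq> T" "{a, b} \<in> bd (opp T {a, b})"
    using opp[OF T(1)] b(2) by (auto simp: insert_commute)
  show ?thesis
  proof (cases "apex_aid (opp T {a, b}) = 0")
    case True
    then show ?thesis using send_eq[OF b] aid_bounds(2)[of v "opp T {v, a}"] aid_bounds(2)[of v "opp T {v, b}"] by simp
  next
    case False
    have b': "bd T = {{v, b}, {b, a}, {a, v}}" "distinct [v, b, a]" using b by (auto simp: insert_commute)
    have "aid v (opp T {v, a}) \<le> 1 / 6" using aid_le_if_apex_aid[OF N H T(1) b(2,1) o(7,8,9) False o(1,2,3)] .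
    moreover have "aid v (opp T {v, b}) \<le> 1 / 6"
      using aid_le_if_apex_aid[OF N H T(1) b' o(7,8) _ False o(4,5,6)] o(9) by (simp add: insert_commute)
    ultimately show ?thesis using send_eq[OF b] apex_aid_bounds(2)[of "opp T {a, b}"] by simp
  qed
qed

text \<open>An aid above 1/6 makes \<open>x\<close> small. As \<open>{v, x}\<close> borders no
  triangle, the deficient face \<open>f\<close> has a triangle beyond its other edge at
  \<open>x\<close>. At degree four this triangle is adjacent to the face beyond the other edge of
  \<open>g\<close> at \<open>x\<close>, which is then no triangle. So two edges of \<open>g\<close>
  border no triangle, and \<open>g\<close> is not deficient.\<close>

lemma aid_pair:
  assumes N: "\<not> has_circuit V E 4" and f: "f \<in> F" "g \<in> F" "f \<noteq> g" "sz f \<noteq> 3" "sz g \<noteq> 3" "{v, x} \<in> bd f" "{v, x} \<in> bd g"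
    and a: "1 / 6 < aid v f"
  shows "aid v g = 0"
proof -
  have af: "deficient f" "lone f v" using a by (auto simp: aid_def split: if_splits)
  have xv: "x \<noteq> v" using edge_neq bdE f by metis
  have xf: "x \<in> \<Union>(bd f)" using f(6) by blast
  then have "small x" using af(2) xv unfolding lone_def by blast
  then have d4: "deg x = 4" by (simp add: small_def)
  have vx: "{x, v} \<in> bd f" "{x, v} \<in> bd g" using f(6,7) by (auto simp: insert_commute)
  obtain y where y: "y \<noteq> v" "{x, y} \<in> bd f" using bd_at[OF f(1) vx(1)] by metis
  obtain y' where y': "y' \<noteq> v" "{x, y'} \<in> bd g" using bd_at[OF f(2) vx(2)] by metis
  have "y \<noteq> y'"
  proof
    assume "y = y'"
    then have "deg x = 2" using two_faces_closed(2)[OF f(1-3) vx(1) y(2) vx(2)] y'(2) y(1) by auto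
    then show False using d4 by simp
  qed
  then obtain d h k where d: "star x = {{x, v}, {x, y}, {x, y'}, {x, d}}" "distinct [v, y, y', d]" "h \<in> F" "k \<in> F" "h \<noteq> k"
      "h \<noteq> f" "h \<noteq> g" "k \<noteq> f" "k \<noteq> g" "{x, y} \<in> bd h" "{x, d} \<in> bd h" "{x, y'} \<in> bd k" "{x, d} \<in> bd k"
    using deg4_fan[OF f(1-3) vx y(2) y'(2) y(1) y'(1) _ d4] by metis
  have nvx: "\<not> tedge {x, v}" by (rule not_tedge[OF f(1-3) vx f(4,5)])
  have "tedge {x, y}"
  proof (rule ccontr)
    assume "\<not> tedge {x, y}"
    then have "{e \<in> bd f. tedge e} \<subseteq> bd f - {{x, v}, {x, y}}" using nvx by auto
    then have "tcount f \<le> card (bd f - {{x, v}, {x, y}})" unfolding tcount_def using fin_bd[OF f(1)] by (intro card_mono) auto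
    also have "\<dots> = sz f - 2" using vx y fin_bd[OF f(1)] by (subst card_Diff_subset) (auto simp: doubleton_eq_iff)
    finally show False using af(1) by (simp add: deficient_def)
  qed
  then have "sz h = 3" using tedge_other[OF f(1) d(3) d(6)[symmetric] y(2) d(10) f(4)] by simp
  then have "sz k \<noteq> 3" using no_adjacent_triangles[OF N d(3,4) _ _ d(11,13)] d(5) by auto
  then have nt: "\<not> tedge {x, y'}" using not_tedge[OF f(2) d(4) d(9)[symmetric] y'(2) d(12) f(5)] by simp
  have "{e \<in> bd g. tedge e} \<subseteq> bd g - {{x, v}, {x, y'}}" using nvx nt by auto
  then have "tcount g \<le> card (bd g - {{x, v}, {x, y'}})" unfolding tcount_def using fin_bd[OF f(2)] by (intro card_mono) auto
  also have "\<dots> = sz g - 2" using vx y' fin_bd[OF f(2)] by (subst card_Diff_subset) (auto simp: doubleton_eq_iff)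
  finally have "\<not> deficient g" by (auto simp: deficient_def)
  then show ?thesis by (simp add: aid_def)
qed

section \<open>Triangles around a vertex and the total the vertex sends\<close>

definition triangle_at :: "'a \<Rightarrow> 'a \<Rightarrow> 'a \<Rightarrow> 'f \<Rightarrow> bool" where
  "triangle_at v a b f \<longleftrightarrow> f \<in> F \<and> distinct [v, a, b] \<and> bd f = {{v, a}, {a, b}, {b, v}}"

lemma triangle_at_commute: "triangle_at v a b f \<Longrightarrow> triangle_at v b a f"
  by (auto simp: triangle_at_def insert_commute)

lemma triangle_atD:
  assumes "triangle_at v a b f"
  shows "f \<in> F" "distinct [v, a, b]" "bd f = {{v, a}, {a, b}, {b, v}}" "sz f = 3"
    "{v, a} \<in> bd f" "{v, b} \<in> bd f" "{a, b} \<in> bd f"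
proof -
  show 1: "f \<in> F" "distinct [v, a, b]" "bd f = {{v, a}, {a, b}, {b, v}}" using assms by (auto simp: triangle_at_def)
  show "sz f = 3" using 1(2,3) by (auto simp: doubleton_eq_iff)
  show "{v, a} \<in> bd f" "{v, b} \<in> bd f" "{a, b} \<in> bd f" using 1(3) by (auto simp: insert_commute)
qed

lemma triangle_atI:
  assumes "f \<in> F" "sz f = 3" "v \<in> \<Union>(bd f)"
  obtains a b where "triangle_at v a b f"
proof -
  obtain e where e: "e \<in> bd f" "v \<in> e" using assms(3) by blast
  then have "e \<in> star v" using bdE[OF assms(1)] by (simp add: star_def)
  then obtain a where "e = {v, a}" "a \<noteq> v" by (rule star_obtain)
  then obtain b where "b \<noteq> v" "b \<noteq> a" "bd f = {{v, a}, {a, b}, {b, v}}" using face3[OF assms(1,2)] e(1) by metis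
  then show thesis using that[of a b] assms(1) \<open>a \<noteq> v\<close> by (auto simp: triangle_at_def)
qed

lemma triangle_at_choose: "triangle_at v a b f \<Longrightarrow> y = a \<or> y = b \<Longrightarrow> \<exists>z. triangle_at v y z f"
  using triangle_at_commute by metis

definition triangles_at :: "'a \<Rightarrow> 'f set" where "triangles_at v = {f \<in> F. sz f = 3 \<and> v \<in> \<Union>(bd f)}"

lemma fin_triangles_at [simp]: "finite (triangles_at v)" using finF by (simp add: triangles_at_def)

lemma bd_at_card: "f \<in> F \<Longrightarrow> v \<in> \<Union>(bd f) \<Longrightarrow> card {e \<in> bd f. v \<in> e} = 2"
proof -
  assume f: "f \<in> F" "v \<in> \<Union>(bd f)"
  have "is_circuit (bd f)" using cycF f(1) by simp
  then obtain a b where "{e \<in> bd f. v \<in> e} = {{v, a}, {v, b}}" "a \<noteq> b" using is_circuit_edges_at[OF _ f(2)] by metis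
  then show ?thesis by (simp add: doubleton_eq_iff)
qed

lemma triangles_at_card:
  assumes N: "\<not> has_circuit V E 4"
  shows "2 * card (triangles_at v) \<le> deg v"
proof -
  have "card (\<Union>f\<in>triangles_at v. {e \<in> bd f. v \<in> e}) = (\<Sum>f\<in>triangles_at v. card {e \<in> bd f. v \<in> e})"
  proof (rule card_UN_disjoint)
    show "\<forall>f\<in>triangles_at v. finite {e \<in> bd f. v \<in> e}" using fin_bd by (auto simp: triangles_at_def)
    show "\<forall>f\<in>triangles_at v. \<forall>g\<in>triangles_at v. f \<noteq> g \<longrightarrow> {e \<in> bd f. v \<in> e} \<inter> {e \<in> bd g. v \<in> e} = {}"
      using no_adjacent_triangles[OF N] unfolding triangles_at_def by blast
  qed simp
  also have "\<dots> = (\<Sum>f\<in>triangles_at v. 2)" by (intro sum.cong) (auto simp: triangles_at_def intro!: bd_at_card)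
  also have "\<dots> = 2 * card (triangles_at v)" by simp
  finally have "2 * card (triangles_at v) = card (\<Union>f\<in>triangles_at v. {e \<in> bd f. v \<in> e})" ..
  also have "\<dots> \<le> deg v" by (rule card_mono[OF fin_star]) (auto simp: triangles_at_def star_def dest: bdE)
  finally show ?thesis .
qed

text \<open>The faces around \<open>v\<close> are \<open>T1\<close>, \<open>P\<close>,
  \<open>T2\<close>, \<open>g\<close>, \<open>f\<close> in this order. By \<open>aid_pair\<close>,
  \<open>f\<close> and \<open>g\<close> together get at most 1/3. \<open>P\<close> borders both
  triangles and counts twice, with 1/3 each time, or with 1/6 as soon as an apex aid of 2/15 is due;
  both ways the sum is at most 1.\<close>

lemma send_pair_aux:
  assumes N: "\<not> has_circuit V E 4" and H: "\<not> house"
    and T1: "triangle_at v a b T1" and T2: "triangle_at v d c T2" and n: "T1 \<noteq> T2"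
    and f: "f \<in> F" "g \<in> F" "f \<noteq> g" "{v, a} \<in> bd f" "{v, x} \<in> bd f" "{v, d} \<in> bd g" "{v, x} \<in> bd g"
    and s: "star v = {{v, a}, {v, b}, {v, c}, {v, d}, {v, x}}" "distinct [a, b, c, d, x]"
  shows "send v T1 + send v T2 \<le> 1"
proof -
  note t1 = triangle_atD[OF T1] and t2 = triangle_atD[OF T2]
  have x1: "{v, x} \<notin> bd T1" using t1(3) s(2) t1(2) by (auto simp: doubleton_eq_iff)
  have x2: "{v, x} \<notin> bd T2" using t2(3) s(2) t2(2) by (auto simp: doubleton_eq_iff)
  have fT: "f \<noteq> T1" "g \<noteq> T2" "f \<noteq> T2" "g \<noteq> T1" using x1 x2 f by auto
  have s3: "sz f \<noteq> 3" "sz g \<noteq> 3"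
    using no_adjacent_triangles[OF N t1(1) f(1) t1(4) _ t1(5) f(4)] no_adjacent_triangles[OF N t2(1) f(2) t2(4) _ t2(5) f(6)] fT by auto
  define P where "P = opp T1 {v, b}"
  have P: "P \<in> F" "P \<noteq> T1" "{v, b} \<in> bd P" using opp[OF t1(1,6)] by (auto simp: P_def)
  obtain y where y: "y \<noteq> b" "{v, y} \<in> bd P" using bd_at[OF P(1,3)] by metis
  have "{v, b} \<notin> bd f" "{v, b} \<notin> bd g"
    using bd_third[OF f(1,4,5), of "{v, b}"] bd_third[OF f(2,6,7), of "{v, b}"] s(2) by (auto simp: doubleton_eq_iff)
  then have Pfg: "P \<noteq> f" "P \<noteq> g" using P(3) by auto
  have "{v, b} \<notin> bd T2" using t2(2,3) t1(2) s(2) by (auto simp: doubleton_eq_iff)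
  then have PT2: "P \<noteq> T2" using P(3) by auto
  have "y \<noteq> a" using faces_of_D[OF t1(5) f(4) t1(1) f(1) fT(1)[symmetric] P(1)] y Pfg P(2) by auto
  moreover have "y \<noteq> d" using faces_of_D[OF t2(5) f(6) t2(1) f(2) fT(2)[symmetric] P(1)] y Pfg PT2 by auto
  moreover have "y \<noteq> x" using faces_of_D[OF f(5,7,1,2,3) P(1)] y Pfg by auto
  moreover have "{v, y} \<in> star v" using in_star bdE[OF P(1) y(2)] by simp
  ultimately have "y = c" using y(1) unfolding s(1) by (auto simp: doubleton_eq_iff)
  then have Pc: "{v, c} \<in> bd P" using y by simp
  have o: "opp T1 {v, a} = f" "opp T2 {v, d} = g" "opp T2 {v, c} = P"
    using oppI[OF t1(1,5) f(1) fT(1) f(4)] oppI[OF t2(1,5) f(2) fT(2) f(6)] oppI[OF t2(1,6) P(1) PT2 Pc] by auto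
  define Q1 where "Q1 = opp T1 {a, b}"
  define Q2 where "Q2 = opp T2 {d, c}"
  have Q1: "Q1 \<in> F" "Q1 \<noteq> T1" "{a, b} \<in> bd Q1" using opp[OF t1(1,7)] by (auto simp: Q1_def)
  have Q2: "Q2 \<in> F" "Q2 \<noteq> T2" "{d, c} \<in> bd Q2" using opp[OF t2(1,7)] by (auto simp: Q2_def)
  have e1: "send v T1 = aid v f + aid v P + apex_aid Q1" using send_eq[OF t1(2,3)] o by (simp add: P_def Q1_def)
  have e2: "send v T2 = aid v g + aid v P + apex_aid Q2" using send_eq[OF t2(2,3)] o by (simp add: Q2_def)
  have fg: "aid v f + aid v g \<le> 1 / 3"
    using aid_pair[OF N f(1-3) s3 f(5,7)] aid_pair[OF N f(2,1) f(3)[symmetric] s3(2,1) f(7,5)]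
      aid_bounds(2)[of v f] aid_bounds(2)[of v g] by linarith
  have a1: "aid v P \<le> 1 / 6" if "apex_aid Q1 \<noteq> 0"
    using aid_le_if_apex_aid[OF N H, of T1 v b a Q1 P] triangle_atD[OF triangle_at_commute[OF T1]] Q1 P that
    by (auto simp: insert_commute)
  have a2: "aid v P \<le> 1 / 6" if "apex_aid Q2 \<noteq> 0"
    using aid_le_if_apex_aid[OF N H, of T2 v c d Q2 P] triangle_atD[OF triangle_at_commute[OF T2]] Q2 P Pc PT2 that
    by (auto simp: insert_commute)
  show ?thesis
    using e1 e2 fg a1 a2 aid_bounds(2)[of v P] apex_aid_bounds(2)[of Q1] apex_aid_bounds(2)[of Q2] by linarith
qed

lemma send_pair:
  assumes N: "\<not> has_circuit V E 4" and H: "\<not> house" and d5: "deg v = 5"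
    and T: "T1 \<in> triangles_at v" "T2 \<in> triangles_at v" "T1 \<noteq> T2"
  shows "send v T1 + send v T2 \<le> 1"
proof -
  obtain a b where t1: "triangle_at v a b T1" using T(1) triangle_atI unfolding triangles_at_def by blast
  obtain c d where t2: "triangle_at v c d T2" using T(2) triangle_atI unfolding triangles_at_def by blast
  note t1' = triangle_atD[OF t1] and t2' = triangle_atD[OF t2]
  have na: "\<And>e. e \<in> bd T1 \<Longrightarrow> e \<notin> bd T2" using no_adjacent_triangles[OF N t1'(1) t2'(1) t1'(4) t2'(4)] T(3) by blast
  have ds: "distinct [a, b, c, d]" using na[OF t1'(5)] na[OF t1'(6)] t1' t2' by auto
  let ?A = "{{v, a}, {v, b}, {v, c}, {v, d}}"
  have sub: "?A \<subseteq> star v" using in_star bdE t1' t2' by auto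
  have "card ?A = 4" using ds by (auto simp: doubleton_eq_iff)
  then have "card (star v - ?A) = 1" using sub d5 by (subst card_Diff_subset) auto
  then obtain e where e: "star v - ?A = {e}" by (auto simp: card_1_singleton_iff)
  then have "e \<in> star v" by blast
  then obtain x where x: "e = {v, x}" by (rule star_obtain) auto
  have st: "star v = {{v, a}, {v, b}, {v, c}, {v, d}, {v, x}}" using e x sub by blast
  have xd: "x \<notin> {a, b, c, d}" using e x by auto
  have xE: "{v, x} \<in> E" using \<open>e \<in> star v\<close> x in_star by simp
  obtain f g where f: "f \<in> F" "g \<in> F" "f \<noteq> g" "{v, x} \<in> bd f" "{v, x} \<in> bd g" by (rule edge_faces[OF xE])
  have nT: "{v, x} \<notin> bd T1" "{v, x} \<notin> bd T2"
    using t1'(3) t2'(3) xd t1'(2) t2'(2) by (auto simp: doubleton_eq_iff)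
  obtain y where y: "y \<noteq> x" "{v, y} \<in> bd f" using bd_at[OF f(1,4)] by metis
  obtain z where z: "z \<noteq> x" "{v, z} \<in> bd g" using bd_at[OF f(2,5)] by metis
  have "{v, y} \<in> star v" "{v, z} \<in> star v" using in_star bdE f y z by auto
  then have yz: "y = a \<or> y = b \<or> y = c \<or> y = d" "z = a \<or> z = b \<or> z = c \<or> z = d"
    using y z unfolding st by (auto simp: doubleton_eq_iff)
  have "y \<noteq> z"
  proof
    assume "y = z"
    then have "deg v = 2" using two_faces_closed(2)[OF f(1-3,4) _ f(5)] y z by auto
    then show False using d5 by simp
  qed
  \<comment> \<open>Faces from \<open>{v, x}\<close> to the two edges of one triangle would close up
    with it around \<open>v\<close> at degree three.\<close>
  have same: False if t: "triangle_at v y z T" and nx: "{v, x} \<notin> bd T" for T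
  proof -
    note t' = triangle_atD[OF t]
    have "T \<noteq> g" "T \<noteq> f" using nx f(4,5) by auto
    then have "deg v = 3"
      using three_faces_closed(2)[OF t'(1) f(2) f(1) _ f(3)[symmetric] _ t'(5) t'(6) z(2) f(5) f(4) y(2) \<open>y \<noteq> z\<close> z(1) y(1)] by simp
    then show False using d5 by simp
  qed
  have n1: "\<not> ((y = a \<or> y = b) \<and> (z = a \<or> z = b))"
    using same[OF _ nT(1)] t1 triangle_at_commute[OF t1] \<open>y \<noteq> z\<close> by metis
  have n2: "\<not> ((y = c \<or> y = d) \<and> (z = c \<or> z = d))"
    using same[OF _ nT(2)] t2 triangle_at_commute[OF t2] \<open>y \<noteq> z\<close> by metis
  have S: "distinct [p, q, r, s', x]" "star v = {{v, p}, {v, q}, {v, r}, {v, s'}, {v, x}}"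
    if "triangle_at v p q T1" "triangle_at v s' r T2" for p q r s'
  proof -
    have "{p, q} = {a, b}"
      using that(1) triangle_atD(3)[OF that(1)] t1' unfolding triangle_at_def by (auto simp: doubleton_eq_iff)
    moreover have "{s', r} = {c, d}"
      using that(2) triangle_atD(3)[OF that(2)] t2' unfolding triangle_at_def by (auto simp: doubleton_eq_iff)
    ultimately have c: "p = a \<and> q = b \<or> p = b \<and> q = a" "s' = c \<and> r = d \<or> s' = d \<and> r = c"
      by (auto simp: doubleton_eq_iff)
    then show "distinct [p, q, r, s', x]" using ds xd by auto
    show "star v = {{v, p}, {v, q}, {v, r}, {v, s'}, {v, x}}" using c st by (elim disjE conjE) (simp_all add: insert_commute)
  qed
  consider "y = a \<or> y = b" "z = c \<or> z = d" | "z = a \<or> z = b" "y = c \<or> y = d" using yz n1 n2 by blast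
  then show ?thesis
  proof cases
    case 1
    obtain q where q: "triangle_at v y q T1" using triangle_at_choose[OF t1 1(1)] by blast
    obtain r where r: "triangle_at v z r T2" using triangle_at_choose[OF t2 1(2)] by blast
    show ?thesis using send_pair_aux[OF N H q r T(3) f(1-3) y(2) f(4) z(2) f(5) S(2)[OF q r] S(1)[OF q r]] .
  next
    case 2
    obtain q where q: "triangle_at v z q T1" using triangle_at_choose[OF t1 2(1)] by blast
    obtain r where r: "triangle_at v y r T2" using triangle_at_choose[OF t2 2(2)] by blast
    show ?thesis using send_pair_aux[OF N H q r T(3) f(2,1) f(3)[symmetric] z(2) f(5) y(2) f(4) S(2)[OF q r] S(1)[OF q r]] .
  qed
qed

text \<open>Small vertices give no aid, and an apex aid from a small apex would mean a
  house.\<close>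

lemma send_small:
  assumes N: "\<not> has_circuit V E 4" and H: "\<not> house" and "small v" "f \<in> triangles_at v"
  shows "send v f = 0"
proof -
  obtain a b where t: "triangle_at v a b f" using assms(4) triangle_atI unfolding triangles_at_def by blast
  note t' = triangle_atD[OF t]
  have o: "opp f {a, b} \<in> F" "{a, b} \<in> bd (opp f {a, b})" using opp[OF t'(1,7)] by auto
  have "apex_aid (opp f {a, b}) = 0"
  proof (rule ccontr)
    assume "apex_aid (opp f {a, b}) \<noteq> 0"
    then have d: "deficient (opp f {a, b})" "\<forall>u\<in>\<Union>(bd (opp f {a, b})). small u" by (auto simp: apex_aid_def split: if_splits)
    then have "sz (opp f {a, b}) = 5" by (simp add: deficient_def)
    moreover have "bd f = {{a, b}, {b, v}, {v, a}}" "distinct [a, b, v]" using t' by (auto simp: insert_commute)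
    ultimately show False using houseI[OF N o(1) _ d(2) o(2) t'(1)] assms(3) H by blast
  qed
  then show ?thesis using send_eq[OF t'(2,3)] assms(3) by (simp add: aid_def)
qed

text \<open>Triangles at \<open>v\<close> use disjoint pairs of edges, so sending 2/3 to each costs
  at most \<open>deg v / 3\<close>. This is at most \<open>deg v - 4\<close> from degree six and at
  most \<open>deg v - 2\<close> from degree three on. Degree five with two triangles is the tight
  case settled by \<open>send_pair\<close>; at degree two there are no triangles.\<close>

lemma send_total:
  assumes N: "\<not> has_circuit V E 4" and H: "\<not> house"
  shows "v \<in> V - Z \<Longrightarrow> (\<Sum>f\<in>triangles_at v. send v f) \<le> real (deg v) - 4"
    and "v \<in> Z \<Longrightarrow> (\<Sum>f\<in>triangles_at v. send v f) \<le> real (deg v) - 2"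
proof -
  let ?s = "\<Sum>f\<in>triangles_at v. send v f"
  let ?t = "card (triangles_at v)"
  have t: "2 * ?t \<le> deg v" by (rule triangles_at_card[OF N])
  have le: "?s \<le> (\<Sum>f\<in>triangles_at v. 2 / 3)"
    by (intro sum_mono send_le[OF N H]) (auto simp: triangles_at_def)
  then have le: "?s \<le> 2 / 3 * real ?t" by simp
  {
    assume v: "v \<in> V - Z"
    show "?s \<le> real (deg v) - 4"
    proof (cases "deg v = 4")
      case True
      then have "small v" using v by (simp add: small_def)
      then have "?s = 0" using send_small[OF N H] by simp
      then show ?thesis using True by simp
    next
      case False
      then have d: "5 \<le> deg v" using deg4[OF v] by (simp add: star_def)
      show ?thesis
      proof (cases "6 \<le> deg v")
        case True
        then show ?thesis using t le by linarith
      next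
        case False
        then have d5: "deg v = 5" using d by simp
        then have "?t \<le> 2" using t by simp
        then consider "?t \<le> 1" | "?t = 2" by linarith
        then show ?thesis
        proof cases
          case 1
          then have "?s \<le> 2 / 3" using le by simp
          then show ?thesis using d5 by simp
        next
          case 2
          then obtain T1 T2 where T: "triangles_at v = {T1, T2}" "T1 \<noteq> T2" by (auto simp: card_2_iff)
          then show ?thesis using send_pair[OF N H d5, of T1 T2] d5 by simp
        qed
      qed
    qed
  }
  {
    assume v: "v \<in> Z"
    then have d2: "2 \<le> deg v" using deg2[of v] ZV by (auto simp: star_def)
    show "?s \<le> real (deg v) - 2"
    proof (cases "deg v = 2")
      case True
      have "triangles_at v = {}"
      proof (rule ccontr)
        assume "triangles_at v \<noteq> {}"
        then obtain f where f: "f \<in> triangles_at v" by blast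
        then obtain a b where "triangle_at v a b f" using triangle_atI unfolding triangles_at_def by blast
        then have "3 \<le> deg v" using triangle_deg_face by (auto simp: triangle_at_def)
        then show False using True by simp
      qed
      then show ?thesis using True by simp
    next
      case False
      then have "3 \<le> real (deg v)" using d2 by simp
      moreover have "real ?t \<le> real (deg v) / 2" using t by linarith
      ultimately show ?thesis using le by linarith
    qed
  }
qed

section \<open>What a face of length at least five pays\<close>

definition tdeg :: "'a \<Rightarrow> 'f \<Rightarrow> nat" where "tdeg v f = card {e \<in> bd f. v \<in> e \<and> tedge e}"

lemma vertices_bd: "f \<in> F \<Longrightarrow> \<Union>(bd f) \<subseteq> V" using cycF edge by blast

lemma sum_cost:
  assumes f: "f \<in> F" and a: "apex_aid f = 0"
  shows "(\<Sum>e\<in>bd f. if tedge e then cost e f else 0) = real (tcount f) / 3 - (\<Sum>v\<in>\<Union>(bd f). real (tdeg v f) * aid v f)"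
proof -
  let ?T = "{e \<in> bd f. tedge e}"
  have fin: "finite ?T" "finite (\<Union>(bd f))" using fin_bd[OF f] finite_subset[OF vertices_bd[OF f] finV] by auto
  have "(\<Sum>e\<in>bd f. if tedge e then cost e f else 0) = (\<Sum>e\<in>?T. cost e f)"
    using fin_bd[OF f] by (simp add: sum.inter_filter)
  also have "\<dots> = real (tcount f) / 3 - (\<Sum>e\<in>?T. \<Sum>v\<in>e. aid v f)"
    by (simp add: cost_def a sum_subtractf tcount_def)
  also have "(\<Sum>e\<in>?T. \<Sum>v\<in>e. aid v f) = (\<Sum>e\<in>?T. \<Sum>v | v \<in> \<Union>(bd f) \<and> v \<in> e. aid v f)"
    by (intro sum.cong refl arg_cong[where f = "sum _"]) auto
  also have "\<dots> = (\<Sum>v\<in>\<Union>(bd f). \<Sum>e | e \<in> ?T \<and> v \<in> e. aid v f)"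
    by (rule sum.swap_restrict[OF fin])
  also have "\<dots> = (\<Sum>v\<in>\<Union>(bd f). real (tdeg v f) * aid v f)"
  proof (rule sum.cong)
    fix v
    have "{e. e \<in> ?T \<and> v \<in> e} = {e \<in> bd f. v \<in> e \<and> tedge e}" by blast
    then show "(\<Sum>e | e \<in> ?T \<and> v \<in> e. aid v f) = real (tdeg v f) * aid v f" by (simp add: tdeg_def)
  qed simp
  finally show ?thesis .
qed

lemma tcount_tdeg:
  assumes f: "f \<in> F" "sz f = 5" and v: "v \<in> \<Union>(bd f)"
  shows "tcount f \<le> tdeg v f + 3" "tdeg v f \<le> 2" "tcount f \<le> 5"
proof -
  have c2: "card {e \<in> bd f. v \<in> e} = 2" by (rule bd_at_card[OF f(1) v])
  have fin: "finite (bd f)" by (rule fin_bd[OF f(1)])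
  have "card (bd f - {e \<in> bd f. v \<in> e}) = 3" using c2 f(2) fin by (subst card_Diff_subset) auto
  moreover have "{e \<in> bd f. tedge e} \<subseteq> {e \<in> bd f. v \<in> e \<and> tedge e} \<union> (bd f - {e \<in> bd f. v \<in> e})" by blast
  then have "tcount f \<le> card ({e \<in> bd f. v \<in> e \<and> tedge e} \<union> (bd f - {e \<in> bd f. v \<in> e}))"
    unfolding tcount_def using fin by (intro card_mono) auto
  ultimately show "tcount f \<le> tdeg v f + 3"
    unfolding tdeg_def using card_Un_le[of "{e \<in> bd f. v \<in> e \<and> tedge e}" "bd f - {e \<in> bd f. v \<in> e}"] by linarith
  have "tdeg v f \<le> card {e \<in> bd f. v \<in> e}" unfolding tdeg_def using fin by (intro card_mono) auto
  then show "tdeg v f \<le> 2" using c2 by simp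
  have "tcount f \<le> sz f" unfolding tcount_def using fin by (intro card_mono) auto
  then show "tcount f \<le> 5" using f(2) by simp
qed

lemma face_cost:
  assumes f: "f \<in> F" "5 \<le> sz f"
  shows "(\<Sum>e\<in>bd f. if tedge e then cost e f else 0) \<le> real (sz f) - 4"
proof -
  have tc: "tcount f \<le> sz f" unfolding tcount_def using fin_bd[OF f(1)] by (intro card_mono) auto
  show ?thesis
  proof (cases "deficient f")
    case False
    then have "(\<Sum>e\<in>bd f. if tedge e then cost e f else 0) = real (tcount f) / 3"
      using sum_cost[OF f(1)] by (simp add: aid_def apex_aid_def)
    moreover have "real (tcount f) / 3 \<le> real (sz f) - 4"
    proof (cases "sz f = 5")
      case True
      then have "tcount f \<le> 3" using False f(1) by (simp add: deficient_def)
      then show ?thesis using True by simp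
    next
      case False
      then have "6 \<le> real (sz f)" "real (tcount f) \<le> real (sz f)" using f(2) tc by auto
      then show ?thesis by linarith
    qed
    ultimately show ?thesis by simp
  next
    case True
    then have s5: "sz f = 5" "4 \<le> tcount f" by (auto simp: deficient_def)
    show ?thesis
    proof (cases "\<forall>u\<in>\<Union>(bd f). small u")
      case all: True
      \<comment> \<open>The apex aid is chosen so that 1/3 - 2/15 = 1/5; even five such edges only
        use up the charge 1.\<close>
      then have "cost e f = 1 / 5" if "e \<in> bd f" for e
      proof -
        have "(\<Sum>v\<in>e. aid v f) = 0" using all that by (intro sum.neutral) (auto simp: aid_def)
        then show ?thesis using all True by (simp add: cost_def apex_aid_def)
      qed
      then have "(\<Sum>e\<in>bd f. if tedge e then cost e f else 0) \<le> (\<Sum>e\<in>bd f. 1 / 5)" by (intro sum_mono) auto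
      then show ?thesis using s5 by simp
    next
      case False
      then have ap: "apex_aid f = 0" by (simp add: apex_aid_def)
      obtain v where v: "v \<in> \<Union>(bd f)" "\<not> small v" using False by blast
      have fin: "finite (\<Union>(bd f))" using finite_subset[OF vertices_bd[OF f(1)] finV] .
      note tv = tcount_tdeg[OF f(1) s5(1) v(1)]
      \<comment> \<open>The excess is 2/3 with five adjacent triangles and 1/3 with four. A lone
        vertex covers it by two aids of 1/3, one of 1/3 or two of 1/6, respectively. With two
        vertices that are not small, each gives 1/6 over at least \<open>tcount f - 3\<close> edges,
        which again suffices.\<close>
      have "real (tcount f) / 3 - 1 \<le> (\<Sum>u\<in>\<Union>(bd f). real (tdeg u f) * aid u f)"
      proof (cases "lone f v")
        case True
        have "real (tcount f) / 3 - 1 \<le> real (tdeg v f) * aid v f"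
        proof (cases "tcount f = 5")
          case five: True
          then have "aid v f = 1 / 3" "tdeg v f = 2" using v \<open>deficient f\<close> True tv(1,2) by (auto simp: aid_def)
          then show ?thesis using five by simp
        next
          case False
          then have t4: "tcount f = 4" using s5(2) tv(3) by simp
          then consider "tdeg v f = 1" | "tdeg v f = 2" using tv by linarith
          then show ?thesis
          proof cases
            case 1
            then have "aid v f = 1 / 3" using v \<open>deficient f\<close> True by (auto simp: aid_def tdeg_def)
            then show ?thesis using t4 1 by simp
          next
            case 2
            then have "aid v f = 1 / 6" using v \<open>deficient f\<close> True t4 by (auto simp: aid_def tdeg_def)
            then show ?thesis using t4 2 by simp
          qed
        qed
        also have "\<dots> \<le> (\<Sum>u\<in>\<Union>(bd f). real (tdeg u f) * aid u f)"
          by (rule member_le_sum[OF v(1) _ fin]) (simp add: aid_bounds)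
        finally show ?thesis .
      next
        case False
        then obtain u where u: "u \<in> \<Union>(bd f)" "u \<noteq> v" "\<not> small u" by (auto simp: lone_def)
        have "\<not> lone f u" using u v by (auto simp: lone_def)
        then have a: "aid u f = 1 / 6" "aid v f = 1 / 6" using u v False \<open>deficient f\<close> by (auto simp: aid_def)
        note tu = tcount_tdeg[OF f(1) s5(1) u(1)]
        have "real (tcount f) / 3 - 1 \<le> real (tdeg v f) * (1 / 6) + real (tdeg u f) * (1 / 6)"
          using tv(1) tu(1) by linarith
        also have "\<dots> = (\<Sum>w\<in>{v, u}. real (tdeg w f) * aid w f)" using u(2) by (simp add: a)
        also have "\<dots> \<le> (\<Sum>u\<in>\<Union>(bd f). real (tdeg u f) * aid u f)"
          by (rule sum_mono2[OF fin]) (use u v in \<open>auto simp: aid_bounds\<close>)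
        finally show ?thesis .
      qed
      then show ?thesis using sum_cost[OF f(1) ap] s5(1) by simp
    qed
  qed
qed

lemma circuit4_or_house: "has_circuit V E 4 \<or> house"
proof (rule ccontr)
  assume "\<not> ?thesis"
  then have N: "\<not> has_circuit V E 4" and H: "\<not> house" by auto
  define \<theta> where "\<theta> v f = (if sz f = 3 then send v f else 0)" for v f
  \<comment> \<open>A triangle has a negative outflow equal to what the face across the edge pays,
    so no charge stays on an edge.\<close>
  define \<phi> where "\<phi> f e = (if sz f = 3 then - cost e (opp f e) else if tedge e then cost e f else 0)" for f e
  have s\<theta>: "(\<Sum>f | f \<in> F \<and> v \<in> \<Union>(bd f). \<theta> v f) = (\<Sum>f\<in>triangles_at v. send v f)" for v
  proof -
    have "(\<Sum>f | f \<in> F \<and> v \<in> \<Union>(bd f). \<theta> v f) = (\<Sum>f\<in>triangles_at v. \<theta> v f)"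
      by (rule sum.mono_neutral_right) (use finF in \<open>auto simp: triangles_at_def \<theta>_def\<close>)
    also have "\<dots> = (\<Sum>f\<in>triangles_at v. send v f)" by (rule sum.cong) (auto simp: triangles_at_def \<theta>_def)
    finally show ?thesis .
  qed
  have "real (card Z) \<le> 3" using Z3 by simp
  then show False
  proof (intro discharging[of 4 1 1 \<phi> \<theta> "\<lambda>_ _. 0" 2])
    fix f assume f: "f \<in> F"
    show "0 \<le> 1 * real (sz f) - 4 - (\<Sum>e\<in>bd f. \<phi> f e) + (\<Sum>v | v \<in> V \<and> v \<in> \<Union>(bd f). \<theta> v f)"
    proof (cases "sz f = 3")
      case True
      obtain v where "v \<in> \<Union>(bd f)" using is_circuit_two_vertices cycF[OF f] by metis
      then obtain a b where t: "triangle_at v a b f" using triangle_atI[OF f True] by metis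
      note t' = triangle_atD[OF t]
      have d: "{v, a} \<notin> {{a, b}, {b, v}}" "{a, b} \<notin> {{b, v}}" using t'(2) by (auto simp: doubleton_eq_iff)
      have "{u \<in> V. u \<in> \<Union>(bd f)} = {v, a, b}" using vertices_bd[OF f] t'(3) by auto
      then have 1: "(\<Sum>u | u \<in> V \<and> u \<in> \<Union>(bd f). \<theta> u f) = send v f + send a f + send b f"
        using t'(2) True by (simp add: \<theta>_def)
      have 2: "(\<Sum>e\<in>bd f. \<phi> f e) = - cost {v, a} (opp f {v, a}) - cost {a, b} (opp f {a, b}) - cost {b, v} (opp f {b, v})"
        using True d by (simp add: \<phi>_def t'(3))
      have 3: "send v f = aid v (opp f {v, a}) + aid v (opp f {b, v}) + apex_aid (opp f {a, b})"
        using send_eq[OF t'(2,3)] by (simp add: insert_commute[of v b "{}"])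
      have 4: "send a f = aid a (opp f {a, b}) + aid a (opp f {v, a}) + apex_aid (opp f {b, v})"
      proof -
        have "bd f = {{a, b}, {b, v}, {v, a}}" unfolding t'(3) by (rule set_eqI) (simp only: insert_iff empty_iff, blast)
        moreover have "distinct [a, b, v]" using t'(2) by auto
        moreover have "{a, v} = {v, a}" by (rule insert_commute)
        ultimately show ?thesis using send_eq[of a b v f] by simp
      qed
      have 5: "send b f = aid b (opp f {b, v}) + aid b (opp f {a, b}) + apex_aid (opp f {v, a})"
      proof -
        have "bd f = {{b, v}, {v, a}, {a, b}}" unfolding t'(3) by (rule set_eqI) (simp only: insert_iff empty_iff, blast)
        moreover have "distinct [b, v, a]" using t'(2) by auto
        moreover have "{b, a} = {a, b}" by (rule insert_commute)
        ultimately show ?thesis using send_eq[of b v a f] by simp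
      qed
      have c: "cost {x, y} g = 1 / 3 - aid x g - aid y g - apex_aid g" if "x \<noteq> y" for x y g using that by (simp add: cost_def)
      have n: "v \<noteq> a" "a \<noteq> b" "b \<noteq> v" using t'(2) by auto
      show ?thesis unfolding 1 2 3 4 5 c[OF n(1)] c[OF n(2)] c[OF n(3)] True by simp
    next
      case False
      have "(\<Sum>v | v \<in> V \<and> v \<in> \<Union>(bd f). \<theta> v f) = 0" using False by (simp add: \<theta>_def)
      moreover have "5 \<le> sz f" using False sz_ge_3[OF f] sz_neq[OF N f] by linarith
      ultimately show ?thesis using face_cost[OF f] False by (simp add: \<phi>_def)
    qed
  next
    fix e assume e: "e \<in> E"
    obtain f g where fg: "f \<in> F" "g \<in> F" "f \<noteq> g" "e \<in> bd f" "e \<in> bd g" "{h \<in> F. e \<in> bd h} = {f, g}"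
      by (rule edge_faces[OF e])
    have o: "opp f e = g" "opp g e = f" using oppI fg by metis+
    have "\<not> (sz f = 3 \<and> sz g = 3)" using no_adjacent_triangles[OF N fg(1,2) _ _ fg(4,5)] fg(3) by blast
    moreover have "tedge e" if "sz f = 3 \<or> sz g = 3" using that fg unfolding tedge_def by blast
    moreover have "\<not> tedge e" if "sz f \<noteq> 3" "sz g \<noteq> 3" using not_tedge[OF fg(1-5) that] .
    ultimately have "\<phi> f e + \<phi> g e = 0" using o unfolding \<phi>_def by auto
    then show "0 \<le> (\<Sum>f | f \<in> F \<and> e \<in> bd f. \<phi> f e) - (\<Sum>v\<in>e. 0)" using fg(3,6) by simp
  next
    fix v assume "v \<in> V - Z"
    then show "0 \<le> 1 * real (deg v) - 4 + (\<Sum>e\<in>star v. 0) - (\<Sum>f | f \<in> F \<and> v \<in> \<Union>(bd f). \<theta> v f)"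
      using send_total(1)[OF N H] unfolding s\<theta> by simp
  next
    fix v assume "v \<in> Z"
    then show "- 2 \<le> 1 * real (deg v) - 4 + (\<Sum>e\<in>star v. 0) - (\<Sum>f | f \<in> F \<and> v \<in> \<Union>(bd f). \<theta> v f)"
      using send_total(2)[OF N H] unfolding s\<theta> by fastforce
  qed auto
qed

subsection \<open>Circuits of length six\<close>

definition adj :: "'a \<Rightarrow> 'a \<Rightarrow> bool" where "adj u v \<longleftrightarrow> {u, v} \<in> E"

lemma adj_commute: "adj u v \<longleftrightarrow> adj v u" by (simp add: adj_def insert_commute)

lemma circuit6_adj:
  "distinct [a, b, c, d, e, f] \<Longrightarrow> adj a b \<Longrightarrow> adj b c \<Longrightarrow> adj c d \<Longrightarrow> adj d e \<Longrightarrow> adj e f \<Longrightarrow> adj f a \<Longrightarrow> has_circuit V E 6"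
  by (rule circuit6I) (auto simp: adj_def)

lemma bd_adj: "f \<in> F \<Longrightarrow> {a, b} \<in> bd f \<Longrightarrow> adj a b" using bdE by (simp add: adj_def)

lemma triangle_at_adj: "triangle_at v a b f \<Longrightarrow> adj v a \<and> adj v b \<and> adj a b"
  using triangle_atD bd_adj by metis

lemma triangle_at_rotate: "triangle_at v a b f \<Longrightarrow> triangle_at a b v f"
  unfolding triangle_at_def by (elim conjE, intro conjI) (simp, force, blast)

lemma triangle_at_third: "triangle_at v a b f \<Longrightarrow> {v, x} \<in> bd f \<Longrightarrow> x = a \<or> x = b"
  using bd_third[of f v a b "{v, x}"] triangle_atD[of v a b f] by (auto simp: doubleton_eq_iff)

lemma triangle_at_unique: "triangle_at v a b f \<Longrightarrow> triangle_at v a c f \<Longrightarrow> b = c"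
  using triangle_at_third[of v a b f c] triangle_atD(6)[of v a c f] triangle_atD(2)[of v a c f] by auto

lemma triangle_at_share:
  "triangle_at v a b f \<Longrightarrow> g \<in> F \<Longrightarrow> g \<noteq> f \<Longrightarrow> {v, a} \<in> bd g \<Longrightarrow> {v, b} \<notin> bd g"
  using triangle_shares_one_edge[of f g v a b] triangle_atD[of v a b f] by auto

lemma triangle_at_edge:
  assumes "f \<in> F" "sz f = 3" "{v, a} \<in> bd f"
  obtains b where "triangle_at v a b f"
  using face3[OF assms] assms(1) by (metis distinct_length_2_or_more distinct_singleton triangle_at_def)

lemma clique_face: "adj a b \<Longrightarrow> adj b c \<Longrightarrow> adj c a \<Longrightarrow> \<exists>f. triangle_at a b c f"
proof -
  assume a: "adj a b" "adj b c" "adj c a"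
  then obtain f where f: "f \<in> F" "bd f = {{a, b}, {b, c}, {c, a}}" using triangle_face[of a b c] unfolding adj_def by blast
  have "a \<noteq> b" "b \<noteq> c" "c \<noteq> a" using a edge_neq unfolding adj_def by metis+
  then have "triangle_at a b c f" using f by (simp add: triangle_at_def)
  then show ?thesis ..
qed

lemma no_K4:
  assumes "triangle_at v a b f" "triangle_at v b c g" "triangle_at v c a h" "f \<noteq> g" "g \<noteq> h" "f \<noteq> h"
  shows False
  by (rule triangles_around_deg3[of f g h v a b c])
    (use assms triangle_atD(1,2,3)[OF assms(1)] triangle_atD(1,2,3)[OF assms(2)] triangle_atD(1,2,3)[OF assms(3)] in auto)

lemma fan3:
  assumes "triangle_at v a x f" "triangle_at v a b g" "triangle_at v b y h" "f \<noteq> g" "g \<noteq> h"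
  shows "f \<noteq> h" "distinct [v, x, a, b, y]"
proof -
  note 1 = triangle_atD[OF assms(1)] and 2 = triangle_atD[OF assms(2)] and 3 = triangle_atD[OF assms(3)]
  have n: "a \<noteq> b" using 2(2) by auto
  obtain x' y' where *: "f \<noteq> h" "distinct [v, x', a, b, y']" "bd f = {{v, a}, {a, x'}, {x', v}}" "bd h = {{v, b}, {b, y'}, {y', v}}"
    using three_triangles[OF 1(1) 2(1) 3(1) assms(4,5) 1(4) 2(4) 3(4) 1(5) 2(5,6) 3(5) n] by metis
  have "triangle_at v a x' f" "triangle_at v b y' h" using * 1(1) 3(1) by (auto simp: triangle_at_def)
  then have "x' = x" "y' = y" using triangle_at_unique assms(1,3) by blast+
  then show "f \<noteq> h" "distinct [v, x, a, b, y]" using * by auto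
qed

lemma TT_other:
  assumes "triangle_at v a b f" "TT {v, a}"
  obtains g x where "g \<noteq> f" "triangle_at v a x g"
proof -
  note 1 = triangle_atD[OF assms(1)]
  obtain g where g: "g \<in> F" "g \<noteq> f" "{v, a} \<in> bd g" using other_face[OF 1(1,5)] by metis
  then have "sz g = 3" using assms(2) by (simp add: TT_def)
  then obtain x where "triangle_at v a x g" using triangle_at_edge g by metis
  then show thesis using that g by blast
qed

lemma TT_commute: "TT {u, v} \<Longrightarrow> TT {v, u}" by (simp add: insert_commute)

lemma TT_I:
  assumes "f \<in> F" "g \<in> F" "f \<noteq> g" "e \<in> bd f" "e \<in> bd g" "sz f = 3" "sz g = 3"
  shows "TT e"
  unfolding TT_def using faces_of_D[OF assms(4,5,1,2,3)] assms bdE by blast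

lemma TT_triangles:
  assumes "TT {v, w}"
  obtains f g a c where "f \<noteq> g" "triangle_at v w a f" "triangle_at v w c g"
proof -
  have "{v, w} \<in> E" using assms by (simp add: TT_def)
  then obtain f g where fg: "f \<in> F" "g \<in> F" "f \<noteq> g" "{v, w} \<in> bd f" "{v, w} \<in> bd g" by (rule edge_faces)
  moreover have "sz f = 3" "sz g = 3" using assms fg by (auto simp: TT_def)
  ultimately show thesis using that triangle_at_edge by metis
qed

lemma diamond_distinct:
  assumes "triangle_at v w a f" "triangle_at v w c g" "f \<noteq> g"
  shows "distinct [v, w, a, c]"
proof -
  have "a \<noteq> c" using triangle_at_share[OF assms(1), of g] triangle_atD[OF assms(2)] assms(3) by auto
  then show ?thesis using triangle_atD(2)[OF assms(1)] triangle_atD(2)[OF assms(2)] by auto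
qed

text \<open>An edge between \<open>a\<close> and \<open>c\<close> would make \<open>v a c\<close> a
  third facial triangle and close the faces around \<open>v\<close>.\<close>

lemma diamond_not_adj:
  assumes "triangle_at v w a f" "triangle_at v w c g" "f \<noteq> g"
  shows "\<not> adj a c"
proof
  assume ac: "adj a c"
  note d = diamond_distinct[OF assms]
  have "adj v c" "adj v a" using triangle_at_adj assms by metis+
  then obtain h where h: "triangle_at v c a h" using clique_face[of v c a] ac adj_commute by metis
  have "h \<noteq> f" using triangle_at_third[OF assms(1), of c] triangle_atD(5)[OF h] d by auto
  moreover have "h \<noteq> g" using triangle_at_third[OF assms(2), of a] triangle_atD(6)[OF h] d by auto
  ultimately show False
    using no_K4[OF triangle_at_commute[OF assms(1)] assms(2) h] assms(3) by blast
qed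

definition center :: "'a \<Rightarrow> bool" where "center v \<longleftrightarrow> deg v = 4 \<and> (\<forall>e\<in>star v. TT e)"

section \<open>Runs of adjacent triangles and the 6-circuits around them\<close>

context
  assumes N: "\<not> has_circuit V E 6"
begin

text \<open>The fans at the three corners show that the outer apexes are distinct; corners and
  apexes alternate on the 6-circuit \<open>v x a y b z\<close>.\<close>

lemma not_three_TT:
  assumes f: "triangle_at v a b f" and t: "TT {v, a}" "TT {v, b}" "TT {a, b}"
  shows False
proof -
  obtain g x where g: "g \<noteq> f" "triangle_at v a x g" using TT_other[OF f t(1)] .
  obtain k z where k: "k \<noteq> f" "triangle_at v b z k" using TT_other[OF triangle_at_commute[OF f] t(2)] .
  have f': "triangle_at a b v f" by (rule triangle_at_rotate[OF f])
  obtain h y where h: "h \<noteq> f" "triangle_at a b y h" using TT_other[OF f' t(3)] .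
  have g': "triangle_at a v x g" by (rule triangle_at_commute[OF triangle_at_rotate[OF g(2)]])
  have f'': "triangle_at a v b f" by (rule triangle_at_commute[OF f'])
  have f3: "triangle_at b a v f" by (rule triangle_at_commute[OF triangle_at_rotate[OF f']])
  have h': "triangle_at b a y h" by (rule triangle_at_commute[OF triangle_at_rotate[OF h(2)]])
  have k': "triangle_at b v z k" by (rule triangle_at_commute[OF triangle_at_rotate[OF k(2)]])
  have d1: "distinct [v, x, a, b, z]" using fan3(2)[OF g(2) f k(2) g(1) k(1)[symmetric]] .
  have d2: "distinct [a, x, v, b, y]" using fan3(2)[OF g' f'' h(2) g(1) h(1)[symmetric]] .
  have d3: "distinct [b, y, a, v, z]" using fan3(2)[OF h' f3 k' h(1) k(1)[symmetric]] .
  have "distinct [v, x, a, y, b, z]" using d1 d2 d3 by auto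
  then show False
    using circuit6_adj[of v x a y b z] N triangle_at_adj[OF g(2)] triangle_at_adj[OF h(2)] triangle_at_adj[OF k(2)] adj_commute by metis
qed

text \<open>Four triangles in zigzag order span the 6-circuit \<open>x a w y c v\<close>, unless
  their end apexes coincide. Then \<open>a w x\<close> bounds a face too, and three triangles close
  up around \<open>a\<close>.\<close>

lemma no_strip:
  assumes f: "triangle_at v w a f" and g: "triangle_at v w c g" and n: "f \<noteq> g" and t: "TT {v, a}" "TT {w, c}"
  shows False
proof -
  obtain h x where h: "h \<noteq> f" "triangle_at v a x h" using TT_other[OF triangle_at_commute[OF f] t(1)] .
  have gw: "triangle_at w c v g" by (rule triangle_at_rotate[OF g])
  have fw: "triangle_at w v a f" by (rule triangle_at_commute[OF triangle_at_rotate[OF f]])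
  obtain k y where k: "k \<noteq> g" "triangle_at w c y k" using TT_other[OF gw t(2)] .
  have d1: "distinct [v, x, a, w, c]" using fan3(2)[OF h(2) triangle_at_commute[OF f] g h(1) n] .
  have d2: "distinct [w, a, v, c, y]" using fan3(2)[OF fw triangle_at_commute[OF gw] k(2) n k(1)[symmetric]] .
  note ad = triangle_at_adj[OF f] triangle_at_adj[OF g] triangle_at_adj[OF h(2)] triangle_at_adj[OF k(2)]
  show False
  proof (cases "x = y")
    case False
    then have "distinct [x, a, w, y, c, v]" using d1 d2 by auto
    then show False using circuit6_adj[of x a w y c v] N ad adj_commute by metis
  next
    case True
    have "adj a w" "adj w x" "adj x a" using ad True adj_commute by metis+
    then obtain m where m: "triangle_at a w x m" using clique_face by metis
    have ha: "triangle_at a x v h" by (rule triangle_at_rotate[OF h(2)])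
    have fa: "triangle_at a v w f" by (rule triangle_at_rotate[OF triangle_at_rotate[OF f]])
    have "m \<noteq> h" using triangle_at_third[OF ha, of w] triangle_atD(5)[OF m] d1 by auto
    moreover have "m \<noteq> f" using triangle_at_third[OF fa, of x] triangle_atD(6)[OF m] d1 by auto
    ultimately show False using no_K4[OF ha fa m] h(1) by blast
  qed
qed

text \<open>Three consecutive \<open>TT\<close> edges mean four consecutive triangles at
  \<open>v\<close>. Their outermost vertices coincide, since otherwise \<open>v\<close> and the rim
  form a 6-circuit, and so the triangles close up to a wheel.\<close>

lemma fan4_center:
  assumes f: "triangle_at v w a f" and g: "triangle_at v w c g" and n: "f \<noteq> g" and t: "TT {v, a}" "TT {v, c}"
  shows "center v"
proof -
  obtain h x where h: "h \<noteq> f" "triangle_at v a x h" using TT_other[OF triangle_at_commute[OF f] t(1)] .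
  obtain k y where k: "k \<noteq> g" "triangle_at v c y k" using TT_other[OF triangle_at_commute[OF g] t(2)] .
  have d1: "h \<noteq> g" "distinct [v, x, a, w, c]" using fan3[OF h(2) triangle_at_commute[OF f] g h(1) n] by auto
  have d2: "f \<noteq> k" "distinct [v, a, w, c, y]" using fan3[OF triangle_at_rotate[OF triangle_at_rotate[OF triangle_at_rotate[OF f]]] g k(2) n k(1)[symmetric]] by auto
  note ad = triangle_at_adj[OF f] triangle_at_adj[OF g] triangle_at_adj[OF h(2)] triangle_at_adj[OF k(2)]
  note D = triangle_atD[OF f] triangle_atD[OF g] triangle_atD[OF h(2)] triangle_atD[OF k(2)]
  have xy: "x = y"
  proof (rule ccontr)
    assume "x \<noteq> y"
    then have "distinct [v, x, a, w, c, y]" using d1 d2 by auto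
    then show False using circuit6_adj[of v x a w c y] N ad adj_commute by metis
  qed
  have hk: "h \<noteq> k" using triangle_at_third[OF h(2), of c] triangle_atD(5)[OF k(2)] d1 by auto
  let ?A = "{{v, a}, {v, w}, {v, c}, {v, x}}"
  have s: "star v = ?A"
  proof (rule closed_star)
    show "?A \<subseteq> star v" using ad by (simp add: star_def adj_def)
    fix l e e' assume l: "l \<in> F" "e \<in> ?A" "e \<in> bd l" "e' \<in> bd l" "v \<in> e'"
    have "l = f \<or> l = g \<or> l = h \<or> l = k"
    proof -
      from l(2) consider "e = {v, a}" | "e = {v, w}" | "e = {v, c}" | "e = {v, x}" by blast
      then show ?thesis
      proof cases
        case 1
        then show ?thesis using faces_of_D[of e h f l] l h(1) D by auto
      next
        case 2
        then show ?thesis using faces_of_D[of e f g l] l n D by auto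
      next
        case 3
        then show ?thesis using faces_of_D[of e g k l] l k(1) D by auto
      next
        case 4
        then show ?thesis using faces_of_D[of e h k l] l hk D xy by auto
      qed
    qed
    moreover obtain z where z: "e' = {v, z}" using card2_joins[of e' v] edge[OF bdE[OF l(1,4)]] l(5) by (metis card_2_iff insert_iff singletonD)
    ultimately have "z = a \<or> z = w \<or> z = c \<or> z = x"
      using triangle_at_third[OF f, of z] triangle_at_third[OF g, of z] triangle_at_third[OF h(2), of z] triangle_at_third[OF k(2), of z] l(4) xy by metis
    then show "e' \<in> ?A" using z by auto
  qed simp
  have "deg v = 4" unfolding s using d1 by (auto simp: doubleton_eq_iff)
  moreover have "TT {v, w}" by (rule TT_I[of f g]) (use D n in auto)
  moreover have "TT {v, x}" by (rule TT_I[of h k]) (use D hk xy in auto)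
  ultimately show ?thesis using t unfolding center_def s by simp
qed

text \<open>A detour over the apex makes the 5-circuit a 6-circuit. The critical coincidence is
  \<open>w = d\<close>: then \<open>b c d\<close> bounds a face that shares two edges with
  \<open>P\<close>.\<close>

lemma triangle_pentagon:
  assumes T: "triangle_at a b w f" and P: "P \<in> F" "sz P = 5" "{a, b} \<in> bd P"
  shows False
proof -
  obtain c d e where p: "distinct [a, b, c, d, e]" "bd P = {{a, b}, {b, c}, {c, d}, {d, e}, {e, a}}" using face5[OF P] by metis
  have n: "P \<noteq> f" using P(2) triangle_atD(4)[OF T] by auto
  have pP: "{b, a} \<in> bd P" "{b, c} \<in> bd P" "{a, e} \<in> bd P" "{c, b} \<in> bd P" "{c, d} \<in> bd P" "{d, e} \<in> bd P"
    unfolding p(2) by (simp_all add: insert_commute)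
  have pa: "adj b c" "adj c d" "adj d e" "adj e a" using bd_adj[OF P(1)] pP adj_commute by metis+
  have "w \<noteq> e" using triangle_at_share[OF T P(1) n P(3)] pP by auto
  moreover have "w \<noteq> c"
    using triangle_at_share[OF triangle_at_commute[OF triangle_at_rotate[OF T]] P(1) n pP(1)] pP by auto
  moreover have "w \<noteq> d"
  proof
    assume "w = d"
    then have "adj b d" using triangle_at_adj[OF T] by simp
    then obtain m where m: "triangle_at c d b m" using clique_face[of c d b] pa adj_commute by metis
    have "m \<noteq> P" using triangle_atD(4)[OF m] P(2) by auto
    then show False using triangle_at_share[OF m P(1) _ pP(5)] pP(4) by auto
  qed
  ultimately have "distinct [a, w, b, c, d, e]" using p(1) triangle_atD(2)[OF T] by auto
  then show False using circuit6_adj[of a w b c d e] N pa triangle_at_adj[OF T] adj_commute by metis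
qed

end

text \<open>Degrees below four occur only in \<open>Z\<close>, which is too small. This excludes a
  wheel whose rim bounds a 4-face.\<close>

lemma four_deg3:
  assumes "distinct [a, b, c, d]" "{a, b, c, d} \<subseteq> V" "deg a = 3" "deg b = 3" "deg c = 3" "deg d = 3"
  shows False
proof -
  have "{a, b, c, d} \<subseteq> Z" using assms(2-) deg4 unfolding star_def by fastforce
  moreover have "finite Z" using ZV finV finite_subset by blast
  ultimately have "card {a, b, c, d} \<le> card Z" by (intro card_mono)
  then show False using assms(1) Z3 by simp
qed

lemma adj_V: "adj u v \<Longrightarrow> u \<in> V \<and> v \<in> V" using edge unfolding adj_def by blast

lemma face4_adj:
  assumes "q \<in> F" "sz q = 4" "{a, b} \<in> bd q"
  obtains c d where "distinct [a, b, c, d]" "bd q = {{a, b}, {b, c}, {c, d}, {d, a}}"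
    "{b, a} \<in> bd q" "{b, c} \<in> bd q" "{c, b} \<in> bd q" "{c, d} \<in> bd q" "{d, c} \<in> bd q" "{d, a} \<in> bd q" "{a, d} \<in> bd q"
    "adj b c" "adj c d" "adj d a"
proof -
  obtain c d where q: "distinct [a, b, c, d]" "bd q = {{a, b}, {b, c}, {c, d}, {d, a}}" using face4[OF assms] by metis
  have "{b, a} \<in> bd q" "{b, c} \<in> bd q" "{c, b} \<in> bd q" "{c, d} \<in> bd q" "{d, c} \<in> bd q" "{d, a} \<in> bd q" "{a, d} \<in> bd q"
    unfolding q(2) by (simp_all add: insert_commute)
  then show thesis using that[OF q] bd_adj[OF assms(1)] by blast
qed

lemma triangle_quad_distinct:
  assumes T: "triangle_at a b w f" and q: "q \<in> F" "q \<noteq> f" "{a, b} \<in> bd q" "{b, c} \<in> bd q" "{a, d} \<in> bd q"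
  shows "w \<noteq> c" "w \<noteq> d"
proof -
  have "{b, a} \<in> bd q" using q(3) by (simp add: insert_commute)
  then show "w \<noteq> c"
    using triangle_at_share[OF triangle_at_commute[OF triangle_at_rotate[OF T]] q(1,2)] q(4) by auto
  show "w \<noteq> d" using triangle_at_share[OF T q(1,2,3)] q(5) by auto
qed

section \<open>Faces of length four beside triangles and beside each other\<close>

context
  assumes N: "\<not> has_circuit V E 6"
begin

text \<open>Unless the 4-face passes through \<open>a\<close>, there is the 6-circuit
  \<open>a w c y z v\<close>. If it does, it closes up with the two triangles around
  \<open>v\<close>.\<close>

lemma quad_beside_diamond:
  assumes f: "triangle_at v w a f" and g: "triangle_at v w c g" and n: "f \<noteq> g"
    and q: "q \<in> F" "sz q = 4" "{v, c} \<in> bd q"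
  obtains y where "distinct [v, w, a, c, y]" "{v, a} \<in> bd q" "{c, y} \<in> bd q" "{a, y} \<in> bd q" "deg v = 3"
proof -
  note D = triangle_atD[OF f] triangle_atD[OF g]
  obtain y z where qq: "distinct [v, c, y, z]" "bd q = {{v, c}, {c, y}, {y, z}, {z, v}}"
    "{c, v} \<in> bd q" "{c, y} \<in> bd q" "{y, c} \<in> bd q" "{y, z} \<in> bd q" "{z, y} \<in> bd q" "{z, v} \<in> bd q" "{v, z} \<in> bd q"
    "adj c y" "adj y z" "adj z v" by (rule face4_adj[OF q])
  have ng: "q \<noteq> g" "q \<noteq> f" using q(2) D by auto
  have gc: "triangle_at v c w g" by (rule triangle_at_commute[OF g])
  have w: "w \<noteq> y" "w \<noteq> z" using triangle_quad_distinct[OF gc q(1) ng(1) q(3) qq(4) qq(9)] by auto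
  have ya: "y \<noteq> a" using diamond_not_adj[OF f g n] qq(10) adj_commute by metis
  note dd = diamond_distinct[OF f g n]
  have za: "z = a"
  proof (rule ccontr)
    assume "z \<noteq> a"
    then have "distinct [a, w, c, y, z, v]" using dd qq(1) w ya by auto
    then show False
      using circuit6_adj[of a w c y z v] N triangle_at_adj[OF f] triangle_at_adj[OF g] qq(10-12) adj_commute by metis
  qed
  have aw: "{v, w} \<in> bd f" "{v, w} \<in> bd g" "{v, a} \<in> bd f" "{v, c} \<in> bd g" using D by auto
  have ne: "a \<noteq> w" "w \<noteq> c" "a \<noteq> c" using dd by auto
  have "deg v = 3"
    using three_faces_closed(2)[OF D(1) D(8) q(1) n ng(1)[symmetric] ng(2)[symmetric] aw(3) aw(1) aw(2) aw(4) q(3) _ ne]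
      qq(9) za by simp
  then show thesis using that[of y] dd qq(1) w ya za qq(9,4,7) by auto
qed

text \<open>To avoid the 6-circuit \<open>a y c e w v\<close>, the next triangle has its apex on
  \<open>q\<close>. Then \<open>w\<close> is adjacent to all four vertices of \<open>q\<close>, and
  around each of these two triangles close up with \<open>q\<close>: four vertices of degree
  three.\<close>

lemma quad_beside_fan:
  assumes f: "triangle_at v w a f" and g: "triangle_at v w c g" and n: "f \<noteq> g"
    and q: "q \<in> F" "sz q = 4" "{v, c} \<in> bd q" and t: "TT {w, c}"
  shows False
proof -
  obtain y where y: "distinct [v, w, a, c, y]" "{v, a} \<in> bd q" "{c, y} \<in> bd q" "{a, y} \<in> bd q" "deg v = 3"
    by (rule quad_beside_diamond[OF f g n q])
  have gw: "triangle_at w c v g" by (rule triangle_at_rotate[OF g])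
  have fw: "triangle_at w v a f" by (rule triangle_at_commute[OF triangle_at_rotate[OF f]])
  obtain k e where k: "k \<noteq> g" "triangle_at w c e k" using TT_other[OF gw t] .
  have d1: "f \<noteq> k" "distinct [w, a, v, c, e]" using fan3[OF fw triangle_at_commute[OF gw] k(2) n k(1)[symmetric]] by auto
  note ad = triangle_at_adj[OF f] triangle_at_adj[OF g] triangle_at_adj[OF k(2)]
  have ay: "adj a y" "adj c y" using bd_adj[OF q(1)] y by auto
  have ye: "y = e"
  proof (rule ccontr)
    assume "y \<noteq> e"
    then have "distinct [a, y, c, e, w, v]" using d1 y(1) by auto
    then show False using circuit6_adj[of a y c e w v] N ad ay adj_commute by metis
  qed
  have "adj a w" "adj w e" "adj e a" using ad ay ye adj_commute by metis+
  then obtain m where m: "triangle_at a w e m" using clique_face by metis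
  have nq: "q \<noteq> f" "q \<noteq> g" "q \<noteq> k" "q \<noteq> m" using q(2) triangle_atD(4)[OF f] triangle_atD(4)[OF g] triangle_atD(4)[OF k(2)] triangle_atD(4)[OF m] by auto
  have gc: "triangle_at c v w g" by (rule triangle_at_rotate[OF gw])
  have kc: "triangle_at c w e k" by (rule triangle_at_commute[OF triangle_at_rotate[OF k(2)]])
  have fa: "triangle_at a v w f" by (rule triangle_at_rotate[OF triangle_at_rotate[OF f]])
  have ke: "triangle_at e c w k" by (rule triangle_at_rotate[OF triangle_at_rotate[OF kc]])
  have me: "triangle_at e w a m" by (rule triangle_at_commute[OF triangle_at_rotate[OF triangle_at_rotate[OF m]]])
  have qe: "{c, v} \<in> bd q" "{c, e} \<in> bd q" "{a, v} \<in> bd q" "{a, e} \<in> bd q" "{e, a} \<in> bd q" "{e, c} \<in> bd q"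
    using q(3) y ye by (simp_all add: insert_commute)
  have mf: "m \<noteq> f" using triangle_at_third[OF fa, of e] triangle_atD(6)[OF m] d1(2) by auto
  have mk: "m \<noteq> k" using triangle_at_third[OF ke, of a] triangle_atD(6)[OF me] d1(2) by auto
  have "deg c = 3"
    using three_faces_closed(2)[OF triangle_atD(1)[OF gc] triangle_atD(1)[OF kc] q(1) k(1)[symmetric] nq(3)[symmetric] nq(2)[symmetric]
      triangle_atD(5,6)[OF gc] triangle_atD(5,6)[OF kc] qe(2,1)] d1(2) by auto
  moreover have "deg a = 3"
    using three_faces_closed(2)[OF triangle_atD(1)[OF fa] triangle_atD(1)[OF m] q(1) mf[symmetric] nq(4)[symmetric] nq(1)[symmetric]
      triangle_atD(5,6)[OF fa] triangle_atD(5,6)[OF m] qe(4,3)] d1(2) by auto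
  moreover have "deg e = 3"
    using three_faces_closed(2)[OF triangle_atD(1)[OF ke] triangle_atD(1)[OF me] q(1) mk[symmetric] nq(4)[symmetric] nq(3)[symmetric]
      triangle_atD(5,6)[OF ke] triangle_atD(5,6)[OF me] qe(5,6)] d1(2) by auto
  ultimately show False
    using four_deg3[of v c a e] y(5) d1(2) ad adj_V by auto
qed

text \<open>Different apexes give the 6-circuit \<open>a w b x c d\<close>; with a common apex,
  \<open>{b, w}\<close> lies between the two triangles.\<close>

lemma quad_adjacent_triangles:
  assumes f: "triangle_at b a w f" and g: "triangle_at b c x g" and n: "f \<noteq> g"
    and q: "q \<in> F" "sz q = 4" "{b, a} \<in> bd q" "{b, c} \<in> bd q" and ac: "a \<noteq> c"
  shows "TT {b, w}"
proof -
  have qab: "{a, b} \<in> bd q" using q(3) by (simp add: insert_commute)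
  obtain c' d where qq: "distinct [a, b, c', d]" "bd q = {{a, b}, {b, c'}, {c', d}, {d, a}}"
    "{b, a} \<in> bd q" "{b, c'} \<in> bd q" "{c', b} \<in> bd q" "{c', d} \<in> bd q" "{d, c'} \<in> bd q" "{d, a} \<in> bd q" "{a, d} \<in> bd q"
    "adj b c'" "adj c' d" "adj d a" by (rule face4_adj[OF q(1,2) qab])
  have "c' = c" using bd_third[OF q(1,3,4) ac qq(4)] qq(1) by (auto simp: doubleton_eq_iff)
  have nq: "q \<noteq> f" "q \<noteq> g" using q(2) triangle_atD(4)[OF f] triangle_atD(4)[OF g] by auto
  have w: "w \<noteq> c" "w \<noteq> d" using triangle_quad_distinct[OF f q(1) nq(1) q(3) qq(9) q(4)] by auto
  have x: "x \<noteq> a" "x \<noteq> d" using triangle_quad_distinct[OF g q(1) nq(2) q(4) _ q(3)] qq(6) \<open>c' = c\<close> by auto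
  have "w = x"
  proof (rule ccontr)
    assume "w \<noteq> x"
    then have "distinct [a, w, b, x, c, d]"
      using w x qq(1) \<open>c' = c\<close> triangle_atD(2)[OF f] triangle_atD(2)[OF g] by auto
    then show False
      using circuit6_adj[of a w b x c d] N triangle_at_adj[OF f] triangle_at_adj[OF g] qq(11,12) \<open>c' = c\<close> adj_commute by metis
  qed
  then show ?thesis using TT_I[of f g "{b, w}"] triangle_atD[OF f] triangle_atD[OF g] n by auto
qed

text \<open>Different apexes give the 6-circuit \<open>a w b c x d\<close>. A common apex is
  adjacent to the whole 4-face, whose four sides then all border triangles, and again there are four
  vertices of degree three.\<close>

lemma quad_opposite_triangles:
  assumes f: "triangle_at a b w f" and g: "triangle_at c d x g" and n: "f \<noteq> g"
    and q: "q \<in> F" "distinct [a, b, c, d]" "bd q = {{a, b}, {b, c}, {c, d}, {d, a}}"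
  shows False
proof -
  have qe: "{a, b} \<in> bd q" "{b, a} \<in> bd q" "{b, c} \<in> bd q" "{c, b} \<in> bd q" "{c, d} \<in> bd q" "{d, c} \<in> bd q" "{d, a} \<in> bd q" "{a, d} \<in> bd q"
    unfolding q(3) by (simp_all add: insert_commute)
  have "sz q = 4" using q(2,3) by (auto simp: doubleton_eq_iff)
  then have n3: "q \<noteq> h" if "triangle_at u v y h" for u v y h using triangle_atD(4)[OF that] by auto
  have w: "w \<noteq> c" "w \<noteq> d" using triangle_quad_distinct[OF f q(1) n3[OF f] qe(1) qe(3) qe(8)] by auto
  have x: "x \<noteq> a" "x \<noteq> b" using triangle_quad_distinct[OF g q(1) n3[OF g] qe(5) qe(7) qe(4)] by auto
  note ad = triangle_at_adj[OF f] triangle_at_adj[OF g]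
  have qa: "adj b c" "adj d a" using bd_adj[OF q(1)] qe by auto
  have wx: "w = x"
  proof (rule ccontr)
    assume "w \<noteq> x"
    then have "distinct [a, w, b, c, x, d]"
      using w x q(2) triangle_atD(2)[OF f] triangle_atD(2)[OF g] by auto
    then show False using circuit6_adj[of a w b c x d] N ad qa adj_commute by metis
  qed
  obtain m where m: "triangle_at b w c m" using clique_face[of b w c] ad qa wx adj_commute by metis
  obtain m' where m': "triangle_at d w a m'" using clique_face[of d w a] ad qa wx adj_commute by metis
  have fa: "triangle_at a b w f" "triangle_at b a w f" using f triangle_at_commute triangle_at_rotate by metis+
  have gc: "triangle_at c d w g" "triangle_at d c w g" using g wx triangle_at_commute triangle_at_rotate by metis+
  have mb: "triangle_at c b w m" "triangle_at b c w m" using m triangle_at_commute triangle_at_rotate by metis+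
  have ma: "triangle_at a d w m'" "triangle_at d a w m'" using m' triangle_at_commute triangle_at_rotate by metis+
  have d3: "deg p = 3" if p: "triangle_at p r w h" "triangle_at p s w k" "{p, r} \<in> bd q" "{p, s} \<in> bd q" "r \<noteq> s" for p r s h k
  proof -
    have "h \<noteq> k" using triangle_at_third[OF p(1), of s] triangle_atD(5)[OF p(2)] triangle_atD(2)[OF p(2)] p(5) by auto
    have nn: "r \<noteq> w" "w \<noteq> s" using triangle_atD(2)[OF p(1)] triangle_atD(2)[OF p(2)] by auto
    show ?thesis
      using three_faces_closed(2)[OF triangle_atD(1)[OF p(1)] triangle_atD(1)[OF p(2)] q(1) \<open>h \<noteq> k\<close> n3[OF p(2), symmetric] n3[OF p(1), symmetric]
        triangle_atD(5,6)[OF p(1)] triangle_atD(6,5)[OF p(2)] p(4,3) nn p(5)] .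
  qed
  have "deg a = 3" using d3[OF fa(1) ma(1) qe(1) qe(8)] q(2) by auto
  moreover have "deg b = 3" using d3[OF fa(2) mb(2) qe(2) qe(3)] q(2) by auto
  moreover have "deg c = 3" using d3[OF gc(1) mb(1) qe(5) qe(4)] q(2) by auto
  moreover have "deg d = 3" using d3[OF gc(2) ma(2) qe(6) qe(7)] q(2) by auto
  ultimately show False using four_deg3[OF q(2)] ad adj_V by auto
qed

text \<open>A second triangle on an adjacent side of \<open>q\<close> would make
  \<open>{a, w}\<close> or \<open>{b, w}\<close> a \<open>TT\<close> edge, and one on the opposite
  side is impossible.\<close>

lemma quad_single_triangle:
  assumes f: "triangle_at a b w f" and q: "q \<in> F" "sz q = 4" "{a, b} \<in> bd q" and t: "\<not> TT {a, w}" "\<not> TT {b, w}"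
  shows "{e \<in> bd q. tedge e} = {{a, b}}"
proof -
  obtain c d where qq: "distinct [a, b, c, d]" "bd q = {{a, b}, {b, c}, {c, d}, {d, a}}"
    "{b, a} \<in> bd q" "{b, c} \<in> bd q" "{c, b} \<in> bd q" "{c, d} \<in> bd q" "{d, c} \<in> bd q" "{d, a} \<in> bd q" "{a, d} \<in> bd q"
    "adj b c" "adj c d" "adj d a" by (rule face4_adj[OF q])
  have nq: "q \<noteq> f" using q(2) triangle_atD(4)[OF f] by auto
  have fb: "triangle_at b a w f" by (rule triangle_at_commute[OF triangle_at_rotate[OF f]])
  have w: "w \<noteq> c" "w \<noteq> d" using triangle_quad_distinct[OF f q(1) nq q(3) qq(4,9)] by auto
  have "\<not> tedge {b, c}"
  proof
    assume "tedge {b, c}"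
    then obtain g where g: "g \<in> F" "{b, c} \<in> bd g" "sz g = 3" by (auto simp: tedge_def)
    obtain x where x: "triangle_at b c x g" using triangle_at_edge g(1,3,2) by metis
    have "f \<noteq> g" using triangle_at_third[OF fb, of c] g(2) qq(1) w by auto
    then have "TT {b, w}" using quad_adjacent_triangles[OF fb x _ q(1,2) qq(3,4)] qq(1) by auto
    then show False using t by simp
  qed
  moreover have "\<not> tedge {d, a}"
  proof
    assume "tedge {d, a}"
    then obtain g where g: "g \<in> F" "{a, d} \<in> bd g" "sz g = 3" by (auto simp: tedge_def insert_commute)
    obtain x where x: "triangle_at a d x g" using triangle_at_edge g(1,3,2) by metis
    have "f \<noteq> g" using triangle_at_third[OF f, of d] g(2) qq(1) w by auto
    then have "TT {a, w}" using quad_adjacent_triangles[OF f x _ q(1,2,3) qq(9)] qq(1) by auto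
    then show False using t by simp
  qed
  moreover have "\<not> tedge {c, d}"
  proof
    assume "tedge {c, d}"
    then obtain g where g: "g \<in> F" "{c, d} \<in> bd g" "sz g = 3" by (auto simp: tedge_def)
    obtain x where x: "triangle_at c d x g" using triangle_at_edge g(1,3,2) by metis
    have "f \<noteq> g"
    proof
      assume "f = g"
      then have "{c, d} \<in> {{a, b}, {b, w}, {w, a}}" using g(2) triangle_atD(3)[OF f] by simp
      then show False using qq(1) by (auto simp: doubleton_eq_iff)
    qed
    then show False using quad_opposite_triangles[OF f x _ q(1) qq(1,2)] by blast
  qed
  moreover have "tedge {a, b}" using triangle_atD[OF f] unfolding tedge_def by blast
  ultimately show ?thesis unfolding qq(2) by blast
qed

text \<open>The two boundaries without \<open>{a, b}\<close> form the 6-circuit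
  \<open>b c d a y x\<close>, unless vertices coincide. \<open>x = c\<close> or \<open>y = d\<close>
  leaves an end of the edge degree two; a crosswise coincidence gives a facial triangle, which would
  be a third face at \<open>{a, b}\<close>.\<close>

lemma quad_quad:
  assumes q: "q \<in> F" "sz q = 4" "r \<in> F" "sz r = 4" "q \<noteq> r" "e \<in> bd q" "e \<in> bd r"
  shows "\<exists>z\<in>\<Union>(bd q). deg z = 2"
proof -
  obtain a b where e: "e = {a, b}" using edge[OF bdE[OF q(1,6)]] by (metis card_2_iff)
  have ab: "{a, b} \<in> bd q" "{a, b} \<in> bd r" using q e by auto
  obtain c d where 1: "distinct [a, b, c, d]" "bd q = {{a, b}, {b, c}, {c, d}, {d, a}}"
    "{b, a} \<in> bd q" "{b, c} \<in> bd q" "{c, b} \<in> bd q" "{c, d} \<in> bd q" "{d, c} \<in> bd q" "{d, a} \<in> bd q" "{a, d} \<in> bd q"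
    "adj b c" "adj c d" "adj d a" by (rule face4_adj[OF q(1,2) ab(1)])
  obtain x y where 2: "distinct [a, b, x, y]" "bd r = {{a, b}, {b, x}, {x, y}, {y, a}}"
    "{b, a} \<in> bd r" "{b, x} \<in> bd r" "{x, b} \<in> bd r" "{x, y} \<in> bd r" "{y, x} \<in> bd r" "{y, a} \<in> bd r" "{a, y} \<in> bd r"
    "adj b x" "adj x y" "adj y a" by (rule face4_adj[OF q(3,4) ab(2)])
  have abV: "a \<in> \<Union>(bd q)" "b \<in> \<Union>(bd q)" using ab(1) by blast+
  have tri: False if c: "adj a z" "adj b z" for z
  proof -
    have "adj a b" using bd_adj[OF q(1) ab(1)] .
    then obtain m where m: "triangle_at a b z m" using clique_face[of a b z] c adj_commute by metis
    have "m = q \<or> m = r" using faces_of_D[OF ab q(1,3,5) triangle_atD(1)[OF m] triangle_atD(5)[OF m]] .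
    then show False using triangle_atD(4)[OF m] q(2,4) by auto
  qed
  consider "x = c" | "y = d" | "x = d" | "y = c" | "distinct [b, c, d, a, y, x]" using 1(1) 2(1) by auto
  then show ?thesis
  proof cases
    case 1
    then have "deg b = 2"
      using two_faces_closed(2)[OF q(1,3,5), of b a c] \<open>{b, a} \<in> bd q\<close> \<open>{b, c} \<in> bd q\<close> 2(3,4) \<open>distinct [a, b, c, d]\<close> by auto
    then show ?thesis using abV by blast
  next
    case 2
    then have "deg a = 2"
      using two_faces_closed(2)[OF q(1,3,5), of a b d] ab \<open>{a, d} \<in> bd q\<close> \<open>{a, y} \<in> bd r\<close> \<open>distinct [a, b, c, d]\<close> by auto
    then show ?thesis using abV by blast
  next
    case 3
    then show ?thesis using tri[of d] \<open>adj d a\<close> \<open>adj b x\<close> adj_commute by metis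
  next
    case 4
    then show ?thesis using tri[of c] \<open>adj b c\<close> \<open>adj y a\<close> adj_commute by metis
  next
    case 5
    then show ?thesis using circuit6_adj[of b c d a y x] N 1 2 adj_commute by metis
  qed
qed

end

section \<open>Transfers of charge for circuits of length six\<close>

definition diamond :: bool where
  "diamond \<longleftrightarrow> (\<exists>v w a c. distinct [v, w, a, c] \<and> (\<forall>u\<in>{v, w, a, c}. small u) \<and>
     adj v w \<and> adj v a \<and> adj v c \<and> adj w a \<and> adj w c \<and> \<not> adj a c)"

text \<open>The two triangles at \<open>e\<close> form a maximal run of triangles around \<open>v\<close>.\<close>

definition iso :: "'a \<Rightarrow> 'a set \<Rightarrow> bool" where
  "iso v e \<longleftrightarrow> TT e \<and> (\<forall>f\<in>F. e \<in> bd f \<longrightarrow> (\<forall>e'\<in>bd f. v \<in> e' \<longrightarrow> e' \<noteq> e \<longrightarrow> \<not> TT e'))"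

text \<open>A small vertex recovers 3/7 from the edge opposite to \<open>e\<close>, which lies
  between two faces of length at least seven. Any other vertex pays 1 per edge, in total at most a
  third of its degree by \<open>iso_count\<close>.\<close>

definition gift :: "'a \<Rightarrow> 'a set \<Rightarrow> real" where
  "gift v e = (if iso v e then if small v then 3 / 7 else 1 else 0)"

definition TT_count :: "'f \<Rightarrow> nat" where "TT_count f = card {e \<in> bd f. TT e}"

text \<open>What an edge between two triangles hands on to its side \<open>f\<close>. Around the hub of a wheel of four triangles the
  rim vertices need not send enough; one of them is not small, and the hub redistributes its surplus.\<close>

definition share :: "'f \<Rightarrow> 'a set \<Rightarrow> real" where
  "share f e = (if \<exists>v\<in>e. center v then 2 / 7 else if \<forall>v\<in>e. iso v e then (\<Sum>v\<in>e. gift v e) / 2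
     else if TT_count f = 1 then 1 / 7 else 2 / 7)"

text \<open>For such a 4-face, three other sides that bring in 1/5 each add up to the 3/5 forwarded
  to the triangle.\<close>

definition single :: "'f \<Rightarrow> bool" where "single q \<longleftrightarrow> card {e \<in> bd q. tedge e} = 1"

text \<open>Each edge carries charge to an adjacent triangle; a 4-face forwards all it gets to its only adjacent triangle.\<close>

definition give :: "'f \<Rightarrow> 'a set \<Rightarrow> real" where
  "give f e = (if 7 \<le> sz f then 3 / 7 else if sz f = 5 then 1 / 5
     else if sz f = 4 then if sz (opp f e) = 3 then if single f then 3 / 5 else 0
       else if 5 \<le> sz (opp f e) then - 1 / 5 else 0
     else if 7 \<le> sz (opp f e) then - 3 / 7
     else if sz (opp f e) = 4 then if single (opp f e) then - 3 / 5 else 0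
     else - share f e)"

text \<open>An edge between two faces of length at least seven collects 3/7 from each and passes 3/7
  to each end. A spoke of a wheel owes 2/7 to each of its two triangles; the gift of the rim vertex
  goes towards these 4/7, and the hub takes or pays the difference.\<close>

definition pass :: "'a set \<Rightarrow> 'a \<Rightarrow> real" where
  "pass e v = (if TT e then if center v then (\<Sum>u\<in>e - {v}. gift u e) - 4 / 7 else - gift v e
     else if \<forall>f\<in>F. e \<in> bd f \<longrightarrow> 7 \<le> sz f then 3 / 7 else 0)"

lemma gift_bounds: "0 \<le> gift v e" "gift v e \<le> 1" by (simp_all add: gift_def)

lemma gift_iso: "iso v e \<Longrightarrow> 3 / 7 \<le> gift v e" by (simp add: gift_def)

lemma triangle_at_star:
  assumes "triangle_at v a b f" "e \<in> bd f" "v \<in> e"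
  shows "e = {v, a} \<or> e = {v, b}"
proof -
  have "a \<noteq> b" using triangle_atD(2)[OF assms(1)] by auto
  then show ?thesis
    by (rule bd_third[OF triangle_atD(1)[OF assms(1)] triangle_atD(5,6)[OF assms(1)] _ assms(2,3)])
qed

lemma iso_iff:
  assumes f: "triangle_at v w a f" and g: "triangle_at v w c g" and n: "f \<noteq> g"
  shows "iso v {v, w} \<longleftrightarrow> \<not> TT {v, a} \<and> \<not> TT {v, c}"
proof -
  note D = triangle_atD[OF f] triangle_atD[OF g]
  have tt: "TT {v, w}" by (rule TT_I[of f g]) (use D n in auto)
  have ne: "{v, a} \<noteq> {v, w}" "{v, c} \<noteq> {v, w}" using D by (auto simp: doubleton_eq_iff)
  show ?thesis
  proof
    assume "iso v {v, w}"
    then have i: "\<And>h e'. h \<in> F \<Longrightarrow> {v, w} \<in> bd h \<Longrightarrow> e' \<in> bd h \<Longrightarrow> v \<in> e' \<Longrightarrow> e' \<noteq> {v, w} \<Longrightarrow> \<not> TT e'"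
      unfolding iso_def by blast
    have v: "v \<in> {v, a}" "v \<in> {v, c}" by auto
    show "\<not> TT {v, a} \<and> \<not> TT {v, c}"
      using i[OF D(1,5,6) v(1) ne(1)] i[OF D(8,12,13) v(2) ne(2)] by blast
  next
    assume r: "\<not> TT {v, a} \<and> \<not> TT {v, c}"
    show "iso v {v, w}" unfolding iso_def
    proof (intro conjI ballI impI tt)
      fix h e' assume h: "h \<in> F" "{v, w} \<in> bd h" "e' \<in> bd h" "v \<in> e'" "e' \<noteq> {v, w}"
      have "h = f \<or> h = g" by (rule faces_of_D[OF D(5,12,1,8) n h(1,2)])
      then have "e' = {v, a} \<or> e' = {v, c}"
        using triangle_at_star[OF f _ h(4)] triangle_at_star[OF g _ h(4)] h(3,5) by blast
      then show "\<not> TT e'" using r by auto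
    qed
  qed
qed

lemma TT_count_eq:
  assumes f: "triangle_at v a b f" and t: "TT {v, a}"
  shows "TT_count f = 1 + of_bool (TT {v, b}) + of_bool (TT {a, b})"
proof -
  note D = triangle_atD[OF f]
  have bv: "{b, v} = {v, b}" by (rule insert_commute)
  have ne: "{v, a} \<noteq> {v, b}" "{v, a} \<noteq> {a, b}" "{a, b} \<noteq> {v, b}" using D(2) by (auto simp: doubleton_eq_iff)
  have "{e \<in> bd f. TT e} = {{v, a}} \<union> (if TT {v, b} then {{v, b}} else {}) \<union> (if TT {a, b} then {{a, b}} else {})"
    unfolding D(3) bv using t by auto
  then show ?thesis unfolding TT_count_def using ne by (simp split: if_splits)
qed

lemma TT_ends:
  assumes "TT e"
  obtains v w where "e = {v, w}" "v \<noteq> w"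
  using assms edge unfolding TT_def by (metis card_2_iff)

text \<open>Each such edge claims itself and its two neighbours around \<open>v\<close>. An edge
  claimed twice would lie between two triangles, contrary to \<open>iso\<close>.\<close>

lemma iso_count: "3 * card {e \<in> star v. iso v e} \<le> deg v"
proof -
  let ?I = "{e \<in> star v. iso v e}"
  define M where "M e = {e' \<in> star v. \<exists>f\<in>F. e \<in> bd f \<and> e' \<in> bd f}" for e
  have M3: "card (M e) = 3" if e: "e \<in> ?I" for e
  proof -
    obtain w where w: "e = {v, w}" using e star_obtain[of e v] by blast
    have "TT {v, w}" using e w by (simp add: iso_def)
    then obtain f g a c where f: "f \<noteq> g" "triangle_at v w a f" "triangle_at v w c g" by (rule TT_triangles)
    note D = triangle_atD[OF f(2)] triangle_atD[OF f(3)] and dd = diamond_distinct[OF f(2,3,1)]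
    have "M e = {{v, w}, {v, a}, {v, c}}"
    proof
      show "{{v, w}, {v, a}, {v, c}} \<subseteq> M e"
      proof -
        have "{v, w} \<in> E" "{v, a} \<in> E" "{v, c} \<in> E"
          using triangle_at_adj[OF f(2)] triangle_at_adj[OF f(3)] by (auto simp: adj_def)
        moreover have "{v, w} \<in> bd f" "{v, a} \<in> bd f" "{v, w} \<in> bd g" "{v, c} \<in> bd g" "f \<in> F" "g \<in> F" using D by auto
        ultimately show ?thesis unfolding M_def w star_def by blast
      qed
      show "M e \<subseteq> {{v, w}, {v, a}, {v, c}}"
      proof
        fix e' assume "e' \<in> M e"
        then obtain h where h: "h \<in> F" "{v, w} \<in> bd h" "e' \<in> bd h" "v \<in> e'" by (auto simp: M_def w star_def)
        have "h = f \<or> h = g" by (rule faces_of_D[OF D(5,12,1,8) f(1) h(1,2)])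
        then show "e' \<in> {{v, w}, {v, a}, {v, c}}"
          using triangle_at_star[OF f(2) _ h(4)] triangle_at_star[OF f(3) _ h(4)] h(3) by blast
      qed
    qed
    then show ?thesis using dd by (auto simp: doubleton_eq_iff)
  qed
  have dis: "M e1 \<inter> M e2 = {}" if e: "e1 \<in> ?I" "e2 \<in> ?I" "e1 \<noteq> e2" for e1 e2
  proof (rule ccontr)
    assume "\<not> ?thesis"
    then obtain e' f1 f2 where x: "e' \<in> star v" "f1 \<in> F" "e1 \<in> bd f1" "e' \<in> bd f1" "f2 \<in> F" "e2 \<in> bd f2" "e' \<in> bd f2"
      unfolding M_def by blast
    have i: "iso v e1" "iso v e2" "v \<in> e1" "v \<in> e2" "v \<in> e'" using e x(1) by (auto simp: star_def)
    then have t: "TT e1" "TT e2" by (auto simp: iso_def)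
    have n: "e' \<noteq> e1" "e' \<noteq> e2" using i t x e(3) unfolding iso_def by blast+
    then have "\<not> TT e'" using i x unfolding iso_def by blast
    moreover have "f1 \<noteq> f2" using i t x e(3) unfolding iso_def by blast
    moreover have "sz f1 = 3" "sz f2 = 3" using t x unfolding TT_def by blast+
    ultimately show False using TT_I[OF x(2,5) _ x(4,7)] by blast
  qed
  have "3 * card ?I = (\<Sum>e\<in>?I. card (M e))" using M3 by simp
  also have "\<dots> = card (\<Union>e\<in>?I. M e)"
    by (rule card_UN_disjoint[symmetric]) (use dis in \<open>auto simp: M_def\<close>)
  also have "\<dots> \<le> deg v" by (rule card_mono[OF fin_star]) (auto simp: M_def)
  finally show ?thesis .
qed

context
  assumes N: "\<not> has_circuit V E 6" and H: "\<not> diamond"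
begin

text \<open>If \<open>iso\<close> fails at both ends, the further \<open>TT\<close> edges belong to
  one triangle, which then has three \<open>TT\<close> sides, or to different ones, which gives a
  zigzag of four triangles.\<close>

lemma iso_some:
  assumes "TT {v, w}"
  shows "iso v {v, w} \<or> iso w {v, w}"
proof -
  obtain f g a c where f: "f \<noteq> g" "triangle_at v w a f" "triangle_at v w c g" using TT_triangles[OF assms] .
  have fw: "triangle_at w v a f" "triangle_at w v c g" using f(2,3) triangle_at_commute triangle_at_rotate by metis+
  have iw: "iso w {v, w} \<longleftrightarrow> \<not> TT {w, a} \<and> \<not> TT {w, c}" using iso_iff[OF fw f(1)] by (simp add: insert_commute)
  show ?thesis
    using iso_iff[OF f(2,3,1)] iw not_three_TT[OF N f(2) assms] not_three_TT[OF N f(3) assms]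
      no_strip[OF N f(2,3,1)] no_strip[OF N f(3,2) f(1)[symmetric]] by blast
qed

lemma center_iso:
  assumes c: "center v" and e: "{v, w} \<in> star v"
  shows "TT {v, w}" "iso w {v, w}"
proof -
  show t: "TT {v, w}" using c e by (simp add: center_def)
  obtain f g a c' where f: "f \<noteq> g" "triangle_at v w a f" "triangle_at v w c' g" using TT_triangles[OF t] .
  have "{v, a} \<in> star v" using triangle_at_adj[OF f(2)] by (simp add: in_star adj_def)
  then have "TT {v, a}" using c by (simp add: center_def)
  then have "\<not> iso v {v, w}" using iso_iff[OF f(2,3,1)] by blast
  then show "iso w {v, w}" using iso_some[OF t] by blast
qed

text \<open>Exactly one of the two triangles has a second \<open>TT\<close> side; other patterns
  give a wheel, a triangle with three such sides, or a zigzag. So the shares are 1/7 and 2/7, and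
  the gift from the \<open>iso\<close> end, at least 3/7, pays for both.\<close>

lemma share_pair:
  assumes t: "TT {v, w}" and f: "f \<noteq> g" "triangle_at v w a f" "triangle_at v w c g"
    and c: "\<not> center v" "\<not> center w" and i: "\<not> iso v {v, w}"
  shows "share f {v, w} + share g {v, w} = 3 / 7"
proof -
  have "TT {v, a} \<or> TT {v, c}" using iso_iff[OF f(2,3,1)] i by blast
  moreover have "\<not> (TT {v, a} \<and> TT {v, c})" using fan4_center[OF N f(2,3,1)] c(1) by blast
  moreover have "\<not> (TT {v, a} \<and> TT {w, a})" "\<not> (TT {v, c} \<and> TT {w, c})"
    using not_three_TT[OF N f(2) t] not_three_TT[OF N f(3) t] by blast+
  moreover have "\<not> (TT {v, a} \<and> TT {w, c})" "\<not> (TT {v, c} \<and> TT {w, a})"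
    using no_strip[OF N f(2,3,1)] no_strip[OF N f(3,2) f(1)[symmetric]] by blast+
  ultimately have "TT_count f = 1 \<and> TT_count g = 2 \<or> TT_count f = 2 \<and> TT_count g = 1"
    using TT_count_eq[OF f(2) t] TT_count_eq[OF f(3) t] by auto
  then show ?thesis using c i by (auto simp: share_def)
qed

lemma sizes: "f \<in> F \<Longrightarrow> sz f = 3 \<or> sz f = 4 \<or> sz f = 5 \<or> 7 \<le> sz f"
  using sz_ge_3[of f] sz_neq[OF N, of f] by linarith

lemma triangle_pentagon':
  assumes "f \<in> F" "sz f = 3" "g \<in> F" "sz g = 5" "e \<in> bd f" "e \<in> bd g"
  shows False
proof -
  obtain a b where e: "e = {a, b}" using edge[OF bdE[OF assms(1,5)]] by (metis card_2_iff)
  obtain w where "triangle_at a b w f" using triangle_at_edge assms(1,2,5) e by metis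
  then show False using triangle_pentagon[OF N] assms(3,4,6) e by blast
qed

lemma edge_charge:
  assumes e: "e \<in> E"
  shows "0 \<le> (\<Sum>f | f \<in> F \<and> e \<in> bd f. give f e) - (\<Sum>v\<in>e. pass e v)"
proof (cases "TT e")
  case True
  obtain v w where vw: "e = {v, w}" "v \<noteq> w" by (rule TT_ends[OF True])
  have t: "TT {v, w}" using True vw by simp
  obtain f g a c where f: "f \<noteq> g" "triangle_at v w a f" "triangle_at v w c g" using TT_triangles[OF t] .
  note D = triangle_atD[OF f(2)] triangle_atD[OF f(3)]
  have fs: "{h \<in> F. e \<in> bd h} = {f, g}" unfolding vw(1) by (rule faces_of) (use D f in auto)
  have o: "opp f e = g" "opp g e = f" unfolding vw(1) by (rule oppI; use D f in auto)+
  have gv: "give f e = - share f e" "give g e = - share g e" using o D by (auto simp: give_def)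
  have sum: "(\<Sum>f | f \<in> F \<and> e \<in> bd f. give f e) = - share f e - share g e" using fs f(1) gv by simp
  have em: "e - {v} = {w}" "e - {w} = {v}" using vw by auto
  have nb: "\<not> (center v \<and> center w)"
  proof
    assume c: "center v \<and> center w"
    have "{v, a} \<in> star v" "{w, a} \<in> star w" using triangle_at_adj[OF f(2)] by (auto simp: in_star adj_def)
    then have "TT {v, a}" "TT {w, a}" using c by (auto simp: center_def)
    then show False using not_three_TT[OF N f(2) t] by blast
  qed
  have s2: "(\<Sum>u\<in>e. pass e u) = pass e v + pass e w" using vw by simp
  consider "center v \<or> center w" | "\<not> center v" "\<not> center w" "iso v e" "iso w e"
    | "\<not> center v" "\<not> center w" "\<not> iso v e" | "\<not> center v" "\<not> center w" "\<not> iso w e" by blast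
  then show ?thesis
  proof cases
    \<comment> \<open>On a spoke the gift of the rim end cancels, leaving exactly 4/7 for the two
      shares. Both ends cannot be hubs, since a triangle would have three \<open>TT\<close>
      sides.\<close>
    case 1
    then have "share f e = 2 / 7" "share g e = 2 / 7" using vw(1) by (auto simp: share_def)
    moreover have "pass e v + pass e w = - 4 / 7" using 1 nb em True by (auto simp: pass_def)
    ultimately show ?thesis unfolding sum s2 by simp
  next
    case 2
    then have "share f e = (gift v e + gift w e) / 2" "share g e = (gift v e + gift w e) / 2"
      using vw by (auto simp: share_def)
    moreover have "pass e v + pass e w = - gift v e - gift w e" using 2 True by (simp add: pass_def)
    ultimately show ?thesis unfolding sum s2 by simp
  next
    case 3
    then have "iso w e" using iso_some[OF t] vw by simp
    have "share f e + share g e = 3 / 7" using share_pair[OF t f 3(1,2)] 3(3) vw(1) by simp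
    moreover have "pass e v + pass e w \<le> - 3 / 7"
      using 3 True gift_iso[OF \<open>iso w e\<close>] gift_bounds(1)[of v e] by (simp add: pass_def)
    ultimately show ?thesis unfolding sum s2 by simp
  next
    case 4
    then have "iso v e" using iso_some[OF t] vw by simp
    have fw: "triangle_at w v a f" "triangle_at w v c g" using f(2,3) triangle_at_commute triangle_at_rotate by metis+
    have wv: "{w, v} = e" using vw(1) by auto
    have "share f e + share g e = 3 / 7" using share_pair[of w v f g a c] t f(1) fw 4 unfolding wv vw(1)[symmetric] by simp
    moreover have "pass e v + pass e w \<le> - 3 / 7"
      using 4 True gift_iso[OF \<open>iso v e\<close>] gift_bounds(1)[of w e] by (simp add: pass_def)
    ultimately show ?thesis unfolding sum s2 by simp
  qed
next
  case False
  obtain f g where fg: "f \<in> F" "g \<in> F" "f \<noteq> g" "e \<in> bd f" "e \<in> bd g" "{h \<in> F. e \<in> bd h} = {f, g}"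
    by (rule edge_faces[OF e])
  have o: "opp f e = g" "opp g e = f" using oppI fg by metis+
  have all: "(\<forall>h\<in>F. e \<in> bd h \<longrightarrow> 7 \<le> sz h) \<longleftrightarrow> 7 \<le> sz f \<and> 7 \<le> sz g"
  proof -
    have "(\<forall>h\<in>F. e \<in> bd h \<longrightarrow> 7 \<le> sz h) \<longleftrightarrow> (\<forall>h\<in>{h \<in> F. e \<in> bd h}. 7 \<le> sz h)" by auto
    then show ?thesis unfolding fg(6) by simp
  qed
  have p: "(\<Sum>u\<in>e. pass e u) = (if 7 \<le> sz f \<and> 7 \<le> sz g then 6 / 7 else 0)"
    using False all edge[OF e] by (simp add: pass_def)
  have n: "\<not> (sz f = 3 \<and> sz g = 3)" using TT_I[OF fg(1-5)] False by blast
  have n5: "\<not> (sz f = 3 \<and> sz g = 5)" "\<not> (sz f = 5 \<and> sz g = 3)"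
    using triangle_pentagon'[OF fg(1) _ fg(2) _ fg(4,5)] triangle_pentagon'[OF fg(2) _ fg(1) _ fg(5,4)] by blast+
  have s: "(\<Sum>f | f \<in> F \<and> e \<in> bd f. give f e) = give f e + give g e" using fg(3,6) by simp
  show ?thesis unfolding s p
    using sizes[OF fg(1)] sizes[OF fg(2)] n n5 by (elim disjE) (simp_all add: give_def o)
qed

lemma triangle_side:
  assumes f: "triangle_at a b w f" and t: "\<not> TT {a, b}"
  shows "7 \<le> sz (opp f {a, b}) \<and> give f {a, b} = - 3 / 7 \<or> sz (opp f {a, b}) = 4 \<and> give f {a, b} \<le> 0"
proof -
  note D = triangle_atD[OF f]
  have o: "opp f {a, b} \<in> F" "opp f {a, b} \<noteq> f" "{a, b} \<in> bd (opp f {a, b})" using opp[OF D(1,5)] by auto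
  have "sz (opp f {a, b}) \<noteq> 3" using TT_I[OF D(1) o(1) o(2)[symmetric] D(5) o(3) D(4)] t by blast
  moreover have "sz (opp f {a, b}) \<noteq> 5" using triangle_pentagon[OF N f o(1) _ o(3)] by blast
  ultimately have "sz (opp f {a, b}) = 4 \<or> 7 \<le> sz (opp f {a, b})" using sizes[OF o(1)] by blast
  then show ?thesis using D(4) by (auto simp: give_def)
qed

text \<open>A side towards a face of length at least seven brings 3/7. With none, one or two
  \<open>TT\<close> sides the sums are at least 9/7, 1/7 + 6/7 and 2/7 + 2/7 + 3/7; three are
  impossible. If a 4-face is adjacent, it forwards 3/5 in the first case, is compensated by larger
  gifts in the second, and is excluded in the third.\<close>

lemma triangle_charge:
  assumes f: "f \<in> F" "sz f = 3"
  shows "(\<Sum>e\<in>bd f. give f e) \<le> - 1"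
proof -
  have sum: "(\<Sum>e\<in>bd f. give f e) = give f {v, a} + give f {a, b} + give f {v, b}" if t: "triangle_at v a b f" for v a b
  proof -
    note D = triangle_atD[OF t]
    have ne: "{v, a} \<notin> {{a, b}, {v, b}}" "{a, b} \<notin> {{v, b}}" using D(2) by (auto simp: doubleton_eq_iff)
    have "bd f = {{v, a}, {a, b}, {v, b}}" unfolding D(3) by (simp add: insert_commute[of b v "{}"])
    then show ?thesis using ne by simp
  qed
  obtain v where "v \<in> \<Union>(bd f)" using is_circuit_two_vertices cycF[OF f(1)] by metis
  then obtain a b where t: "triangle_at v a b f" using triangle_atI[OF f] by metis
  have none: ?thesis if t: "triangle_at v a b f" and n: "\<not> TT {v, a}" "\<not> TT {a, b}" "\<not> TT {v, b}" for v a b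
  proof -
    have side: "give f {x, y} \<le> - 3 / 7" if s: "triangle_at x y z f" and m: "\<not> TT {x, y}" "\<not> TT {x, z}" "\<not> TT {y, z}" for x y z
    proof -
      note D = triangle_atD[OF s]
      have o: "opp f {x, y} \<in> F" "{x, y} \<in> bd (opp f {x, y})" using opp[OF D(1,5)] by auto
      show ?thesis
      proof (cases "sz (opp f {x, y}) = 4")
        case True
        then have "{e \<in> bd (opp f {x, y}). tedge e} = {{x, y}}" using quad_single_triangle[OF N s o(1) _ o(2) m(2,3)] by simp
        then have "single (opp f {x, y})" by (simp add: single_def)
        then show ?thesis using True D(4) by (simp add: give_def)
      next
        case False
        then show ?thesis using triangle_side[OF s m(1)] by auto
      qed
    qed
    have t2: "triangle_at a b v f" "triangle_at v b a f" using t triangle_at_commute triangle_at_rotate by metis+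
    show ?thesis using sum[OF t] side[OF t n(1,3,2)] side[OF t2(1)] side[OF t2(2) n(3,1)] n by (simp add: insert_commute)
  qed
  have one: ?thesis if t: "triangle_at v w a f" and n: "TT {v, w}" "\<not> TT {v, a}" "\<not> TT {w, a}" for v w a
  proof -
    obtain g c where g: "g \<noteq> f" "triangle_at v w c g" using TT_other[OF t n(1)] .
    have tw: "triangle_at w v a f" "triangle_at w v c g" using t g(2) triangle_at_commute triangle_at_rotate by metis+
    have wv: "{w, v} = {v, w}" by auto
    have o: "opp f {v, w} = g" by (rule oppI) (use triangle_atD[OF t] triangle_atD[OF g(2)] g(1) in auto)
    have gs: "give f {v, w} = - share f {v, w}" using o f(2) triangle_atD(4)[OF g(2)] by (simp add: give_def)
    \<comment> \<open>The 4-face forces degree three at \<open>x\<close>, which is thus not small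
      and gives 1. Both ends are \<open>iso\<close>, so the share is at least 5/7, to which the
      other side adds 3/7; with 4-faces on both sides the share is 1.\<close>
    have quad: "iso x {x, y} \<and> iso y {x, y} \<and> gift x {x, y} = 1"
      if tx: "triangle_at x y a f" "triangle_at x y c g" and q: "sz (opp f {x, a}) = 4" for x y
    proof -
      have q': "opp f {x, a} \<in> F" "{x, a} \<in> bd (opp f {x, a})" using opp[OF triangle_atD(1,6)[OF tx(1)]] by auto
      obtain z where z: "{x, c} \<in> bd (opp f {x, a})" "deg x = 3" using quad_beside_diamond[OF N tx(2,1) g(1) q'(1) q q'(2)] by metis
      have na: "\<not> TT {y, a}" using quad_beside_fan[OF N tx(2,1) g(1) q'(1) q q'(2)] by blast
      have nc: "\<not> TT {y, c}" using quad_beside_fan[OF N tx(1,2) g(1)[symmetric] q'(1) q z(1)] by blast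
      have nx: "\<not> TT {x, a}" "\<not> TT {x, c}" using q' z(1) q unfolding TT_def by auto
      have ty: "triangle_at y x a f" "triangle_at y x c g" using tx triangle_at_commute triangle_at_rotate by metis+
      have i: "iso x {x, y}" using iso_iff[OF tx g(1)[symmetric]] nx by blast
      moreover have "iso y {x, y}" using iso_iff[OF ty g(1)[symmetric]] na nc by (simp add: insert_commute)
      moreover have "gift x {x, y} = 1" using i z(2) by (simp add: gift_def small_def)
      ultimately show ?thesis by blast
    qed
    have nc: "\<not> center v" "\<not> center w"
      using n triangle_at_adj[OF t] unfolding center_def star_def adj_def by auto
    have vw: "v \<noteq> w" using triangle_atD(2)[OF t] by auto
    have sh: "share f {v, w} = (gift v {v, w} + gift w {v, w}) / 2" if "iso v {v, w}" "iso w {v, w}"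
      using that nc vw by (simp add: share_def)
    have ttc: "TT_count f = 1" using TT_count_eq[OF t n(1)] n by simp
    have tv: "triangle_at v a w f" "triangle_at w a v f" using t triangle_at_commute triangle_at_rotate by metis+
    have S: "(\<Sum>e\<in>bd f. give f e) = - share f {v, w} + give f {w, a} + give f {v, a}" using sum[OF t] gs by simp
    consider "sz (opp f {v, a}) = 4" "sz (opp f {w, a}) = 4" | "sz (opp f {v, a}) = 4" "sz (opp f {w, a}) \<noteq> 4"
      | "sz (opp f {v, a}) \<noteq> 4" "sz (opp f {w, a}) = 4" | "sz (opp f {v, a}) \<noteq> 4" "sz (opp f {w, a}) \<noteq> 4" by blast
    then show ?thesis
    proof cases
      case 1
      then show ?thesis
        using S sh quad[OF t g(2)] quad[OF tw] triangle_side[OF tv(1) n(2)] triangle_side[OF tv(2) n(3)] unfolding wv by auto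
    next
      case 2
      have q: "iso v {v, w}" "iso w {v, w}" "gift v {v, w} = 1" using quad[OF t g(2) 2(1)] by auto
      then have "share f {v, w} \<ge> 5 / 7" using sh gift_iso[OF q(2)] by simp
      then show ?thesis using S triangle_side[OF tv(1) n(2)] triangle_side[OF tv(2) n(3)] 2 by auto
    next
      case 3
      have q: "iso w {v, w}" "iso v {v, w}" "gift w {v, w} = 1" using quad[OF tw 3(2)] unfolding wv by auto
      then have "share f {v, w} \<ge> 5 / 7" using sh gift_iso[OF q(2)] by simp
      then show ?thesis using S triangle_side[OF tv(1) n(2)] triangle_side[OF tv(2) n(3)] 3 by auto
    next
      case 4
      have "share f {v, w} \<ge> 1 / 7"
      proof (cases "iso v {v, w} \<and> iso w {v, w}")
        case True
        then show ?thesis using sh gift_iso[of v "{v, w}"] gift_iso[of w "{v, w}"] by simp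
      next
        case False
        then show ?thesis using nc ttc by (auto simp: share_def)
      qed
      then show ?thesis using S triangle_side[OF tv(1) n(2)] triangle_side[OF tv(2) n(3)] 4 by auto
    qed
  qed
  have two: ?thesis if t: "triangle_at v a b f" and n: "TT {v, a}" "TT {v, b}" "\<not> TT {a, b}" for v a b
  proof -
    have tb: "triangle_at v b a f" "triangle_at a v b f" "triangle_at a b v f" using t triangle_at_commute triangle_at_rotate by metis+
    have sh: "give f {v, x} = - 2 / 7" if tx: "triangle_at v x y f" and m: "TT {v, x}" "TT {v, y}" "\<not> TT {x, y}" for x y
    proof -
      obtain g c where g: "g \<noteq> f" "triangle_at v x c g" using TT_other[OF tx m(1)] .
      have o: "opp f {v, x} = g" by (rule oppI) (use triangle_atD[OF tx] triangle_atD[OF g(2)] g(1) in auto)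
      have "\<not> iso v {v, x}" using iso_iff[OF tx g(2) g(1)[symmetric]] m by blast
      moreover have "TT_count f = 2" using TT_count_eq[OF tx m(1)] m by simp
      ultimately have "share f {v, x} = 2 / 7" by (simp add: share_def)
      then show ?thesis using o f(2) triangle_atD(4)[OF g(2)] by (simp add: give_def)
    qed
    have ba: "{b, a} = {a, b}" by auto
    have "sz (opp f {a, b}) \<noteq> 4"
    proof
      assume q4: "sz (opp f {a, b}) = 4"
      have q: "opp f {a, b} \<in> F" "{a, b} \<in> bd (opp f {a, b})" using opp[OF triangle_atD(1,7)[OF t]] by auto
      obtain g x where g: "g \<noteq> f" "triangle_at a v x g" using TT_other[OF tb(2)] TT_commute[OF n(1)] by metis
      show False by (rule quad_beside_fan[OF N g(2) tb(2) g(1) q(1) q4 q(2) n(2)])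
    qed
    then have "give f {a, b} = - 3 / 7" using triangle_side[OF tb(3) n(3)] by auto
    then show ?thesis using sum[OF t] sh[OF t n] sh[OF tb(1) n(2,1)] n(3) ba by simp
  qed
  have ts: "triangle_at v b a f" "triangle_at a b v f" "triangle_at a v b f" "triangle_at b v a f" "triangle_at b a v f"
    using t triangle_at_commute triangle_at_rotate by metis+
  have cm: "{b, v} = {v, b}" "{a, v} = {v, a}" "{b, a} = {a, b}" by auto
  have "\<not> (TT {v, a} \<and> TT {v, b} \<and> TT {a, b})" using not_three_TT[OF N t] by blast
  then consider "\<not> TT {v, a}" "\<not> TT {a, b}" "\<not> TT {v, b}"
    | "TT {v, a}" "\<not> TT {a, b}" "\<not> TT {v, b}" | "\<not> TT {v, a}" "TT {a, b}" "\<not> TT {v, b}" | "\<not> TT {v, a}" "\<not> TT {a, b}" "TT {v, b}"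
    | "TT {v, a}" "TT {v, b}" "\<not> TT {a, b}" | "TT {v, a}" "TT {a, b}" "\<not> TT {v, b}" | "TT {v, b}" "TT {a, b}" "\<not> TT {v, a}" by blast
  then show ?thesis
  proof cases
    case 1 then show ?thesis by (rule none[OF t])
  next
    case 2 show ?thesis by (rule one[OF t]) (use 2 cm in auto)
  next
    case 3 show ?thesis by (rule one[OF ts(2)]) (use 3 cm in auto)
  next
    case 4 show ?thesis by (rule one[OF ts(1)]) (use 4 cm in auto)
  next
    case 5 then show ?thesis by (rule two[OF t])
  next
    case 6 show ?thesis by (rule two[OF ts(3)]) (use 6 cm in auto)
  next
    case 7 show ?thesis by (rule two[OF ts(4)]) (use 7 cm in auto)
  qed
qed

end

text \<open>Only vertices of \<open>Z\<close> can have degree two. By \<open>quad_quad\<close> such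
  a vertex lies on every 4-face that borders another 4-face, and it replaces the contributions of
  1/5 that may be missing.\<close>

definition quad_gift :: "'a \<Rightarrow> 'f \<Rightarrow> real" where
  "quad_gift v f = (if deg v = 2 \<and> sz f = 4 then 3 / 5 else 0)"

context
  assumes N: "\<not> has_circuit V E 6" and H: "\<not> diamond"
begin

lemma quad_charge:
  assumes q: "q \<in> F" "sz q = 4"
  shows "(\<Sum>e\<in>bd q. give q e) \<le> (\<Sum>v | v \<in> V \<and> v \<in> \<Union>(bd q). quad_gift v q)"
proof -
  have fin: "finite (bd q)" using fin_bd[OF q(1)] .
  have nn: "0 \<le> (\<Sum>v | v \<in> V \<and> v \<in> \<Union>(bd q). quad_gift v q)" by (intro sum_nonneg) (simp add: quad_gift_def)
  have opp_tri: "sz (opp q e) = 3 \<longleftrightarrow> tedge e" if e: "e \<in> bd q" for e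
  proof
    have o: "opp q e \<in> F" "opp q e \<noteq> q" "e \<in> bd (opp q e)" using opp[OF q(1) e] by auto
    show "sz (opp q e) = 3 \<Longrightarrow> tedge e" using o unfolding tedge_def by blast
    show "tedge e \<Longrightarrow> sz (opp q e) = 3" using tedge_other[OF q(1) o(1) o(2)[symmetric] e o(3)] q(2) by simp
  qed
  have le0: "give q e \<le> 0" if "e \<in> bd q" "\<not> tedge e" for e
    using opp_tri[OF that(1)] that(2) q(2) by (simp add: give_def)
  show ?thesis
  proof (cases "single q")
    case False
    have "give q e \<le> 0" if "e \<in> bd q" for e
      using le0[OF that] opp_tri[OF that] False q(2) by (cases "tedge e") (simp_all add: give_def)
    then have "(\<Sum>e\<in>bd q. give q e) \<le> 0" by (intro sum_nonpos)
    then show ?thesis using nn by simp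
  next
    case True
    then obtain e0 where e0: "{e \<in> bd q. tedge e} = {e0}" by (auto simp: single_def card_1_singleton_iff)
    then have e0q: "e0 \<in> bd q" "tedge e0" by blast+
    have g0: "give q e0 = 3 / 5" using opp_tri[OF e0q(1)] e0q(2) True q(2) by (simp add: give_def)
    have rest: "\<not> tedge e" if "e \<in> bd q - {e0}" for e using that e0 by blast
    have split: "(\<Sum>e\<in>bd q. give q e) = 3 / 5 + (\<Sum>e\<in>bd q - {e0}. give q e)"
      using sum.remove[OF fin e0q(1), of "give q"] g0 by simp
    show ?thesis
    proof (cases "\<exists>z\<in>\<Union>(bd q). deg z = 2")
      case True
      then obtain z where z: "z \<in> \<Union>(bd q)" "deg z = 2" by blast
      have "z \<in> V" using vertices_bd[OF q(1)] z(1) by blast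
      have "quad_gift z q \<le> (\<Sum>v | v \<in> V \<and> v \<in> \<Union>(bd q). quad_gift v q)"
        by (rule member_le_sum) (use finV z \<open>z \<in> V\<close> in \<open>auto simp: quad_gift_def\<close>)
      moreover have "(\<Sum>e\<in>bd q - {e0}. give q e) \<le> 0" using le0 rest by (intro sum_nonpos) auto
      ultimately show ?thesis using split z(2) q(2) by (simp add: quad_gift_def)
    next
      case False
      have "give q e = - 1 / 5" if e: "e \<in> bd q - {e0}" for e
      proof -
        have o: "opp q e \<in> F" "opp q e \<noteq> q" "e \<in> bd (opp q e)" using opp[OF q(1)] e by auto
        have "sz (opp q e) \<noteq> 3" using opp_tri rest e by blast
        moreover have "sz (opp q e) \<noteq> 4" using quad_quad[OF N q o(1) _ o(2)[symmetric] _ o(3)] e False by blast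
        ultimately have "5 \<le> sz (opp q e)" using sizes[OF N H o(1)] by linarith
        then show ?thesis using q(2) by (simp add: give_def)
      qed
      then have "(\<Sum>e\<in>bd q - {e0}. give q e) = - 3 / 5" using fin q(2) e0q(1) by simp
      then show ?thesis using split nn by simp
    qed
  qed
qed

lemma pass_ge:
  assumes "e \<in> star v" "\<not> center v"
  shows "pass e v \<ge> (if iso v e then - 1 else 0)"
proof (cases "iso v e")
  case True
  then have "TT e" by (simp add: iso_def)
  then show ?thesis using True assms gift_bounds(2)[of v e] by (simp add: pass_def)
next
  case False
  then have "gift v e = 0" by (simp add: gift_def)
  then show ?thesis using False assms by (simp add: pass_def)
qed

lemma pass_sum_ge:
  assumes "\<not> center v"
  shows "(\<Sum>e\<in>star v. pass e v) \<ge> - real (deg v) / 3"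
proof -
  have "- real (card {e \<in> star v. iso v e}) = (\<Sum>e\<in>star v. if iso v e then - 1 else 0)"
    by (simp add: sum.If_cases Collect_conj_eq)
  also have "\<dots> \<le> (\<Sum>e\<in>star v. pass e v)" using pass_ge assms by (intro sum_mono) auto
  finally have "- real (card {e \<in> star v. iso v e}) \<le> (\<Sum>e\<in>star v. pass e v)" .
  moreover have "3 * real (card {e \<in> star v. iso v e}) \<le> real (deg v)" using iso_count[of v] by linarith
  ultimately show ?thesis by linarith
qed

lemma pass_center:
  assumes c: "center v" and e: "e \<in> star v"
  shows "pass e v \<ge> - 1 / 7"
proof -
  obtain w where w: "e = {v, w}" "w \<noteq> v" using e star_obtain[of e v] by blast
  have "e - {v} = {w}" using w by auto
  moreover have "TT e" "iso w e" using center_iso[OF N H c] e w(1) by auto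
  ultimately show ?thesis using c gift_iso[of w e] by (simp add: pass_def)
qed

text \<open>The two triangles at a spoke would form a diamond of small vertices, so some rim vertex
  is not small. Its gift of 1 leaves 3/7 for the hub, which pays for at most 1/7 on each of the
  other three spokes.\<close>

lemma pass_center_small:
  assumes c: "center v" and s: "small v"
  shows "(\<Sum>e\<in>star v. pass e v) \<ge> 0"
proof -
  have d4: "deg v = 4" using c by (simp add: center_def)
  then have "star v \<noteq> {}" by auto
  then obtain e where e: "e \<in> star v" by blast
  then obtain w where w: "e = {v, w}" using star_obtain by metis
  have t: "TT {v, w}" using center_iso(1)[OF N H c] e w by blast
  obtain f g a b where f: "f \<noteq> g" "triangle_at v w a f" "triangle_at v w b g" using TT_triangles[OF t] .
  note dd = diamond_distinct[OF f(2,3,1)] and na = diamond_not_adj[OF f(2,3,1)]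
  note ad = triangle_at_adj[OF f(2)] triangle_at_adj[OF f(3)]
  have "\<not> (\<forall>u\<in>{v, w, a, b}. small u)" using H dd na ad unfolding diamond_def by blast
  then obtain r where r: "r \<in> {w, a, b}" "\<not> small r" using s by blast
  then have rs: "{v, r} \<in> star v" "r \<noteq> v" using ad dd by (auto simp: in_star adj_def)
  have "{v, r} - {v} = {r}" using rs(2) by auto
  then have "pass {v, r} v = 3 / 7"
    using center_iso[OF N H c rs(1)] c r(2) by (simp add: pass_def gift_def)
  moreover have "(\<Sum>e\<in>star v. pass e v) = pass {v, r} v + (\<Sum>e\<in>star v - {{v, r}}. pass e v)"
    by (rule sum.remove[OF fin_star rs(1)])
  moreover have "(\<Sum>e\<in>star v - {{v, r}}. - 1 / 7) \<le> (\<Sum>e\<in>star v - {{v, r}}. pass e v)"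
    using pass_center[OF c] by (intro sum_mono) auto
  moreover have "(\<Sum>e\<in>star v - {{v, r}}. - 1 / 7 :: real) = - 3 / 7" using rs(1) d4 by simp
  ultimately show ?thesis by linarith
qed

text \<open>The two faces beyond the triangles at the \<open>iso\<close> edge do not have length
  three or five, and length four would leave \<open>v\<close> degree three by
  \<open>quad_beside_diamond\<close>. So both have length at least seven; they share the fourth edge
  at \<open>v\<close>, which returns the 3/7 given away.\<close>

lemma pass_small:
  assumes nc: "\<not> center v" and s: "small v"
  shows "(\<Sum>e\<in>star v. pass e v) \<ge> 0"
proof (cases "\<exists>e\<in>star v. iso v e")
  case False
  then show ?thesis using pass_ge[OF _ nc] by (intro sum_nonneg) fastforce
next
  case True
  then obtain a where a: "{v, a} \<in> star v" "iso v {v, a}" using star_obtain by metis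
  have d4: "deg v = 4" using s by (simp add: small_def)
  have t: "TT {v, a}" using a(2) by (simp add: iso_def)
  obtain f g b c where f: "f \<noteq> g" "triangle_at v a b f" "triangle_at v a c g" using TT_triangles[OF t] .
  note D = triangle_atD[OF f(2)] and D' = triangle_atD[OF f(3)] and dd = diamond_distinct[OF f(2,3,1)]
  have nT: "\<not> TT {v, b}" "\<not> TT {v, c}" using iso_iff[OF f(2,3,1)] a(2) by auto
  have n: "b \<noteq> a" "c \<noteq> a" "b \<noteq> c" using dd by auto
  obtain d h k where d: "star v = {{v, a}, {v, b}, {v, c}, {v, d}}" "distinct [a, b, c, d]" "h \<in> F" "k \<in> F" "h \<noteq> k"
      "h \<noteq> f" "h \<noteq> g" "k \<noteq> f" "k \<noteq> g" "{v, b} \<in> bd h" "{v, d} \<in> bd h" "{v, c} \<in> bd k" "{v, d} \<in> bd k"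
    by (rule deg4_fan[OF D(1) D'(1) f(1) D(5) D'(5) D(6) D'(6) n d4])
  have big: "7 \<le> sz m" if f: "triangle_at v a x f'" "triangle_at v a y g'" "f' \<noteq> g'" and m: "m \<in> F" "m \<noteq> g'" "{v, y} \<in> bd m" and nt: "\<not> TT {v, y}" for x y f' g' m
  proof -
    have "sz m \<noteq> 3" using TT_I[OF triangle_atD(1)[OF f(2)] m(1) m(2)[symmetric] triangle_atD(6)[OF f(2)] m(3) triangle_atD(4)[OF f(2)]] nt by blast
    moreover have "sz m \<noteq> 5" using triangle_pentagon[OF N triangle_at_commute[OF f(2)] m(1) _ m(3)] by blast
    moreover have "sz m \<noteq> 4"
    proof
      assume "sz m = 4"
      then have "deg v = 3" using quad_beside_diamond[OF N f m(1) _ m(3)] by metis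
      then show False using d4 by simp
    qed
    ultimately show ?thesis using sizes[OF N H m(1)] by blast
  qed
  have "7 \<le> sz h" using big[OF f(3,2) f(1)[symmetric] d(3,6,10) nT(1)] .
  moreover have "7 \<le> sz k" using big[OF f(2,3,1) d(4,9,12) nT(2)] .
  ultimately have s7: "\<forall>x\<in>F. {v, d} \<in> bd x \<longrightarrow> 7 \<le> sz x" using faces_of_D[OF d(11,13,3,4,5)] by metis
  then have "\<not> TT {v, d}" using d(3,11) unfolding TT_def by fastforce
  then have pd: "pass {v, d} v = 3 / 7" using s7 by (simp add: pass_def)
  have pa: "pass {v, a} v = - 3 / 7" using t nc a(2) s by (simp add: pass_def gift_def)
  have pb: "pass {v, b} v \<ge> 0" "pass {v, c} v \<ge> 0" using nT by (simp_all add: pass_def)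
  have ne: "{v, a} \<notin> {{v, b}, {v, c}, {v, d}}" "{v, b} \<notin> {{v, c}, {v, d}}" "{v, c} \<notin> {{v, d}}"
    using d(2) by (auto simp: doubleton_eq_iff)
  show ?thesis unfolding d(1) using ne pa pb pd by simp
qed

lemma vertex_charge:
  assumes v: "v \<in> V - Z"
  shows "0 \<le> real (deg v) - 4 + (\<Sum>e\<in>star v. pass e v)"
proof -
  have d4: "4 \<le> deg v" using deg4[OF v] by (simp add: star_def)
  show ?thesis
  proof (cases "deg v = 4")
    case True
    then have "small v" using v by (simp add: small_def)
    then show ?thesis using pass_small pass_center_small True by fastforce
  next
    case False
    then have nc: "\<not> center v" by (simp add: center_def)
    show ?thesis
    proof (cases "6 \<le> deg v")
      case True
      then have "6 \<le> real (deg v)" by simp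
      then show ?thesis using pass_sum_ge[OF nc] by linarith
    next
      case False
      then have d5: "deg v = 5" using d4 \<open>deg v \<noteq> 4\<close> by simp
      have "card {e \<in> star v. iso v e} \<le> 1" using iso_count[of v] d5 by linarith
      moreover have "- real (card {e \<in> star v. iso v e}) = (\<Sum>e\<in>star v. if iso v e then - 1 else 0)"
        by (simp add: sum.If_cases Collect_conj_eq)
      moreover have "(\<Sum>e\<in>star v. if iso v e then - 1 else 0) \<le> (\<Sum>e\<in>star v. pass e v)"
        using pass_ge nc by (intro sum_mono) auto
      ultimately show ?thesis using d5 by simp
    qed
  qed
qed

lemma root_charge:
  assumes v: "v \<in> Z" and d3: "3 \<le> deg v"
  shows "- 2 \<le> real (deg v) - 4 + (\<Sum>e\<in>star v. pass e v)"
proof (cases "center v")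
  case True
  then have d4: "deg v = 4" by (simp add: center_def)
  have "(\<Sum>e\<in>star v. - 1 / 7) \<le> (\<Sum>e\<in>star v. pass e v)" using pass_center[OF True] by (intro sum_mono) auto
  then show ?thesis using d4 by simp
next
  case False
  have "3 \<le> real (deg v)" using d3 by simp
  then show ?thesis using pass_sum_ge[OF False] by linarith
qed

lemma root_charge2:
  assumes v: "v \<in> V" and d2: "deg v = 2"
  shows "0 \<le> (\<Sum>e\<in>star v. pass e v)" "(\<Sum>f | f \<in> F \<and> v \<in> \<Union>(bd f). quad_gift v f) \<le> 6 / 5"
proof -
  have nT: "\<not> TT e" if e: "e \<in> star v" for e
  proof
    assume t: "TT e"
    obtain a where a: "e = {v, a}" using e star_obtain[of e v] by blast
    obtain f g b c where "triangle_at v a b f" using TT_triangles t a by metis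
    then have "3 \<le> deg v" using triangle_deg_face triangle_atD(1,3) by metis
    then show False using d2 by simp
  qed
  then show "0 \<le> (\<Sum>e\<in>star v. pass e v)" by (intro sum_nonneg) (simp add: pass_def)
  obtain e where e: "e \<in> star v" using d2 by fastforce
  then have eE: "e \<in> E" by (simp add: star_def)
  have "{f \<in> F. v \<in> \<Union>(bd f)} \<subseteq> {f \<in> F. e \<in> bd f}"
  proof
    fix f assume "f \<in> {f \<in> F. v \<in> \<Union>(bd f)}"
    then have f: "f \<in> F" "v \<in> \<Union>(bd f)" by auto
    have "{e \<in> bd f. v \<in> e} \<subseteq> star v" using bdE[OF f(1)] by (auto simp: star_def)
    then have "{e \<in> bd f. v \<in> e} = star v" using bd_at_card[OF f] d2 card_subset_eq[OF fin_star] by simp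
    then show "f \<in> {f \<in> F. e \<in> bd f}" using e f by blast
  qed
  then have "card {f \<in> F. v \<in> \<Union>(bd f)} \<le> card {f \<in> F. e \<in> bd f}" using finF by (intro card_mono) auto
  then have c: "card {f \<in> F. v \<in> \<Union>(bd f)} \<le> 2" using two[OF eE] by simp
  have "(\<Sum>f | f \<in> F \<and> v \<in> \<Union>(bd f). quad_gift v f) \<le> (\<Sum>f | f \<in> F \<and> v \<in> \<Union>(bd f). 3 / 5)"
    by (intro sum_mono) (simp add: quad_gift_def)
  also have "\<dots> \<le> 6 / 5" using c by simp
  finally show "(\<Sum>f | f \<in> F \<and> v \<in> \<Union>(bd f). quad_gift v f) \<le> 6 / 5" .
qed

end

lemma circuit6_or_diamond:
  assumes Zd: "\<And>v. card Z = 3 \<Longrightarrow> v \<in> Z \<Longrightarrow> 3 \<le> deg v"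
  shows "has_circuit V E 6 \<or> diamond"
proof (rule ccontr)
  assume "\<not> ?thesis"
  then have N: "\<not> has_circuit V E 6" and H: "\<not> diamond" by auto
  \<comment> \<open>A vertex of degree two may fall to 2 - 4 - 2 * 3/5 = -16/5, and two of these do
    not reach -8. If the clique has three vertices, \<open>Zd\<close> gives each degree at least
    three, and then they stay at -2 or above.\<close>
  define c :: real where "c = (if card Z = 3 then 2 else 16 / 5)"
  have no_gift: "(\<Sum>f | f \<in> F \<and> v \<in> \<Union>(bd f). quad_gift v f) = 0" if "3 \<le> deg v" for v
    using that by (simp add: quad_gift_def)
  have cZ: "real (card Z) * c < 2 * 4"
  proof (cases "card Z = 3")
    case False
    then have "real (card Z) \<le> 2" using Z3 by simp
    then show ?thesis using False by (simp add: c_def)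
  qed (simp add: c_def)
  then show False
  proof (intro discharging[of 4 1 1 give quad_gift pass c])
    fix f assume f: "f \<in> F"
    have nn: "0 \<le> (\<Sum>v | v \<in> V \<and> v \<in> \<Union>(bd f). quad_gift v f)" by (intro sum_nonneg) (simp add: quad_gift_def)
    consider "sz f = 3" | "sz f = 4" | "sz f = 5" | "7 \<le> sz f" using sizes[OF N H f] by blast
    then show "0 \<le> 1 * real (sz f) - 4 - (\<Sum>e\<in>bd f. give f e) + (\<Sum>v | v \<in> V \<and> v \<in> \<Union>(bd f). quad_gift v f)"
    proof cases
      case 1
      then show ?thesis using triangle_charge[OF N H f 1] nn by simp
    next
      case 2
      then show ?thesis using quad_charge[OF N H f 2] by simp
    next
      case 3
      then have "(\<Sum>e\<in>bd f. give f e) = 1" by (simp add: give_def)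
      then show ?thesis using 3 nn by simp
    next
      case 4
      then have "(\<Sum>e\<in>bd f. give f e) = 3 / 7 * real (sz f)" by (simp add: give_def)
      moreover have "7 \<le> real (sz f)" using 4 by simp
      ultimately show ?thesis using nn by linarith
    qed
  next
    fix e assume "e \<in> E"
    then show "0 \<le> (\<Sum>f | f \<in> F \<and> e \<in> bd f. give f e) - (\<Sum>v\<in>e. pass e v)" by (rule edge_charge[OF N H])
  next
    fix v assume v: "v \<in> V - Z"
    have "3 \<le> deg v" using deg4[OF v] by (simp add: star_def)
    then show "0 \<le> 1 * real (deg v) - 4 + (\<Sum>e\<in>star v. pass e v) - (\<Sum>f | f \<in> F \<and> v \<in> \<Union>(bd f). quad_gift v f)"
      using vertex_charge[OF N H v] no_gift by simp
  next
    fix v assume v: "v \<in> Z"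
    then have vV: "v \<in> V" using ZV by blast
    have c2: "2 \<le> c" by (simp add: c_def)
    show "- c \<le> 1 * real (deg v) - 4 + (\<Sum>e\<in>star v. pass e v) - (\<Sum>f | f \<in> F \<and> v \<in> \<Union>(bd f). quad_gift v f)"
    proof (cases "3 \<le> deg v")
      case True
      then show ?thesis using root_charge[OF N H v True] no_gift c2 by simp
    next
      case False
      then have d2: "deg v = 2" using deg2[OF vV] by (simp add: star_def)
      then have "c = 16 / 5" using Zd[OF _ v] by (auto simp: c_def)
      then show ?thesis using root_charge2[OF N H vV d2] d2 by simp
    qed
  qed simp
qed

end

section \<open>Small clique cuts\<close>

definition clique :: "'a set set \<Rightarrow> 'a set \<Rightarrow> bool" where
  "clique E Y \<longleftrightarrow> (\<forall>u\<in>Y. \<forall>v\<in>Y. u \<noteq> v \<longrightarrow> {u, v} \<in> E)"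

definition hangs :: "'a set \<Rightarrow> 'a set set \<Rightarrow> 'a set \<Rightarrow> 'a set \<Rightarrow> bool" where
  "hangs V E A Z \<longleftrightarrow> A \<noteq> {} \<and> A \<subseteq> V \<and> Z \<subseteq> V \<and> A \<inter> Z = {} \<and> clique E Z \<and> card Z \<le> 3 \<and>
     (\<forall>e\<in>E. e \<inter> A \<noteq> {} \<longrightarrow> e \<subseteq> A \<union> Z)"

lemma hangs_minimal:
  assumes "finite V" "V \<noteq> {}" "\<And>e. e \<in> E \<Longrightarrow> e \<subseteq> V"
  obtains A Z where "hangs V E A Z" "\<And>B Y. hangs V E B Y \<Longrightarrow> card (A \<union> Z) \<le> card (B \<union> Y)"
proof -
  have "hangs V E V {}" using assms by (auto simp: hangs_def clique_def)
  then have "\<exists>x. (\<lambda>(A, Z). hangs V E A Z) x" by blast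
  then obtain x where x: "(\<lambda>(A, Z). hangs V E A Z) x"
    "\<And>y. (\<lambda>(A, Z). hangs V E A Z) y \<Longrightarrow> (\<lambda>(A, Z). card (A \<union> Z)) x \<le> (\<lambda>(A, Z). card (A \<union> Z)) y"
    using ex_has_least_nat[of "\<lambda>(A, Z). hangs V E A Z" _ "\<lambda>(A, Z). card (A \<union> Z)"] by blast
  obtain A Z where "x = (A, Z)" by (cases x)
  then show thesis using that[of A Z] x(1) x(2)[of "(_, _)"] by auto
qed

text \<open>Suppose the clique \<open>Y\<close> separates the piece. The clique \<open>Z\<close>
  cannot meet both parts, so some part avoids \<open>Z\<close>, lies in \<open>A\<close>, and has
  all its neighbours in itself or \<open>Y\<close>. It hangs on \<open>Y\<close> and gives a smaller
  pair.\<close>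

lemma hangs_conn:
  assumes fin: "finite V" and E: "\<And>e. e \<in> E \<Longrightarrow> e \<subseteq> V \<and> card e = 2"
    and h: "hangs V E A Z" and min: "\<And>B Y. hangs V E B Y \<Longrightarrow> card (A \<union> Z) \<le> card (B \<union> Y)"
    and Y: "Y \<subseteq> A \<union> Z" "clique E Y" "card Y \<le> 3"
  shows "conn_in {e \<in> E. e \<subseteq> A \<union> Z} (A \<union> Z - Y)"
  unfolding conn_in_def
proof (intro allI impI, rule ccontr)
  let ?W = "A \<union> Z"
  fix B assume B: "B \<subseteq> ?W - Y \<and> B \<noteq> {} \<and> B \<noteq> ?W - Y"
    and no: "\<not> (\<exists>u\<in>B. \<exists>v\<in>?W - Y - B. {u, v} \<in> {e \<in> E. e \<subseteq> ?W})"
  define C where "C = ?W - Y - B"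
  have BC: "B \<noteq> {}" "C \<noteq> {}" "B \<inter> C = {}" "B \<union> C = ?W - Y" using B by (auto simp: C_def)
  have WV: "?W \<subseteq> V" using h by (auto simp: hangs_def)
  have hE: "e \<subseteq> ?W" if "e \<in> E" "e \<inter> A \<noteq> {}" for e using h that unfolding hangs_def by simp
  have hZ: "{u, v} \<in> E" if "u \<in> Z" "v \<in> Z" "u \<noteq> v" for u v using h that unfolding hangs_def clique_def by simp
  have noE: "{u, v} \<notin> E" if "u \<in> B" "v \<in> C" for u v
    using no that BC(4) unfolding C_def by blast
  have key: False if P: "P \<noteq> {}" "Q \<noteq> {}" "P \<inter> Q = {}" "P \<union> Q = ?W - Y" "P \<inter> Z = {}"
    and nE: "\<And>u v. u \<in> P \<Longrightarrow> v \<in> Q \<Longrightarrow> {u, v} \<notin> E" for P Q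
  proof -
    have PA: "P \<subseteq> A" using P(4,5) by blast
    have "hangs V E P Y"
      unfolding hangs_def
    proof (intro conjI ballI impI)
      show "P \<noteq> {}" "clique E Y" "card Y \<le> 3" by fact+
      show "P \<subseteq> V" "Y \<subseteq> V" using PA Y(1) WV by auto
      show "P \<inter> Y = {}" using P(4) by blast
      fix e assume e: "e \<in> E" "e \<inter> P \<noteq> {}"
      have "e \<inter> A \<noteq> {}" using e(2) PA by auto
      then have eW: "e \<subseteq> ?W" by (rule hE[OF e(1)])
      obtain u where u: "u \<in> e" "u \<in> P" using e(2) by blast
      show "e \<subseteq> P \<union> Y"
      proof
        fix v assume v: "v \<in> e"
        show "v \<in> P \<union> Y"
        proof (cases "v = u")
          case False
          then have "e = {u, v}" using card2_joins E[OF e(1)] u(1) v by metis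
          then have "v \<notin> Q" using nE u(2) e(1) by blast
          then show ?thesis using v eW P(4) by blast
        qed (use u in simp)
      qed
    qed
    then have "card ?W \<le> card (P \<union> Y)" by (rule min)
    moreover have "P \<union> Y \<subset> ?W" using P Y(1) by blast
    ultimately show False using psubset_card_mono[of ?W "P \<union> Y"] finite_subset[OF WV fin] by simp
  qed
  have "B \<inter> Z = {} \<or> C \<inter> Z = {}"
  proof (rule ccontr)
    assume "\<not> ?thesis"
    then obtain u v where "u \<in> B" "u \<in> Z" "v \<in> C" "v \<in> Z" by blast
    moreover from this have "u \<noteq> v" using BC(3) by blast
    ultimately show False using noE hZ by metis
  qed
  then show False
  proof
    assume "B \<inter> Z = {}"
    then show False using key[OF BC] noE by blast
  next
    assume c: "C \<inter> Z = {}"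
    have "C \<inter> B = {}" "C \<union> B = ?W - Y" using BC(3,4) by auto
    then show False using key[OF BC(2,1) _ _ c] noE by (metis insert_commute)
  qed
qed

lemma conn_in_new_neighbour:
  assumes "conn_in E (W - Y)" "v \<in> W - Y" "finite Y" "card Y + 1 < card W"
  obtains d where "d \<in> W" "d \<notin> Y" "d \<noteq> v" "{v, d} \<in> E"
proof -
  have "W - Y \<noteq> {v}"
  proof
    assume "W - Y = {v}"
    then have "W \<subseteq> insert v Y" by blast
    then have "card W \<le> card (insert v Y)" using assms(3) by (intro card_mono) auto
    also have "\<dots> \<le> card Y + 1" using card_insert_le_m1 assms(3) by (simp add: card_insert_if)
    finally show False using assms(4) by simp
  qed
  then obtain u d where "u \<in> {v}" "d \<in> W - Y - {v}" "{u, d} \<in> E"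
    using conn_inD[OF assms(1), of "{v}"] assms(2) by blast
  then show thesis using that by auto
qed

lemma plane_drawing_subgraph:
  assumes pd: "plane_drawing V E p \<gamma>" and "W \<subseteq> V" "D \<subseteq> E"
  shows "plane_drawing W D p \<gamma>"
  unfolding plane_drawing_def
proof (intro conjI ballI impI)
  show "inj_on p W" using pd assms(2) unfolding plane_drawing_def by (meson inj_on_subset)
  fix e assume "e \<in> D"
  then have e: "e \<in> E" using assms(3) by auto
  then show "arc (\<gamma> e)" "{pathstart (\<gamma> e), pathfinish (\<gamma> e)} = p ` e" using pd unfolding plane_drawing_def by auto
  have "(path_image (\<gamma> e) - p ` e) \<inter> p ` V = {}" using pd e unfolding plane_drawing_def by auto
  then show "(path_image (\<gamma> e) - p ` e) \<inter> p ` W = {}" using assms(2) by blast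
  fix f assume f: "f \<in> D" "e \<noteq> f"
  then have "f \<in> E" using assms(3) by auto
  then show "(path_image (\<gamma> e) - p ` e) \<inter> path_image (\<gamma> f) = {}"
    using pd e f(2) unfolding plane_drawing_def by simp
qed

text \<open>The equality of stars carries configurations of the piece back to the graph; the bound
  for \<open>card Z = 3\<close> is what the balance for circuits of length six needs.\<close>

lemma degree_four_piece:
  fixes V :: "'a set"
  assumes sg: "simple_graph V E" and pl: "planar_graph V E" and ne: "V \<noteq> {}"
    and d4: "\<And>v. v \<in> V \<Longrightarrow> 4 \<le> card {e \<in> E. v \<in> e}"
  obtains W Z and F :: "('a set set \<times> complex set) set" where
    "plane_faces W {e \<in> E. e \<subseteq> W} F fst Z" "W \<subseteq> V" "\<And>v. v \<in> W - Z \<Longrightarrow> {e \<in> E. e \<subseteq> W \<and> v \<in> e} = {e \<in> E. v \<in> e}"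
    "\<And>v. card Z = 3 \<Longrightarrow> v \<in> Z \<Longrightarrow> 3 \<le> card {e \<in> E. e \<subseteq> W \<and> v \<in> e}"
proof -
  have fin: "finite V" and E: "\<And>e. e \<in> E \<Longrightarrow> e \<subseteq> V \<and> card e = 2" using sg by (auto simp: simple_graph_def)
  obtain A Z where h: "hangs V E A Z" and min: "\<And>B Y. hangs V E B Y \<Longrightarrow> card (A \<union> Z) \<le> card (B \<union> Y)"
    using hangs_minimal[OF fin ne] E by metis
  define W where "W = A \<union> Z"
  define EW where "EW = {e \<in> E. e \<subseteq> W}"
  have A: "A \<noteq> {}" "A \<subseteq> V" "Z \<subseteq> V" "A \<inter> Z = {}" "clique E Z" "card Z \<le> 3" "\<And>e. e \<in> E \<Longrightarrow> e \<inter> A \<noteq> {} \<Longrightarrow> e \<subseteq> W"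
    using h unfolding hangs_def W_def by blast+
  have WV: "W \<subseteq> V" using A by (auto simp: W_def)
  have finW: "finite W" using WV fin finite_subset by blast
  have EW: "e \<subseteq> W \<and> card e = 2 \<and> e \<in> E" if "e \<in> EW" for e using that E by (auto simp: EW_def)
  have neq: "u \<noteq> v" if "{u, v} \<in> EW" for u v using EW[OF that] by auto
  have inW: "u \<in> W" "v \<in> W" if "{u, v} \<in> EW" for u v using EW[OF that] by auto
  have finEW: "finite EW" by (rule finite_subset[of _ "Pow W"]) (use EW finW in auto)
  have starA: "{e \<in> EW. v \<in> e} = {e \<in> E. v \<in> e}" if "v \<in> A" for v using A(7) that by (auto simp: EW_def)
  have conn: "conn_in EW (W - Y)" if "Y \<subseteq> W" "clique E Y" "card Y \<le> 3" for Y
    unfolding EW_def W_def by (rule hangs_conn[OF fin E h min]) (use that in \<open>auto simp: W_def\<close>)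
  obtain v0 where v0: "v0 \<in> A" using A(1) by blast
  have d0: "4 \<le> card {e \<in> EW. v0 \<in> e}" using d4[of v0] starA[OF v0] A(2) v0 by auto
  \<comment> \<open>Five vertices guarantee that, besides a vertex and a clique of at most three
    others, the piece contains something further for the vertex to be joined to.\<close>
  have W5: "5 \<le> card W"
  proof -
    let ?n = "{e \<in> EW. v0 \<in> e}"
    have "?n \<subseteq> (\<lambda>u. {v0, u}) ` (W - {v0})"
    proof
      fix e assume e: "e \<in> ?n"
      then obtain u where "u \<in> e" "u \<noteq> v0" using EW[of e] by (auto simp: card_2_iff)
      then have "e = {v0, u}" "u \<in> W" using e EW[of e] card2_joins[of e v0 u] by auto
      then show "e \<in> (\<lambda>u. {v0, u}) ` (W - {v0})" using \<open>u \<noteq> v0\<close> by blast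
    qed
    then have "card ?n \<le> card (W - {v0})" using finW by (meson card_image_le card_mono finite_Diff finite_imageI le_trans)
    moreover have "card (W - {v0}) = card W - 1" using v0 by (simp add: W_def card_Diff_singleton)
    ultimately show ?thesis using d0 by linarith
  qed
  have nb: "\<exists>d. d \<in> W \<and> d \<notin> Y \<and> d \<noteq> v \<and> {v, d} \<in> EW" if "v \<in> W" "v \<notin> Y" "Y \<subseteq> W" "clique E Y" "card Y \<le> 3" for v Y
    using conn_in_new_neighbour[OF conn[OF that(3-5)], of v] that W5 finite_subset[OF that(3) finW] by auto
  have c2: "card {x, y} \<le> 3" and c3: "card {x, y, z} \<le> 3" for x y z :: 'a by (simp_all add: card_insert_if)
  have cl: "clique E {a, b, c}" if "{a, b} \<in> EW" "{b, c} \<in> EW" "{c, a} \<in> EW" for a b c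
    using that by (auto simp: clique_def EW_def insert_commute)
  have card_star: "card S \<le> card {e \<in> EW. v \<in> e}" if "S \<subseteq> {e \<in> EW. v \<in> e}" for S v
    using finEW that by (intro card_mono) auto
  have deg2: "2 \<le> card {e \<in> EW. v \<in> e}" if v: "v \<in> W" for v
  proof -
    obtain a where a: "{v, a} \<in> EW" using nb[OF v, of "{}"] by (auto simp: clique_def)
    then obtain b where b: "b \<noteq> a" "{v, b} \<in> EW" using nb[OF v, of "{a}"] neq[OF a] inW[OF a] by (auto simp: clique_def)
    have "card {{v, a}, {v, b}} \<le> card {e \<in> EW. v \<in> e}" by (rule card_star) (use a b in auto)
    then show ?thesis using b(1) by (auto simp: doubleton_eq_iff)
  qed
  have tdeg: "3 \<le> card {e \<in> EW. a \<in> e}" if t: "{a, b} \<in> EW" "{b, c} \<in> EW" "{c, a} \<in> EW" for a b c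
  proof -
    have "clique E {b, c}" using t by (auto simp: clique_def EW_def insert_commute)
    then obtain d where d: "d \<notin> {b, c}" "{a, d} \<in> EW"
      using nb[of a "{b, c}", OF _ _ _ _ c2] neq[OF t(1)] neq[OF t(3)] inW[OF t(1)] inW[OF t(2)] by auto
    have "card {{a, b}, {a, c}, {a, d}} \<le> card {e \<in> EW. a \<in> e}"
      by (rule card_star) (use t d in \<open>auto simp: insert_commute\<close>)
    moreover have "card {{a, b}, {a, c}, {a, d}} = 3" using d neq[OF t(2)] by (auto simp: doubleton_eq_iff)
    ultimately show ?thesis by simp
  qed
  obtain p \<gamma> where pd: "plane_drawing V E p \<gamma>" using pl by (auto simp: planar_graph_def)
  interpret D: drawing W EW p \<gamma>
  proof
    show "simple_graph W EW" using finW EW by (auto simp: simple_graph_def)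
    show "plane_drawing W EW p \<gamma>" by (rule plane_drawing_subgraph[OF pd WV]) (auto simp: EW_def)
  qed
  have c0: "conn_in EW W" using conn[of "{}"] by (simp add: clique_def)
  have c1: "conn_in EW (W - {v})" if "v \<in> W" for v using conn[of "{v}"] that by (simp add: clique_def)
  have v0W: "v0 \<in> W" using v0 by (simp add: W_def)
  obtain a where a: "{v0, a} \<in> EW" using nb[OF v0W, of "{}"] by (auto simp: clique_def)
  obtain b where b: "b \<noteq> a" "{v0, b} \<in> EW" using nb[OF v0W, of "{a}"] neq[OF a] inW[OF a] by (auto simp: clique_def)
  obtain C where C: "is_circuit C" "C \<subseteq> EW" using D.exists_circuit[OF v0W a b(2) b(1)[symmetric] c1[OF v0W]] by metis
  obtain F where F: "D.face_structure EW F"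
    using D.face_structure_extend[OF c0 c1 D.face_structure_circuit[OF C] is_circuit_nonempty[OF C(1)]] by blast
  have UW: "\<Union>EW = W"
  proof
    show "\<Union>EW \<subseteq> W" using EW by blast
    show "W \<subseteq> \<Union>EW"
    proof
      fix v assume "v \<in> W"
      then obtain d where "{v, d} \<in> EW" using nb[of v "{}"] by (auto simp: clique_def)
      then show "v \<in> \<Union>EW" by blast
    qed
  qed
  have "plane_faces W EW F fst Z"
  proof
    show "finite W" by (rule finW)
    show "e \<subseteq> W \<and> card e = 2" if "e \<in> EW" for e using EW[OF that] by simp
    show "finite F" using F unfolding D.face_structure_def by simp
    show "is_circuit (fst f) \<and> fst f \<subseteq> EW" if "f \<in> F" for f using F that unfolding D.face_structure_def by (auto simp: split_beta)
    show "card {f \<in> F. e \<in> fst f} = 2" if "e \<in> EW" for e using F that unfolding D.face_structure_def by blast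
    show "card F + card W = card EW + 2" using F unfolding D.face_structure_def UW by simp
    show "\<exists>f\<in>F. \<exists>e\<in>B. \<exists>e'\<in>{e \<in> EW. v \<in> e} - B. e \<in> fst f \<and> e' \<in> fst f"
      if "B \<subseteq> {e \<in> EW. v \<in> e}" "B \<noteq> {}" "B \<noteq> {e \<in> EW. v \<in> e}" for v B
      using F that unfolding D.face_structure_def by presburger
    show "Z \<subseteq> W" by (simp add: W_def)
    show "card Z \<le> 3" by (rule A(6))
    show "4 \<le> card {e \<in> EW. v \<in> e}" if "v \<in> W - Z" for v
    proof -
      have "v \<in> A" using that by (auto simp: W_def)
      then show ?thesis using starA[of v] d4[of v] A(2) by auto
    qed
    show "2 \<le> card {e \<in> EW. v \<in> e}" if "v \<in> W" for v by (rule deg2[OF that])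
    show "3 \<le> card {e \<in> EW. a \<in> e}" if "{a, b} \<in> EW" "{b, c} \<in> EW" "{c, a} \<in> EW" for a b c by (rule tdeg[OF that])
    show "\<exists>f\<in>F. fst f = {{a, b}, {b, c}, {c, a}}" if t: "{a, b} \<in> EW" "{b, c} \<in> EW" "{c, a} \<in> EW" for a b c
    proof -
      have abc: "a \<noteq> b" "b \<noteq> c" "c \<noteq> a" using neq t by auto
      let ?C = "{{a, b}, {b, c}, {c, a}}"
      have U: "\<Union>?C = {a, b, c}" by auto
      have cy: "is_circuit ?C" unfolding is_circuit_def by (rule exI[of _ "[a, b, c]"]) (use abc in auto)
      have "conn_in EW (W - \<Union>?C)" unfolding U
        by (rule conn[OF _ cl[OF t] c3]) (use inW[OF t(1)] inW[OF t(2)] in auto)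
      moreover have "e \<in> ?C" if e: "e \<in> EW" "e \<subseteq> \<Union>?C" for e
      proof -
        obtain x y where xy: "e = {x, y}" "x \<noteq> y" using EW[OF e(1)] by (auto simp: card_2_iff)
        then have "x \<in> {a, b, c}" "y \<in> {a, b, c}" using e(2) unfolding U by auto
        then show ?thesis using xy by auto
      qed
      ultimately show ?thesis using D.triangle_is_face[OF F cy] t by blast
    qed
    show "4 \<le> card {e \<in> EW. v \<in> e}"
      if t: "{v, a} \<in> EW" "{v, b} \<in> EW" "{v, c} \<in> EW" "{a, b} \<in> EW" "{b, c} \<in> EW" "{c, a} \<in> EW" for v a b c
    proof -
      have n: "v \<noteq> a" "v \<noteq> b" "v \<noteq> c" "a \<noteq> b" "b \<noteq> c" "c \<noteq> a" using neq t by auto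
      obtain d where d: "d \<notin> {a, b, c}" "{v, d} \<in> EW"
        using nb[of v "{a, b, c}", OF _ _ _ _ c3] n inW[OF t(1)] inW[OF t(5)] cl[OF t(4-6)] by auto
      have "card {{v, a}, {v, b}, {v, c}, {v, d}} \<le> card {e \<in> EW. v \<in> e}" by (rule card_star) (use t d in auto)
      moreover have "card {{v, a}, {v, b}, {v, c}, {v, d}} = 4" using d n by (auto simp: doubleton_eq_iff)
      ultimately show ?thesis by simp
    qed
  qed
  moreover have "3 \<le> card {e \<in> EW. v \<in> e}" if Z: "card Z = 3" "v \<in> Z" for v
  proof -
    obtain x y z where Zx: "Z = {x, y, z}" "x \<noteq> y" "y \<noteq> z" "x \<noteq> z" using Z(1) by (auto simp: card_3_iff)
    then obtain b c where bc: "b \<in> Z" "c \<in> Z" "b \<noteq> c" "b \<noteq> v" "c \<noteq> v" using Z(2) by auto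
    then have "{v, b} \<in> E" "{b, c} \<in> E" "{c, v} \<in> E" using A(5) Z(2) unfolding clique_def by metis+
    then have "{v, b} \<in> EW" "{b, c} \<in> EW" "{c, v} \<in> EW" using bc Z(2) by (auto simp: EW_def W_def)
    then show ?thesis by (rule tdeg)
  qed
  moreover have "{e \<in> E. e \<subseteq> W \<and> v \<in> e} = {e \<in> E. v \<in> e}" if "v \<in> W - Z" for v
    using starA[of v] that by (auto simp: EW_def W_def)
  moreover have "{e \<in> EW. v \<in> e} = {e \<in> E. e \<subseteq> W \<and> v \<in> e}" for v by (auto simp: EW_def)
  ultimately show thesis using that[of W F Z] WV unfolding EW_def by auto
qed

section \<open>Extending colourings\<close>

definition nbs :: "'a set set \<Rightarrow> 'a \<Rightarrow> 'a set" where "nbs E v = {u. {u, v} \<in> E}"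

text \<open>A set \<open>S = {u} \<union> set xs\<close> of vertices of degree four such that every colouring outside \<open>S\<close> extends:
  \<open>u\<close> gets a colour that does not harm \<open>last xs\<close>, and the rest is coloured greedily along \<open>xs\<close>.\<close>

definition reducible :: "'a set \<Rightarrow> 'a set set \<Rightarrow> 'a \<Rightarrow> 'a list \<Rightarrow> bool" where
  "reducible V E u xs \<longleftrightarrow> xs \<noteq> [] \<and> distinct (u # xs) \<and> set (u # xs) \<subseteq> V \<and> path_edges xs \<subseteq> E \<and> {u, last xs} \<in> E \<and>
     (\<forall>z\<in>set (u # xs). card {e \<in> E. z \<in> e} = 4) \<and>
     card (nbs E (last xs) \<inter> set (u # xs)) < card (nbs E u \<inter> set (u # xs))"

lemma has_circuit_mono: "has_circuit W D k \<Longrightarrow> W \<subseteq> V \<Longrightarrow> D \<subseteq> E \<Longrightarrow> has_circuit V E k"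
  unfolding has_circuit_def by blast

lemma card_nbs:
  assumes "simple_graph V E"
  shows "card (nbs E v) = card {e \<in> E. v \<in> e}" "nbs E v \<subseteq> V" "v \<notin> nbs E v"
proof -
  have E: "e \<subseteq> V \<and> card e = 2" if "e \<in> E" for e using assms that by (auto simp: simple_graph_def)
  show "nbs E v \<subseteq> V" using E by (auto simp: nbs_def)
  show n: "v \<notin> nbs E v" using E[of "{v, v}"] by (auto simp: nbs_def)
  have "bij_betw (\<lambda>u. {u, v}) (nbs E v) {e \<in> E. v \<in> e}"
    unfolding bij_betw_def
  proof
    show "inj_on (\<lambda>u. {u, v}) (nbs E v)" by (auto simp: inj_on_def doubleton_eq_iff)
    show "(\<lambda>u. {u, v}) ` nbs E v = {e \<in> E. v \<in> e}"
    proof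
      show "(\<lambda>u. {u, v}) ` nbs E v \<subseteq> {e \<in> E. v \<in> e}" by (auto simp: nbs_def)
      show "{e \<in> E. v \<in> e} \<subseteq> (\<lambda>u. {u, v}) ` nbs E v"
      proof
        fix e assume e: "e \<in> {e \<in> E. v \<in> e}"
        then have "card e = 2" using E by blast
        then obtain u where "u \<in> e" "u \<noteq> v" by (auto simp: card_2_iff)
        then have "e = {u, v}" using card2_joins[of e u v] e \<open>card e = 2\<close> by auto
        then show "e \<in> (\<lambda>u. {u, v}) ` nbs E v" using e by (auto simp: nbs_def)
      qed
    qed
  qed
  then show "card (nbs E v) = card {e \<in> E. v \<in> e}" by (rule bij_betw_same_card)
qed

lemma reducible_exists:
  assumes sg: "simple_graph V E" and pl: "planar_graph V E" and ne: "V \<noteq> {}"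
    and d4: "\<And>v. v \<in> V \<Longrightarrow> 4 \<le> card {e \<in> E. v \<in> e}"
    and k: "k \<in> {3, 4, 5, 6}" "\<not> has_circuit V E k"
  shows "\<exists>u xs. reducible V E u xs"
proof -
  obtain W Z and F :: "('a set set \<times> complex set) set" where
    P: "plane_faces W {e \<in> E. e \<subseteq> W} F fst Z" and WV: "W \<subseteq> V"
    and st: "\<And>v. v \<in> W - Z \<Longrightarrow> {e \<in> E. e \<subseteq> W \<and> v \<in> e} = {e \<in> E. v \<in> e}"
    and Z3: "\<And>v. card Z = 3 \<Longrightarrow> v \<in> Z \<Longrightarrow> 3 \<le> card {e \<in> E. e \<subseteq> W \<and> v \<in> e}"
  proof (rule degree_four_piece[OF sg pl ne])
    show "4 \<le> card {e \<in> E. v \<in> e}" if "v \<in> V" for v by (rule d4[OF that])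
  qed (rule that)
  let ?D = "{e \<in> E. e \<subseteq> W}"
  interpret P: plane_faces W ?D F fst Z by (rule P)
  have mono: "\<not> has_circuit W ?D k" using has_circuit_mono[of W ?D k V E] k(2) WV by auto
  have s: "{e \<in> ?D. v \<in> e} = {e \<in> E. e \<subseteq> W \<and> v \<in> e}" for v by auto
  have small: "v \<in> W \<and> card {e \<in> E. v \<in> e} = 4" if "P.small v" for v
    using that st[of v] unfolding P.small_def P.star_def s by auto
  have fin: "finite V" using sg by (simp add: simple_graph_def)
  have finN: "finite (nbs E v)" for v using card_nbs(2)[OF sg] fin finite_subset by metis
  have Esym: "{x, y} \<in> E \<longleftrightarrow> {y, x} \<in> E" for x y by (simp add: insert_commute)
  have nself: "{x, x} \<notin> E" for x using card_nbs(3)[OF sg, of x] by (simp add: nbs_def)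
  consider "k = 3" | "k = 4" | "k = 5" | "k = 6" using k(1) by blast
  then show ?thesis
  proof cases
    case 1 then show ?thesis using P.circuit3 mono by simp
  next
    case 3 then show ?thesis using P.circuit5 mono by simp
  next
    case 2
    then have P.house using P.circuit4_or_house mono by simp
    then obtain a b x y z c where h: "distinct [a, b, x, y, z, c]" "\<forall>u\<in>{a, b, x, y, z, c}. P.small u"
      "{{a, b}, {b, x}, {x, y}, {y, z}, {z, a}, {a, c}, {b, c}} \<subseteq> ?D" unfolding P.house_def by (elim exE conjE) (rule that)
    let ?S = "set [a, c, b, x, y, z]"
    have c4: False if "distinct [p, q, r, t]" "{{p, q}, {q, r}, {r, t}, {t, p}} \<subseteq> ?D" for p q r t
      using P.circuit4I[OF that] mono 2 by simp
    have SW: "?S \<subseteq> W" using small h(2) by auto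
    \<comment> \<open>Each further edge at \<open>z\<close> would close a 4-circuit. So
      \<open>z\<close> has at most two neighbours in the configuration, whereas \<open>a\<close> has
      at least three.\<close>
    have nzb: "{b, z} \<notin> E" "{x, z} \<notin> E" "{c, z} \<notin> E"
    proof -
      have D: "{p, q} \<in> ?D" if "{p, q} \<in> E" "p \<in> ?S" "q \<in> ?S" for p q using that SW by auto
      show "{b, z} \<notin> E"
      proof
        assume "{b, z} \<in> E"
        then show False using c4[of b x y z] D[of b z] h(1,3) by (auto simp: insert_commute)
      qed
      show "{x, z} \<notin> E"
      proof
        assume "{x, z} \<in> E"
        then show False using c4[of x z a b] D[of x z] h(1,3) by (auto simp: insert_commute)
      qed
      show "{c, z} \<notin> E"
      proof
        assume "{c, z} \<in> E"
        then show False using c4[of c z a b] D[of c z] h(1,3) by (auto simp: insert_commute)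
      qed
    qed
    have "nbs E z \<inter> ?S \<subseteq> {y, a}" using nzb nself by (auto simp: nbs_def)
    then have "card (nbs E z \<inter> ?S) \<le> card {y, a}" by (intro card_mono) auto
    also have "\<dots> < card {b, z, c}" using h(1) by auto
    also have "\<dots> \<le> card (nbs E a \<inter> ?S)"
      using h(3) finN by (intro card_mono) (auto simp: nbs_def insert_commute)
    finally have "card (nbs E z \<inter> ?S) < card (nbs E a \<inter> ?S)" .
    then have "reducible V E a [c, b, x, y, z]"
      using h small WV SW unfolding reducible_def by (auto simp: insert_commute)
    then show ?thesis by blast
  next
    case 4
    then have P.diamond using P.circuit6_or_diamond mono Z3 unfolding P.star_def s by metis
    then obtain v w a c where h: "distinct [v, w, a, c]" "\<forall>u\<in>{v, w, a, c}. P.small u"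
      "P.adj v w" "P.adj v a" "P.adj v c" "P.adj w a" "P.adj w c" "\<not> P.adj a c" unfolding P.diamond_def by (elim exE conjE) (rule that)
    let ?S = "set [v, c, w, a]"
    have SW: "?S \<subseteq> W" using small h(2) by auto
    have e: "{v, w} \<in> E" "{v, a} \<in> E" "{v, c} \<in> E" "{w, a} \<in> E" "{w, c} \<in> E" "{a, c} \<notin> E"
      using h(3-8) SW unfolding P.adj_def by auto
    have "nbs E a \<inter> ?S \<subseteq> {v, w}" using e(6) nself by (auto simp: nbs_def insert_commute)
    then have "card (nbs E a \<inter> ?S) \<le> card {v, w}" by (intro card_mono) auto
    also have "\<dots> < card {w, a, c}" using h(1) by auto
    also have "\<dots> \<le> card (nbs E v \<inter> ?S)"
      using e finN by (intro card_mono) (auto simp: nbs_def insert_commute)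
    finally have "card (nbs E a \<inter> ?S) < card (nbs E v \<inter> ?S)" .
    then have "reducible V E v [c, w, a]"
      using h(1,2) e small WV SW unfolding reducible_def by (auto simp: insert_commute)
    then show ?thesis by blast
  qed
qed

section \<open>Partial colourings from lists of four colours\<close>

locale signed_lists =
  fixes V :: "'a set" and E :: "'a set set" and \<sigma> :: "'a set \<Rightarrow> int" and L :: "'a \<Rightarrow> int set"
  assumes sg: "simple_graph V E" and sig: "signature E \<sigma>"
    and L: "\<And>v. v \<in> V \<Longrightarrow> finite (L v) \<and> card (L v) = 4"
begin

definition ok :: "'a set \<Rightarrow> ('a \<Rightarrow> int) \<Rightarrow> bool" where
  "ok D c \<longleftrightarrow> (\<forall>v\<in>D. c v \<in> L v) \<and> (\<forall>u\<in>D. \<forall>v\<in>D. {u, v} \<in> E \<longrightarrow> c u \<noteq> \<sigma> {u, v} * c v)"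

definition blocked :: "'a set \<Rightarrow> ('a \<Rightarrow> int) \<Rightarrow> 'a \<Rightarrow> int set" where
  "blocked D c v = (\<lambda>u. \<sigma> {u, v} * c u) ` (nbs E v \<inter> D)"

lemma finN: "finite (nbs E v)"
  using card_nbs(2)[OF sg] sg finite_subset unfolding simple_graph_def by metis

lemma sign_cancel: "e \<in> E \<Longrightarrow> \<sigma> e * (\<sigma> e * x) = x"
  using sig unfolding signature_def by fastforce

lemma card_blocked: "card (blocked D c v) \<le> card (nbs E v \<inter> D)"
  unfolding blocked_def by (rule card_image_le) (simp add: finN)

text \<open>Properness is required for both orders of the ends; multiplying by the sign once more
  turns one condition into the other.\<close>

lemma ok_insert:
  assumes "ok D c" "v \<notin> D" "x \<in> L v" "x \<notin> blocked D c v"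
  shows "ok (insert v D) (c(v := x))"
proof -
  have nb: "{v, v} \<notin> E" using card_nbs(3)[OF sg, of v] by (simp add: nbs_def)
  have x: "x \<noteq> \<sigma> {v, w} * c w \<and> c w \<noteq> \<sigma> {w, v} * x" if w: "w \<in> D" "{v, w} \<in> E" for w
  proof -
    have vw: "{w, v} = {v, w}" by auto
    have "w \<in> nbs E v \<inter> D" using w by (simp add: nbs_def vw)
    then have "x \<noteq> \<sigma> {v, w} * c w" using assms(4) unfolding blocked_def vw[symmetric] by blast
    moreover have "x = \<sigma> {v, w} * c w" if "c w = \<sigma> {v, w} * x" using sign_cancel[OF w(2)] that by simp
    ultimately show ?thesis unfolding vw by blast
  qed
  have x': "{w, v} \<in> E \<Longrightarrow> w \<in> D \<Longrightarrow> c w \<noteq> \<sigma> {w, v} * x" for w using x[of w] by (simp add: insert_commute)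
  show ?thesis
    using assms(1-3) nb x x' unfolding ok_def by auto
qed

lemma ok_step:
  assumes "ok D c" "v \<notin> D" "v \<in> V" "card (nbs E v \<inter> D) < 4"
  shows "\<exists>x. ok (insert v D) (c(v := x))"
proof -
  have "finite (blocked D c v)" by (simp add: blocked_def finN)
  then have "card (L v - blocked D c v) \<ge> 4 - card (blocked D c v)"
    using L[OF assms(3)] diff_card_le_card_Diff[of "blocked D c v" "L v"] by simp
  then have "card (L v - blocked D c v) \<noteq> 0" using card_blocked[of D c v] assms(4) by linarith
  then have "L v - blocked D c v \<noteq> {}" by (metis card.empty)
  then obtain x where "x \<in> L v - blocked D c v" by blast
  then show ?thesis using ok_insert[OF assms(1,2)] by blast
qed

text \<open>Each vertex is coloured while its successor is still uncoloured, so at most three of its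
  four colours are blocked. The final vertex \<open>w\<close> only serves as a successor and stays
  uncoloured.\<close>

lemma ok_path:
  "ok D c \<Longrightarrow> distinct (ys @ [w]) \<Longrightarrow> set (ys @ [w]) \<inter> D = {} \<Longrightarrow> set ys \<subseteq> V \<Longrightarrow> path_edges (ys @ [w]) \<subseteq> E \<Longrightarrow>
    (\<And>z. z \<in> set ys \<Longrightarrow> card (nbs E z) = 4) \<Longrightarrow> \<exists>c'. ok (D \<union> set ys) c' \<and> (\<forall>v\<in>D. c' v = c v)"
proof (induction ys arbitrary: D c)
  case Nil
  then show ?case by auto
next
  case (Cons y ys)
  define n where "n = hd (ys @ [w])"
  have n: "{y, n} \<in> E" "n \<in> set (ys @ [w])" using Cons.prems(5) unfolding n_def by (cases ys; auto)+
  have ps: "nbs E y \<inter> D \<subset> nbs E y"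
    using n Cons.prems(3) by (auto simp: nbs_def insert_commute)
  have "card (nbs E y \<inter> D) < 4"
    using psubset_card_mono[OF finN ps] Cons.prems(6)[of y] by simp
  then obtain x where x: "ok (insert y D) (c(y := x))"
    using ok_step[OF Cons.prems(1), of y] Cons.prems(3,4) by auto
  have "\<exists>c'. ok (insert y D \<union> set ys) c' \<and> (\<forall>v\<in>insert y D. c' v = (c(y := x)) v)"
  proof (rule Cons.IH[OF x])
    show "path_edges (ys @ [w]) \<subseteq> E" using Cons.prems(5) by (cases ys) auto
  qed (use Cons.prems in auto)
  then obtain c' where c': "ok (insert y D \<union> set ys) c'" "\<forall>v\<in>insert y D. c' v = (c(y := x)) v" by blast
  have "y \<notin> D" using Cons.prems(3) by simp
  then have "\<forall>v\<in>D. c' v = c v" using c'(2) by auto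
  then show ?case using c'(1) by auto
qed

text \<open>After colouring outside the configuration, each of its vertices keeps at least as many
  colours as it has neighbours inside. The colour of \<open>u\<close> is chosen so that
  \<open>w\<close> still has that many afterwards. Since \<open>u\<close> is one of these
  neighbours, the others cannot block all colours of \<open>w\<close>, which is coloured
  last.\<close>

lemma ok_reducible:
  assumes r: "reducible V E u xs" and c: "ok (V - set (u # xs)) c"
  shows "\<exists>c'. ok V c'"
proof -
  let ?S = "set (u # xs)" and ?D = "V - set (u # xs)"
  obtain ys w where xs: "xs = ys @ [w]" using r by (metis reducible_def rev_exhaust)
  have d: "distinct (u # ys @ [w])" and SV: "?S \<subseteq> V" and p: "path_edges (ys @ [w]) \<subseteq> E" and uw: "{u, w} \<in> E"
    and lt: "card (nbs E w \<inter> ?S) < card (nbs E u \<inter> ?S)"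
    using r by (auto simp: reducible_def xs)
  have n4: "card (nbs E z) = 4" if "z \<in> ?S" for z using r that card_nbs(1)[OF sg] by (auto simp: reducible_def)
  have part: "card (nbs E z \<inter> ?D) + card (nbs E z \<inter> ?S) = 4" if "z \<in> ?S" for z
  proof -
    have "nbs E z = (nbs E z \<inter> ?D) \<union> (nbs E z \<inter> ?S)" using card_nbs(2)[OF sg] by blast
    then have "card (nbs E z) = card ((nbs E z \<inter> ?D) \<union> (nbs E z \<inter> ?S))" by simp
    also have "\<dots> = card (nbs E z \<inter> ?D) + card (nbs E z \<inter> ?S)" by (rule card_Un_disjoint) (auto simp: finN)
    finally show ?thesis using n4[OF that] by simp
  qed
  define Au where "Au = L u - blocked ?D c u"
  define Aw where "Aw = L w - blocked ?D c w"
  have A: "card (L z - blocked ?D c z) \<ge> card (nbs E z \<inter> ?S)" if "z \<in> ?S" for z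
  proof -
    have "finite (blocked ?D c z)" by (simp add: blocked_def finN)
    then have "card (L z - blocked ?D c z) \<ge> 4 - card (blocked ?D c z)"
      using L[of z] SV that diff_card_le_card_Diff[of "blocked ?D c z" "L z"] by auto
    then show ?thesis using card_blocked[of ?D c z] part[OF that] by linarith
  qed
  have fA: "finite Au" "finite Aw" using L SV xs by (auto simp: Au_def Aw_def)
  have Au: "card (nbs E w \<inter> ?S) < card Au" using A[of u] lt by (simp add: Au_def)
  have Aw: "card (nbs E w \<inter> ?S) \<le> card Aw" using A[of w] by (simp add: Aw_def xs)
  \<comment> \<open>If \<open>Aw\<close> has a surplus, any colour of \<open>u\<close> will do.
    Otherwise \<open>Au\<close> is larger than \<open>Aw\<close>; distinct colours of
    \<open>u\<close> forbid distinct colours of \<open>w\<close>, so some colour of \<open>u\<close>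
    forbids none in \<open>Aw\<close>.\<close>
  have "\<exists>\<alpha>\<in>Au. card (nbs E w \<inter> ?S) \<le> card (Aw - {\<sigma> {u, w} * \<alpha>})"
  proof (cases "card (nbs E w \<inter> ?S) < card Aw")
    case True
    have "Au \<noteq> {}" using Au by auto
    then obtain \<alpha> where "\<alpha> \<in> Au" by blast
    moreover have "card Aw - 1 \<le> card (Aw - {\<sigma> {u, w} * \<alpha>})" using fA by (simp add: card_Diff_singleton_if)
    ultimately show ?thesis using True by force
  next
    case False
    then have eq: "card Aw = card (nbs E w \<inter> ?S)" using Aw by simp
    have "\<not> (\<lambda>\<alpha>. \<sigma> {u, w} * \<alpha>) ` Au \<subseteq> Aw"
    proof
      assume "(\<lambda>\<alpha>. \<sigma> {u, w} * \<alpha>) ` Au \<subseteq> Aw"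
      then have "card ((\<lambda>\<alpha>. \<sigma> {u, w} * \<alpha>) ` Au) \<le> card Aw" using fA by (intro card_mono)
      moreover have "inj_on (\<lambda>\<alpha>. \<sigma> {u, w} * \<alpha>) Au" using sign_cancel[OF uw] by (metis inj_onI)
      ultimately show False using Au eq by (simp add: card_image)
    qed
    then obtain \<alpha> where \<alpha>: "\<alpha> \<in> Au" "\<sigma> {u, w} * \<alpha> \<notin> Aw" by blast
    then have "Aw - {\<sigma> {u, w} * \<alpha>} = Aw" by simp
    then show ?thesis using eq \<alpha>(1) by (metis order_refl)
  qed
  then obtain \<alpha> where \<alpha>: "\<alpha> \<in> Au" "card (nbs E w \<inter> ?S) \<le> card (Aw - {\<sigma> {u, w} * \<alpha>})" by blast
  have c1: "ok (insert u ?D) (c(u := \<alpha>))" by (rule ok_insert[OF c]) (use \<alpha>(1) in \<open>auto simp: Au_def\<close>)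
  obtain c' where c': "ok (insert u ?D \<union> set ys) c'" "\<forall>v\<in>insert u ?D. c' v = (c(u := \<alpha>)) v"
    using ok_path[OF c1, of ys w] d p SV n4 xs by auto
  have dis: "w \<notin> insert u ?D \<union> set ys" using d xs by auto
  have bl: "blocked (insert u ?D \<union> set ys) c' w \<subseteq> blocked ?D c w \<union> {\<sigma> {u, w} * \<alpha>} \<union> blocked (set ys) c' w"
  proof
    fix x assume "x \<in> blocked (insert u ?D \<union> set ys) c' w"
    then obtain v where v: "v \<in> nbs E w" "v \<in> insert u ?D \<union> set ys" "x = \<sigma> {v, w} * c' v" by (auto simp: blocked_def)
    consider "v = u" | "v \<in> ?D" "v \<noteq> u" | "v \<in> set ys" using v(2) by blast
    then show "x \<in> blocked ?D c w \<union> {\<sigma> {u, w} * \<alpha>} \<union> blocked (set ys) c' w"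
    proof cases
      case 1
      then show ?thesis using v(3) c'(2) by simp
    next
      case 2
      then have "x = \<sigma> {v, w} * c v" using v(3) c'(2) by simp
      then show ?thesis using v(1) 2 unfolding blocked_def by blast
    next
      case 3
      then show ?thesis using v(1,3) unfolding blocked_def by blast
    qed
  qed
  have "card (blocked (set ys) c' w) \<le> card (nbs E w \<inter> set ys)" by (rule card_blocked)
  also have "\<dots> < card (nbs E w \<inter> ?S)"
  proof (rule psubset_card_mono)
    have "u \<in> nbs E w" using uw by (simp add: nbs_def)
    then show "nbs E w \<inter> set ys \<subset> nbs E w \<inter> ?S" using d xs by auto
  qed (simp add: finN)
  finally have "card (blocked (set ys) c' w) < card (Aw - {\<sigma> {u, w} * \<alpha>})" using \<alpha>(2) by simp
  then have "\<not> Aw - {\<sigma> {u, w} * \<alpha>} \<subseteq> blocked (set ys) c' w"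
    using card_mono[of "blocked (set ys) c' w" "Aw - {\<sigma> {u, w} * \<alpha>}"] by (auto simp: blocked_def finN)
  then obtain x where x: "x \<in> Aw - {\<sigma> {u, w} * \<alpha>}" "x \<notin> blocked (set ys) c' w" by blast
  then have "x \<in> L w" "x \<notin> blocked (insert u ?D \<union> set ys) c' w" using bl by (auto simp: Aw_def)
  then have "ok (insert w (insert u ?D \<union> set ys)) (c'(w := x))" using ok_insert[OF c'(1) dis] by blast
  moreover have "insert w (insert u ?D \<union> set ys) = V" using SV xs by auto
  ultimately show ?thesis by auto
qed

end

section \<open>Induction on the number of vertices\<close>

lemma planar_subgraph:
  "planar_graph V E \<Longrightarrow> W \<subseteq> V \<Longrightarrow> D \<subseteq> E \<Longrightarrow> planar_graph W D"
  unfolding planar_graph_def using plane_drawing_subgraph by metis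

lemma signed_colouring:
  assumes "simple_graph V E" "signature E \<sigma>" "planar_graph V E" "k \<in> {3, 4, 5, 6}" "\<not> has_circuit V E k"
    "\<And>v. v \<in> V \<Longrightarrow> finite (L v) \<and> card (L v) = 4"
  shows "\<exists>c. signed_lists.ok E \<sigma> L V c"
  using assms
proof (induction "card V" arbitrary: V E rule: less_induct)
  case less
  interpret signed_lists V E \<sigma> L by (standard) (use less.prems in auto)
  have fin: "finite V" using less.prems(1) by (simp add: simple_graph_def)
  have smaller: "\<exists>c. ok (V - S) c" if S: "S \<noteq> {}" "S \<subseteq> V" for S
  proof -
    let ?E = "{e \<in> E. e \<subseteq> V - S}"
    have lt: "card (V - S) < card V" using S fin by (intro psubset_card_mono) auto
    have g: "simple_graph (V - S) ?E" using less.prems(1) by (auto simp: simple_graph_def)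
    have "\<exists>c. signed_lists.ok ?E \<sigma> L (V - S) c"
    proof (rule less.hyps[OF lt g])
      show "signature ?E \<sigma>" using less.prems(2) by (auto simp: signature_def)
      show "planar_graph (V - S) ?E" by (rule planar_subgraph[OF less.prems(3)]) auto
      show "\<not> has_circuit (V - S) ?E k" using has_circuit_mono[of "V - S" ?E k V E] less.prems(5) by auto
    qed (use less.prems in auto)
    then obtain c where c: "signed_lists.ok ?E \<sigma> L (V - S) c" by blast
    interpret S: signed_lists "V - S" ?E \<sigma> L
      by standard (use g less.prems in \<open>auto simp: signature_def\<close>)
    have "ok (V - S) c" using c unfolding S.ok_def ok_def by auto
    then show ?thesis by blast
  qed
  show ?case
  proof (cases "V = {}")
    case True
    then have "ok V (\<lambda>_. 0)" by (simp add: ok_def)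
    then show ?thesis by blast
  next
    case ne: False
    show ?thesis
    proof (cases "\<exists>v\<in>V. card {e \<in> E. v \<in> e} < 4")
      case True
      then obtain v where v: "v \<in> V" "card {e \<in> E. v \<in> e} < 4" by blast
      obtain c where c: "ok (V - {v}) c" using smaller[of "{v}"] v(1) by blast
      have "card (nbs E v \<inter> (V - {v})) \<le> card (nbs E v)" by (rule card_mono[OF finN]) simp
      then have "card (nbs E v \<inter> (V - {v})) < 4" using v(2) card_nbs(1)[OF sg] by simp
      then obtain x where "ok (insert v (V - {v})) (c(v := x))" using ok_step[OF c _ v(1)] by blast
      then show ?thesis using v(1) by (auto simp: insert_absorb)
    next
      case False
      then have "\<And>v. v \<in> V \<Longrightarrow> 4 \<le> card {e \<in> E. v \<in> e}" by force
      then obtain u xs where r: "reducible V E u xs"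
        using reducible_exists[OF less.prems(1,3) ne _ less.prems(4,5)] by blast
      then have "set (u # xs) \<subseteq> V" by (simp add: reducible_def)
      then obtain c where "ok (V - set (u # xs)) c" using smaller[of "set (u # xs)"] by auto
      then show ?thesis using ok_reducible[OF r] by blast
    qed
  qed
qed

theorem theorem3p5:
  fixes V :: "'a set" and E :: "'a set set" and \<sigma> :: "'a set \<Rightarrow> int" and k :: nat
  assumes "simple_graph V E"
    and "signature E \<sigma>"
    and "planar_graph V E"
    and "k \<in> {3, 4, 5, 6}"
    and "\<not> has_circuit V E k"
  shows "choosable 4 V E \<sigma>"
  unfolding choosable_def
proof (intro allI impI)
  fix L assume "m_list_assignment 4 V L"
  then have L: "\<And>v. v \<in> V \<Longrightarrow> finite (L v) \<and> card (L v) = 4" by (simp add: m_list_assignment_def)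
  interpret signed_lists V E \<sigma> L by standard (use assms L in auto)
  have "\<exists>c. ok V c" by (rule signed_colouring[OF assms]) (rule L)
  then obtain c where c: "ok V c" by blast
  have "proper_coloring E \<sigma> c"
    unfolding proper_coloring_def
  proof (intro allI impI)
    fix u v assume e: "{u, v} \<in> E"
    then have "u \<in> V" "v \<in> V" using assms(1) by (auto simp: simple_graph_def)
    then show "c u \<noteq> \<sigma> {u, v} * c v" using c e by (simp add: ok_def)
  qed
  then show "\<exists>c. L_coloring V E \<sigma> L c" using c by (auto simp: L_coloring_def ok_def)
qed

end
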